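(* Let $x\in\mathcal E$ be fixed and assume hypotheses (A1), (A2), (A3)(i), (A4)(i) and (A5) listed in the context. Then $$B_n(x)=\frac{M_0}{M_1}\Big(\sum_{k\in\mathbb N}\psi'_{k,x}(0)e_k\Big)h+o_{a.s.}(h)\ \text{ in }\mathcal H\qquad\text{and}\qquad R_n(x)=\mathcal O_{a.s.}\big(h(\log n)^{1/2}(n\phi(h))^{-1/2}\big)\ \text{ in }\mathcal H.$$
   Context: Setting. $\mathcal E$ is a space with a pseudometric $d$; $\mathcal H$ is a separable Hilbert space with inner product $\langle\cdot,\cdot\rangle$, norm $\|\cdot\|$ and orthonormal basis $\{e_k:k\in\mathbb N\}$, $\mathbb N=\{1,2,\dots\}$. $((X_{n,i},Y_{n,i}):1\le i\le n,\ n\in\mathbb N)$ is a triangular array of (possibly dependent) $\mathcal E\times\mathcal H$-valued pairs, all with the same distribution. For a generic pair $(X,Y)$: $r(x)=\mathbb E[Y|X=x]\in\mathcal H$, $r_v(x)=\mathbb E[\langle Y,v\rangle|X=x]$ for $v\in\mathcal H$. $\mathcal F_{n,i}=\sigma((X_{n,1},Y_{n,1}),\dots,(X_{n,i},Y_{n,i}))$, $\mathcal G_{n,i}=\sigma((X_{n,1},Y_{n,1}),\dots,(X_{n,i},Y_{n,i}),X_{n,i+1})$. $U(x,\delta)=\{y\in\mathcal E:d(x,y)\le\delta\}$. $F_x(u)=\mathbb P(d(x,X_{n,i})\le u)$, $F_x^{\mathcal F_{n,i-1}}(u)=\mathbb P(d(x,X_{n,i})\le u|\mathcal F_{n,i-1})$.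 $h=h_n>0$ and $b=b_n>0$ are bandwidths, $K$ a kernel, $\Delta_{n,h,i}(x)=K(d(x,X_{n,i})/h)$. Limits are for $n\to\infty$ unless stated otherwise. $o_{a.s.}$, $\mathcal O_{a.s.}$: the ratio (of the norm, for $\mathcal H$-valued quantities) to the given rate tends to $0$ a.s., resp. is a.s. bounded. $\|\cdot\|_{\mathbb P,\infty}$ is the essential supremum norm. Definitions. For $j=1,2$ (with $Y^0=1$), $$\hat r_{n,h,j}(x)=\frac{\sum_{i=1}^nY_{n,i}^{j-1}\Delta_{n,h,i}(x)}{n\,\mathbb E[\Delta_{1,h,1}(x)]},\quad \bar r_{n,h,j}(x)=\frac{\sum_{i=1}^n\mathbb E[Y_{n,i}^{j-1}\Delta_{n,h,i}(x)|\mathcal F_{n,i-1}]}{n\,\mathbb E[\Delta_{1,h,1}(x)]},$$ $B_n(x)=\bar r_{n,h,2}(x)/\bar r_{n,h,1}(x)-r(x)$ and $R_n(x)=-B_n(x)\,(\hat r_{n,h,1}(x)-\bar r_{n,h,1}(x))$. Constants: $M_0=K(1)-\int_0^1(K(s)s)'\tau_0(s)\,ds$, $M_1=K(1)-\int_0^1K'(s)\tau_0(s)\,ds$. Hypotheses ($y\in\mathcal E$; $n,k\in\mathbb N$; $1\le i\le n$). (A1) $K$ is a nonnegative bounded kernel, of class $C^1$ over its support $[0,1]$; $K'$ exists on $[0,1]$, $K'(t)\le0$ for all $t\in[0,1]$, and $K(1)>0$. (A2) (i) There are $\tilde L_{n,i}\in\mathbb R_+$ and $\alpha\in(0,1]$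 such that a.s. $|F^{\mathcal F_{n,i-1}}_{y_1}(u)-F^{\mathcal F_{n,i-1}}_{y_2}(u)|/F^{\mathcal F_{n,i-1}}_x(u)\le\tilde L_{n,i}d(y_1,y_2)^\alpha$ for all $y_1,y_2\in\mathcal E$, uniformly in $u$ in a neighborhood of $0$; moreover a.s. $[F_x^{\mathcal F_{n,i-1}}(u+\varepsilon)-F_x^{\mathcal F_{n,i-1}}(u-\varepsilon)]/F_x^{\mathcal F_{n,i-1}}(u)\le\tilde L_{n,i}\varepsilon u^{-1}$ for $0\le\varepsilon<u$ and $u$ in a neighborhood of $0$; $\limsup_n n^{-1}\sum_{i=1}^n\tilde L_{n,i}^2=\tilde L<\infty$. Further there are nonnegative bounded random functionals $f_{n,i,1}$, random functions $g_{n,i,y}$ ($y\in\mathcal E$), a deterministic nonnegative bounded functional $f_1$ and a nonnegative real function $\phi$ tending to $0$ as its argument tends to $0$ such that: (ii) $F_y(u)=\phi(u)f_1(y)+o(\phi(u))$ as $u\to0$, $y\in\mathcal E$. (iii) $F_y^{\mathcal F_{n,i-1}}(u)=\phi(u)f_{n,i,1}(y)+g_{n,i,y}(u)$ with $|g_{n,i,y}(u)|=o_{a.s.}(\phi(u))$, $n^{-1}\sum_{i=1}^n|g_{n,i,y}(u)|=o_{a.s.}(\phi(u))$ as $n\to\infty$, and for some $\delta>0$: $\|f_{n,i,1}(y)\|_{\mathbb P,\infty}\le\tilde L_{n,i}$ and $\phi(u)^{-1}\|g_{n,i,y}(u)\|_{\mathbb P,\infty}\le\tilde L_{n,i}$ for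 $u\le\delta$ and all $y\in U(x,\delta)$. (iv) $\lim_n n^{-1}\sum_{i=1}^nf_{n,i,1}(x)=f_1(x)>0$ a.s. (v) $\sup_{u\in[0,1]}|\phi(hu)/\phi(h)-\tau_0(u)|=o(1)$ as $h\downarrow0$ for some $\tau_0:[0,1]\to[0,1]$. (A3)(i) $\mathbb E[Y_{n,i}|\mathcal G_{n,i-1}]\equiv r(X_{n,i})$ a.s. (A4)(i) $r_{e_k}$ is continuous and $\mathbb E[r_{e_k}(X_{n,i})-r_{e_k}(y)|\mathcal F_{n,i-1},d(y,X_{n,i})=s]\equiv\psi_{k,y}(s)+\bar g_{k,n,i,y}(s)$, where $\psi_{k,y}$ is deterministic, $\bar g_{k,n,i,y}$ is random, $\psi_{k,y}(0)=0$, $\psi_{k,y}$ is differentiable (in $s$) in a neighborhood of $(y,s)=(x,0)$, $\psi'_{k,y}(0)\ne0$, with $\sup_{0\le u\le s,\,y\in U(x,s)}|\psi'_{k,y}(u)-\psi'_{k,x}(0)|\,s+\|\bar g_{k,n,i,y}(s)\|_{\mathbb P,\infty}\le L_ks^{1+\alpha}$ ($\alpha$ from (A2)) and $\sum_k(\psi'_{k,x}(0)^2+L_k^2)<\infty$. (A5) $h,b\to0$, $h/b\to0$, $(n\phi(h))^{1/2}(\log n)^{-[(2+\alpha)\vee(1/2)]}\to\infty$, $[\phi(h)/\phi(b)](\log n)^2=o(1)$, $h(n\phi(h))^{1/2}=\mathcal O(1)$, $b^{1+\alpha}(n\phi(h))^{1/2}=o(1)$, $b=o(h\sqrt{n\phi(h)})$,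 $h(\log n)^{1/2}=o(1)$. *)

theory Defs
  imports "HOL-Probability.Probability" "HOL-Library.Landau_Symbols"
begin

section \<open>Conditional expectations of Hilbert-space valued variables\<close>

text \<open>
  The library provides \<^const>\<open>real_cond_exp\<close> for real-valued functions only.  The following
  predicate says that \<open>Z\<close> is a version of the conditional expectation of the Bochner integrable
  \<open>W\<close> given the sub-sigma-algebra \<open>F\<close>.
\<close>

definition is_cond_exp ::
  "'w measure \<Rightarrow> 'w measure \<Rightarrow> ('w \<Rightarrow> 'h::{banach, second_countable_topology}) \<Rightarrow> ('w \<Rightarrow> 'h) \<Rightarrow> bool"
  where "is_cond_exp M F W Z \<longleftrightarrow>
    subalgebra M F \<and> integrable M W \<and> integrable M Z \<and> Z \<in> borel_measurable F \<and>
    (\<forall>A\<in>sets F. (LINT \<omega>:A|M. Z \<omega>) = (LINT \<omega>:A|M. W \<omega>))"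

text \<open>
  A chosen version; it exists and is unique up to null sets by the lemmas
  \<open>is_cond_exp_cond_exp\<close> and \<open>is_cond_exp_unique\<close> below.
\<close>

definition cond_exp ::
  "'w measure \<Rightarrow> 'w measure \<Rightarrow> ('w \<Rightarrow> 'h::{banach, second_countable_topology}) \<Rightarrow> 'w \<Rightarrow> 'h"
  where "cond_exp M F W = (SOME Z. is_cond_exp M F W Z)"

lemma is_cond_exp_real_iff:
  fixes W Z :: "'w \<Rightarrow> real"
  assumes "prob_space M" "subalgebra M F" "integrable M W"
  shows "is_cond_exp M F W Z \<longleftrightarrow>
    Z \<in> borel_measurable F \<and> (AE \<omega> in M. Z \<omega> = real_cond_exp M F W \<omega>)"
proof -
  interpret prob_space M by fact
  interpret finite_measure_subalgebra M F by unfold_locales fact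
  show ?thesis
  proof
    assume "is_cond_exp M F W Z"
    then have "AE \<omega> in M. real_cond_exp M F W \<omega> = Z \<omega>"
      by (intro real_cond_exp_charact) (auto simp: is_cond_exp_def)
    then show "Z \<in> borel_measurable F \<and> (AE \<omega> in M. Z \<omega> = real_cond_exp M F W \<omega>)"
      using \<open>is_cond_exp M F W Z\<close> by (auto simp: is_cond_exp_def)
  next
    assume Z: "Z \<in> borel_measurable F \<and> (AE \<omega> in M. Z \<omega> = real_cond_exp M F W \<omega>)"
    then have [measurable]: "Z \<in> borel_measurable M"
      using assms(2) measurable_from_subalg by blast
    have "integrable M (real_cond_exp M F W)"
      using assms(3) by (rule real_cond_exp_int)
    moreover have "AE \<omega> in M. real_cond_exp M F W \<omega> = Z \<omega>" using Z by auto
    ultimately have intZ: "integrable M Z"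
      by (subst integrable_cong_AE[where g = "real_cond_exp M F W"]) (use Z in auto)
    have "(LINT \<omega>:A|M. Z \<omega>) = (LINT \<omega>:A|M. W \<omega>)" if A: "A \<in> sets F" for A
    proof -
      have [measurable]: "A \<in> sets M" using A assms(2) by (auto simp: subalgebra_def)
      have "(LINT \<omega>:A|M. Z \<omega>) = (LINT \<omega>:A|M. real_cond_exp M F W \<omega>)"
        unfolding set_lebesgue_integral_def
        by (rule integral_cong_AE) (use Z in auto)
      also have "\<dots> = (LINT \<omega>:A|M. W \<omega>)"
        using real_cond_exp_intA[OF assms(3) A] by simp
      finally show ?thesis .
    qed
    then show "is_cond_exp M F W Z" using assms Z intZ by (auto simp: is_cond_exp_def)
  qed
qed

lemma is_cond_exp_inner:
  fixes W Z :: "'w \<Rightarrow> 'h::{real_inner, banach, second_countable_topology}"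
  assumes "is_cond_exp M F W Z"
  shows "is_cond_exp M F (\<lambda>\<omega>. W \<omega> \<bullet> v) (\<lambda>\<omega>. Z \<omega> \<bullet> v)"
proof -
  have sub: "subalgebra M F" and int: "integrable M W" "integrable M Z"
    and [measurable]: "Z \<in> borel_measurable F"
    and eq: "\<And>A. A \<in> sets F \<Longrightarrow> (LINT \<omega>:A|M. Z \<omega>) = (LINT \<omega>:A|M. W \<omega>)"
    using assms by (auto simp: is_cond_exp_def)
  have "(LINT \<omega>:A|M. Z \<omega> \<bullet> v) = (LINT \<omega>:A|M. W \<omega> \<bullet> v)" if A: "A \<in> sets F" for A
  proof -
    have AM: "A \<in> sets M" using A sub by (auto simp: subalgebra_def)
    have *: "(LINT \<omega>:A|M. V \<omega> \<bullet> v) = (LINT \<omega>:A|M. V \<omega>) \<bullet> v" if V: "integrable M V" for V :: "'w \<Rightarrow> 'h"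
    proof -
      have "integrable M (\<lambda>\<omega>. indicator A \<omega> *\<^sub>R V \<omega>)"
        using AM V by (rule integrable_mult_indicator)
      then have "(LINT \<omega>|M. (indicator A \<omega> *\<^sub>R V \<omega>) \<bullet> v) = (LINT \<omega>|M. indicator A \<omega> *\<^sub>R V \<omega>) \<bullet> v"
        by (intro integral_inner_left)
      then show ?thesis by (simp add: set_lebesgue_integral_def)
    qed
    show ?thesis using *[OF int(1)] *[OF int(2)] eq[OF A] by simp
  qed
  then show ?thesis using sub int by (auto simp: is_cond_exp_def)
qed

lemma is_cond_exp_add:
  assumes "is_cond_exp M F W Z" "is_cond_exp M F W' Z'"
  shows "is_cond_exp M F (\<lambda>\<omega>. W \<omega> + W' \<omega>) (\<lambda>\<omega>. Z \<omega> + Z' \<omega>)"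
  using assms unfolding is_cond_exp_def
  apply (auto simp: subalgebra_def)
  apply (subst (1 2) set_integral_add(2))
      apply (auto simp: set_integrable_def subset_iff intro!: integrable_mult_indicator)
  done

lemma is_cond_exp_diff:
  assumes "is_cond_exp M F W Z" "is_cond_exp M F W' Z'"
  shows "is_cond_exp M F (\<lambda>\<omega>. W \<omega> - W' \<omega>) (\<lambda>\<omega>. Z \<omega> - Z' \<omega>)"
  using assms unfolding is_cond_exp_def
  apply (auto simp: subalgebra_def)
  apply (subst (1 2) set_integral_diff(2))
      apply (auto simp: set_integrable_def subset_iff intro!: integrable_mult_indicator)
  done

lemma is_cond_exp_norm_le:
  fixes W Z :: "'w \<Rightarrow> 'h::{real_inner, banach, second_countable_topology}"
  assumes "prob_space M" and ce: "is_cond_exp M F W Z"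
  shows "AE \<omega> in M. norm (Z \<omega>) \<le> real_cond_exp M F (\<lambda>\<omega>. norm (W \<omega>)) \<omega>"
proof -
  interpret prob_space M by fact
  have sub: "subalgebra M F" and int: "integrable M W" "integrable M Z"
    using ce by (auto simp: is_cond_exp_def)
  interpret finite_measure_subalgebra M F by unfold_locales fact
  define N where "N = real_cond_exp M F (\<lambda>\<omega>. norm (W \<omega>))"
  obtain D :: "'h set" where D: "countable D" "\<And>X. open X \<Longrightarrow> X \<noteq> {} \<Longrightarrow> \<exists>v\<in>D. v \<in> X"
    using countable_dense_exists by blast
  have "AE \<omega> in M. Z \<omega> \<bullet> v \<le> norm v * N \<omega>" for v
  proof -
    have "AE \<omega> in M. Z \<omega> \<bullet> v = real_cond_exp M F (\<lambda>\<omega>. W \<omega> \<bullet> v) \<omega>"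
      using is_cond_exp_inner[OF ce, of v] is_cond_exp_real_iff[OF assms(1) sub] int by auto
    moreover have "AE \<omega> in M. real_cond_exp M F (\<lambda>\<omega>. W \<omega> \<bullet> v) \<omega>
        \<le> real_cond_exp M F (\<lambda>\<omega>. norm v * norm (W \<omega>)) \<omega>"
      using int by (intro real_cond_exp_mono)
        (auto intro!: AE_I2 simp: mult.commute[of "norm v"] norm_cauchy_schwarz)
    moreover have "AE \<omega> in M. real_cond_exp M F (\<lambda>\<omega>. norm v * norm (W \<omega>)) \<omega> = norm v * N \<omega>"
      unfolding N_def using int by (intro real_cond_exp_cmult) auto
    ultimately show ?thesis by eventually_elim auto
  qed
  then have "AE \<omega> in M. \<forall>v\<in>D. Z \<omega> \<bullet> v \<le> norm v * N \<omega>"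
    using D(1) by (subst AE_ball_countable) auto
  moreover have "AE \<omega> in M. N \<omega> \<ge> 0"
    unfolding N_def using int by (intro real_cond_exp_pos) auto
  ultimately show ?thesis
    unfolding N_def[symmetric]
  proof eventually_elim
    case (elim \<omega>)
    show ?case
    proof (rule ccontr)
      assume "\<not> norm (Z \<omega>) \<le> N \<omega>"
      then have "norm (Z \<omega>) > 0" "N \<omega> < norm (Z \<omega>)" using elim(2) by linarith+
      then have "norm (Z \<omega>) * N \<omega> < Z \<omega> \<bullet> Z \<omega>"
        by (simp add: dot_square_norm power2_eq_square)
      then have "Z \<omega> \<in> {v. norm v * N \<omega> < Z \<omega> \<bullet> v}" by simp
      moreover have "open {v. norm v * N \<omega> < Z \<omega> \<bullet> v}"
        by (intro open_Collect_less continuous_intros)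
      ultimately obtain v where "v \<in> D" "norm v * N \<omega> < Z \<omega> \<bullet> v"
        using D(2) by blast
      with elim(1) show False by force
    qed
  qed
qed

lemma is_cond_exp_L1_contraction:
  fixes W Z :: "'w \<Rightarrow> 'h::{real_inner, banach, second_countable_topology}"
  assumes "prob_space M" and ce: "is_cond_exp M F W Z"
  shows "(LINT \<omega>|M. norm (Z \<omega>)) \<le> (LINT \<omega>|M. norm (W \<omega>))"
proof -
  interpret prob_space M by fact
  have sub: "subalgebra M F" and int: "integrable M W" "integrable M Z"
    using ce by (auto simp: is_cond_exp_def)
  interpret finite_measure_subalgebra M F by unfold_locales fact
  have "(LINT \<omega>|M. norm (Z \<omega>)) \<le> (LINT \<omega>|M. real_cond_exp M F (\<lambda>\<omega>. norm (W \<omega>)) \<omega>)"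
    using is_cond_exp_norm_le[OF assms] int
    by (intro integral_mono_AE real_cond_exp_int) auto
  also have "\<dots> = (LINT \<omega>|M. norm (W \<omega>))"
    using int by (intro real_cond_exp_int) auto
  finally show ?thesis .
qed

lemma is_cond_exp_unique:
  fixes W Z Z' :: "'w \<Rightarrow> 'h::{real_inner, banach, second_countable_topology}"
  assumes "prob_space M" "is_cond_exp M F W Z" "is_cond_exp M F W Z'"
  shows "AE \<omega> in M. Z \<omega> = Z' \<omega>"
proof -
  have *: "is_cond_exp M F (\<lambda>\<omega>. W \<omega> - W \<omega>) (\<lambda>\<omega>. Z \<omega> - Z' \<omega>)"
    using assms(2,3) by (rule is_cond_exp_diff)
  have "(LINT \<omega>|M. norm (Z \<omega> - Z' \<omega>)) \<le> 0"
    using is_cond_exp_L1_contraction[OF assms(1) *] by simp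
  then have "(LINT \<omega>|M. norm (Z \<omega> - Z' \<omega>)) = 0"
    by (intro antisym Bochner_Integration.integral_nonneg) auto
  moreover have "integrable M (\<lambda>\<omega>. norm (Z \<omega> - Z' \<omega>))"
    using * by (auto simp: is_cond_exp_def)
  ultimately have "AE \<omega> in M. norm (Z \<omega> - Z' \<omega>) = 0"
    using integral_nonneg_eq_0_iff_AE[of M "\<lambda>\<omega>. norm (Z \<omega> - Z' \<omega>)"] by auto
  then show ?thesis by auto
qed

lemma is_cond_exp_ex:
  fixes W :: "'w \<Rightarrow> 'h::{real_inner, banach, second_countable_topology}"
  assumes "prob_space M" and sub: "subalgebra M F" and "integrable M W"
  shows "\<exists>Z. is_cond_exp M F W Z"
  using assms(3)
proof (induction rule: integrable_induct)
  case (base A c)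
  interpret prob_space M by fact
  interpret finite_measure_subalgebra M F by unfold_locales fact
  define p where "p = real_cond_exp M F (indicator A)"
  have intA: "integrable M (indicator A :: 'w \<Rightarrow> real)" using base by simp
  have p: "is_cond_exp M F (indicator A) p"
    using is_cond_exp_real_iff[OF assms(1) sub intA] by (auto simp: p_def)
  have "(LINT \<omega>:B|M. p \<omega> *\<^sub>R c) = (LINT \<omega>:B|M. indicator A \<omega> *\<^sub>R c)" if "B \<in> sets F" for B
  proof -
    have "B \<in> sets M" using that sub by (auto simp: subalgebra_def)
    have "(LINT \<omega>:B|M. q \<omega> *\<^sub>R c) = (LINT \<omega>:B|M. q \<omega>) *\<^sub>R c"
      if "integrable M q" for q :: "'w \<Rightarrow> real"
      using integrable_mult_indicator[OF \<open>B \<in> sets M\<close> that]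
      by (simp add: set_lebesgue_integral_def flip: integral_scaleR_left)
    then show ?thesis using p intA that by (simp add: is_cond_exp_def)
  qed
  then have "is_cond_exp M F (\<lambda>\<omega>. indicator A \<omega> *\<^sub>R c) (\<lambda>\<omega>. p \<omega> *\<^sub>R c)"
    using p by (auto simp: is_cond_exp_def)
  then show ?case by blast
next
  case (add f g)
  then show ?case using is_cond_exp_add by fast
next
  case (lim f s)
  then obtain Z where Z: "\<And>i. is_cond_exp M F (s i) (Z i)" by metis
  have [measurable]: "\<And>i. Z i \<in> borel_measurable F" and intZ: "\<And>i. integrable M (Z i)"
    using Z by (auto simp: is_cond_exp_def)
  have L1: "(\<lambda>i. LINT \<omega>|M. norm (s i \<omega> - f \<omega>)) \<longlonglongrightarrow> (LINT \<omega>|M. norm (f \<omega> - f \<omega>))"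
  proof (rule integral_dominated_convergence[where w = "\<lambda>\<omega>. 3 * norm (f \<omega>)"])
    show "AE \<omega> in M. (\<lambda>i. norm (s i \<omega> - f \<omega>)) \<longlonglongrightarrow> norm (f \<omega> - f \<omega>)"
      using lim(2) by (intro AE_I2 tendsto_intros)
    show "AE \<omega> in M. norm (norm (s i \<omega> - f \<omega>)) \<le> 3 * norm (f \<omega>)" for i
    proof (rule AE_I2)
      fix \<omega> assume "\<omega> \<in> space M"
      then show "norm (norm (s i \<omega> - f \<omega>)) \<le> 3 * norm (f \<omega>)"
        using lim(3)[of \<omega> i] norm_triangle_ineq4[of "s i \<omega>" "f \<omega>"] by simp
    qed
  qed (use lim(1,4) in auto)
  then have L1: "(\<lambda>i. LINT \<omega>|M. norm (s i \<omega> - f \<omega>)) \<longlonglongrightarrow> 0" by simp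
  have int_diff: "integrable M (\<lambda>\<omega>. norm (s i \<omega> - f \<omega>))" for i using lim(1,4) by auto
  have ZZ: "(LINT \<omega>|M. norm (Z i \<omega> - Z j \<omega>)) \<le>
      (LINT \<omega>|M. norm (s i \<omega> - f \<omega>)) + (LINT \<omega>|M. norm (s j \<omega> - f \<omega>))" for i j
  proof -
    have "(LINT \<omega>|M. norm (Z i \<omega> - Z j \<omega>)) \<le> (LINT \<omega>|M. norm (s i \<omega> - s j \<omega>))"
      using is_cond_exp_L1_contraction[OF assms(1) is_cond_exp_diff[OF Z[of i] Z[of j]]] .
    also have "\<dots> \<le> (LINT \<omega>|M. norm (s i \<omega> - f \<omega>) + norm (s j \<omega> - f \<omega>))"
      using lim(1,4)
    proof (intro integral_mono)
      fix \<omega> show "norm (s i \<omega> - s j \<omega>) \<le> norm (s i \<omega> - f \<omega>) + norm (s j \<omega> - f \<omega>)"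
        using norm_triangle_ineq4[of "s i \<omega> - f \<omega>" "s j \<omega> - f \<omega>"] by simp
    qed auto
    also have "\<dots> = (LINT \<omega>|M. norm (s i \<omega> - f \<omega>)) + (LINT \<omega>|M. norm (s j \<omega> - f \<omega>))"
      using int_diff by simp
    finally show ?thesis .
  qed
  have Cau: "\<exists>N. \<forall>i\<ge>N. \<forall>j\<ge>N. (LINT \<omega>|M. norm (Z i \<omega> - Z j \<omega>)) < e" if "e > 0" for e
  proof -
    have "e / 2 > 0" using that by simp
    then obtain N where N: "\<And>i. i \<ge> N \<Longrightarrow> (LINT \<omega>|M. norm (s i \<omega> - f \<omega>)) < e / 2"
      using order_tendstoD(2)[OF L1] unfolding eventually_sequentially by blast
    show ?thesis
    proof (intro exI[of _ N] allI impI)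
      fix i j assume "N \<le> i" "N \<le> j"
      then show "(LINT \<omega>|M. norm (Z i \<omega> - Z j \<omega>)) < e"
        using ZZ[of i j] N[of i] N[of j] by linarith
    qed
  qed
  obtain \<rho> where \<rho>: "strict_mono \<rho>" "AE \<omega> in M. Cauchy (\<lambda>i. Z (\<rho> i) \<omega>)"
    using cauchy_L1_AE_cauchy_subseq[OF intZ Cau] by blast
  define Y where "Y \<omega> = lim (\<lambda>i. Z (\<rho> i) \<omega>)" for \<omega>
  have YF [measurable]: "Y \<in> borel_measurable F"
    unfolding Y_def by (rule borel_measurable_lim_metric) simp
  have YM [measurable]: "Y \<in> borel_measurable M" using measurable_from_subalg[OF sub YF] .
  have [measurable]: "Z i \<in> borel_measurable M" for i using intZ by auto
  have conv: "AE \<omega> in M. (\<lambda>i. Z (\<rho> i) \<omega>) \<longlonglongrightarrow> Y \<omega>"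
    using \<rho>(2) by eventually_elim
      (simp add: Y_def Cauchy_convergent_iff convergent_LIMSEQ_iff)
  have dist: "(\<integral>\<^sup>+\<omega>. norm (Y \<omega> - Z (\<rho> i) \<omega>) \<partial>M) \<le> ennreal e"
    if e: "\<And>j. j \<ge> i \<Longrightarrow> (LINT \<omega>|M. norm (Z (\<rho> j) \<omega> - Z (\<rho> i) \<omega>)) \<le> e" for i e
  proof -
    have "(\<integral>\<^sup>+\<omega>. norm (Y \<omega> - Z (\<rho> i) \<omega>) \<partial>M)
        = (\<integral>\<^sup>+\<omega>. liminf (\<lambda>j. ennreal (norm (Z (\<rho> j) \<omega> - Z (\<rho> i) \<omega>))) \<partial>M)"
    proof (rule nn_integral_cong_AE, use conv in eventually_elim)
      case (elim \<omega>)
      then have "(\<lambda>j. ennreal (norm (Z (\<rho> j) \<omega> - Z (\<rho> i) \<omega>))) \<longlonglongrightarrow> ennreal (norm (Y \<omega> - Z (\<rho> i) \<omega>))"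
        by (intro tendsto_intros)
      then show ?case by (intro lim_imp_Liminf[symmetric]) simp_all
    qed
    also have "\<dots> \<le> liminf (\<lambda>j. \<integral>\<^sup>+\<omega>. ennreal (norm (Z (\<rho> j) \<omega> - Z (\<rho> i) \<omega>)) \<partial>M)"
      by (rule nn_integral_liminf) measurable
    also have "\<dots> \<le> liminf (\<lambda>j::nat. ennreal e)"
    proof (rule Liminf_mono, rule eventually_sequentiallyI[of i])
      fix j assume "i \<le> j"
      have "(\<integral>\<^sup>+\<omega>. ennreal (norm (Z (\<rho> j) \<omega> - Z (\<rho> i) \<omega>)) \<partial>M)
          = ennreal (LINT \<omega>|M. norm (Z (\<rho> j) \<omega> - Z (\<rho> i) \<omega>))"
        using intZ by (intro nn_integral_eq_integral) auto
      then show "(\<integral>\<^sup>+\<omega>. ennreal (norm (Z (\<rho> j) \<omega> - Z (\<rho> i) \<omega>)) \<partial>M) \<le> ennreal e"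
        using e[OF \<open>i \<le> j\<close>] by (simp add: ennreal_leI)
    qed
    also have "\<dots> = ennreal e" by (simp add: Liminf_const)
    finally show ?thesis .
  qed
  have close: "\<exists>N. \<forall>i\<ge>N. (\<integral>\<^sup>+\<omega>. norm (Y \<omega> - Z (\<rho> i) \<omega>) \<partial>M) \<le> ennreal e" if e: "e > 0" for e
  proof -
    obtain N where N: "\<And>i j. i \<ge> N \<Longrightarrow> j \<ge> N \<Longrightarrow> (LINT \<omega>|M. norm (Z i \<omega> - Z j \<omega>)) < e"
      using Cau[OF e] by blast
    show ?thesis
    proof (intro exI[of _ N] allI impI dist)
      fix i j assume "N \<le> i" "i \<le> j"
      then show "(LINT \<omega>|M. norm (Z (\<rho> j) \<omega> - Z (\<rho> i) \<omega>)) \<le> e"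
        using N[of "\<rho> j" "\<rho> i"] seq_suble[OF \<rho>(1), of i] seq_suble[OF \<rho>(1), of j] by force
    qed
  qed
  have intY: "integrable M Y"
  proof -
    obtain N where "(\<integral>\<^sup>+\<omega>. norm (Y \<omega> - Z (\<rho> N) \<omega>) \<partial>M) \<le> ennreal 1"
      using close[of 1] by auto
    then have "integrable M (\<lambda>\<omega>. Y \<omega> - Z (\<rho> N) \<omega>)"
      by (intro integrableI_bounded) (auto intro: le_less_trans)
    from Bochner_Integration.integrable_add[OF this intZ[of "\<rho> N"]] show ?thesis by simp
  qed
  have L1Y: "(\<lambda>i. LINT \<omega>|M. norm (Z (\<rho> i) \<omega> - Y \<omega>)) \<longlonglongrightarrow> 0"
  proof (rule LIMSEQ_I)
    fix e :: real assume "e > 0"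
    then obtain N where N: "\<And>i. i \<ge> N \<Longrightarrow> (\<integral>\<^sup>+\<omega>. norm (Y \<omega> - Z (\<rho> i) \<omega>) \<partial>M) \<le> ennreal (e/2)"
      using close[of "e/2"] by auto
    have "norm ((LINT \<omega>|M. norm (Z (\<rho> i) \<omega> - Y \<omega>)) - 0) < e" if "i \<ge> N" for i
    proof -
      have "ennreal (LINT \<omega>|M. norm (Y \<omega> - Z (\<rho> i) \<omega>)) = (\<integral>\<^sup>+\<omega>. norm (Y \<omega> - Z (\<rho> i) \<omega>) \<partial>M)"
        using intZ intY by (intro nn_integral_eq_integral[symmetric]) auto
      then have "ennreal (LINT \<omega>|M. norm (Y \<omega> - Z (\<rho> i) \<omega>)) \<le> ennreal (e/2)"
        using N[OF that] by simp
      then have "(LINT \<omega>|M. norm (Y \<omega> - Z (\<rho> i) \<omega>)) \<le> e/2"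
        using \<open>e > 0\<close> by (subst (asm) ennreal_le_iff) auto
      then show ?thesis using \<open>e > 0\<close> by (simp add: norm_minus_commute)
    qed
    then show "\<exists>N. \<forall>i\<ge>N. norm ((LINT \<omega>|M. norm (Z (\<rho> i) \<omega> - Y \<omega>)) - 0) < e" by blast
  qed
  have set_lim: "(\<lambda>i. LINT \<omega>:A|M. V i \<omega>) \<longlonglongrightarrow> (LINT \<omega>:A|M. U \<omega>)"
    if A: "A \<in> sets M" and V: "\<And>i. integrable M (V i)" "integrable M U"
      and L: "(\<lambda>i. LINT \<omega>|M. norm (V i \<omega> - U \<omega>)) \<longlonglongrightarrow> 0" for A U and V :: "nat \<Rightarrow> 'w \<Rightarrow> 'h"
  proof -
    have "norm ((LINT \<omega>:A|M. V i \<omega>) - (LINT \<omega>:A|M. U \<omega>)) \<le> (LINT \<omega>|M. norm (V i \<omega> - U \<omega>))" for i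
    proof -
      have "(LINT \<omega>:A|M. V i \<omega>) - (LINT \<omega>:A|M. U \<omega>) = (LINT \<omega>:A|M. V i \<omega> - U \<omega>)"
        using A V by (intro set_integral_diff(2)[symmetric])
          (auto simp: set_integrable_def intro!: integrable_mult_indicator)
      also have "norm \<dots> \<le> (LINT \<omega>|M. norm (indicator A \<omega> *\<^sub>R (V i \<omega> - U \<omega>)))"
        unfolding set_lebesgue_integral_def by (rule integral_norm_bound)
      also have "\<dots> \<le> (LINT \<omega>|M. norm (V i \<omega> - U \<omega>))"
        using A V by (intro integral_mono integrable_norm integrable_mult_indicator)
          (auto simp: indicator_def)
      finally show ?thesis .
    qed
    then show ?thesis
      by (intro LIM_zero_cancel[OF Lim_null_comparison[OF _ L]] always_eventually) auto
  qed
  have "(LINT \<omega>:A|M. Y \<omega>) = (LINT \<omega>:A|M. f \<omega>)" if A: "A \<in> sets F" for A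
  proof -
    have AM: "A \<in> sets M" using A sub by (auto simp: subalgebra_def)
    have "(\<lambda>i. LINT \<omega>:A|M. Z (\<rho> i) \<omega>) \<longlonglongrightarrow> (LINT \<omega>:A|M. Y \<omega>)"
      by (rule set_lim[OF AM intZ intY L1Y])
    moreover have "(\<lambda>i. LINT \<omega>:A|M. s (\<rho> i) \<omega>) \<longlonglongrightarrow> (LINT \<omega>:A|M. f \<omega>)"
      using LIMSEQ_subseq_LIMSEQ[OF L1 \<rho>(1)]
      by (intro set_lim[OF AM] lim(1) lim(4)) (simp add: o_def)
    moreover have "(LINT \<omega>:A|M. Z (\<rho> i) \<omega>) = (LINT \<omega>:A|M. s (\<rho> i) \<omega>)" for i
      using Z[of "\<rho> i"] A by (auto simp: is_cond_exp_def)
    ultimately show ?thesis using LIMSEQ_unique by simp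
  qed
  then have "is_cond_exp M F f Y"
    using sub lim(4) intY by (auto simp: is_cond_exp_def)
  then show ?case by blast
qed

lemma is_cond_exp_cond_exp:
  fixes W :: "'w \<Rightarrow> 'h::{real_inner, banach, second_countable_topology}"
  assumes "prob_space M" "subalgebra M F" "integrable M W"
  shows "is_cond_exp M F W (cond_exp M F W)"
  unfolding cond_exp_def using someI_ex[OF is_cond_exp_ex[OF assms]] .

section \<open>The regression setting\<close>

definition pseudometric :: "('e \<Rightarrow> 'e \<Rightarrow> real) \<Rightarrow> bool"
  where "pseudometric d \<longleftrightarrow>
    (\<forall>x. d x x = 0) \<and> (\<forall>x y. 0 \<le> d x y) \<and> (\<forall>x y. d x y = d y x) \<and>
    (\<forall>x y z. d x z \<le> d x y + d y z)"

definition pm_cball :: "('e \<Rightarrow> 'e \<Rightarrow> real) \<Rightarrow> 'e \<Rightarrow> real \<Rightarrow> 'e set"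
  where "pm_cball d x \<delta> = {y. d x y \<le> \<delta>}"

definition pm_continuous :: "('e \<Rightarrow> 'e \<Rightarrow> real) \<Rightarrow> ('e \<Rightarrow> real) \<Rightarrow> bool"
  where "pm_continuous d f \<longleftrightarrow>
    (\<forall>y. \<forall>\<epsilon>>0. \<exists>\<delta>>0. \<forall>z. d y z < \<delta> \<longrightarrow> \<bar>f z - f y\<bar> < \<epsilon>)"

definition orthonormal_basis :: "(nat \<Rightarrow> 'h::real_inner) \<Rightarrow> bool"
  where "orthonormal_basis e \<longleftrightarrow>
    (\<forall>j k. e j \<bullet> e k = (if j = k then 1 else 0)) \<and> closure (span (range e)) = UNIV"

definition Linf_norm :: "'w measure \<Rightarrow> ('w \<Rightarrow> real) \<Rightarrow> ereal"
  where "Linf_norm M f = esssup M (\<lambda>\<omega>. ereal \<bar>f \<omega>\<bar>)"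

text \<open>
  \<open>r\<close> is a version of the regression function \<open>x \<mapsto> E[W | X = x]\<close>, where \<open>S\<close> is the measurable
  space in which \<open>X\<close> takes its values.
\<close>

definition is_regression ::
  "'w measure \<Rightarrow> 'e measure \<Rightarrow> ('w \<Rightarrow> 'e) \<Rightarrow> ('w \<Rightarrow> 'h::{banach, second_countable_topology})
    \<Rightarrow> ('e \<Rightarrow> 'h) \<Rightarrow> bool"
  where "is_regression M S X W r \<longleftrightarrow>
    r \<in> borel_measurable S \<and>
    is_cond_exp M (vimage_algebra (space M) X S) W (\<lambda>\<omega>. r (X \<omega>))"

text \<open>
  The sigma-algebras \<open>\<F>\<^sub>n\<^sub>,\<^sub>i\<close>, \<open>\<G>\<^sub>n\<^sub>,\<^sub>i\<close>, and the one generated by \<open>\<F>\<^sub>n\<^sub>,\<^sub>i\<^sub>-\<^sub>1\<close> and \<open>d(y, X\<^sub>n\<^sub>,\<^sub>i)\<close>.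
  In particular \<open>\<F>\<^sub>n\<^sub>,\<^sub>0\<close> is trivial.
\<close>

definition Fsig ::
  "'w measure \<Rightarrow> 'e measure \<Rightarrow> (nat \<Rightarrow> nat \<Rightarrow> 'w \<Rightarrow> 'e) \<Rightarrow> (nat \<Rightarrow> nat \<Rightarrow> 'w \<Rightarrow> 'h::topological_space)
    \<Rightarrow> nat \<Rightarrow> nat \<Rightarrow> 'w measure"
  where "Fsig M S X Y n i = sigma (space M)
    (\<Union>j\<in>{1..i}. sets (vimage_algebra (space M) (\<lambda>\<omega>. (X n j \<omega>, Y n j \<omega>)) (S \<Otimes>\<^sub>M borel)))"

definition Gsig ::
  "'w measure \<Rightarrow> 'e measure \<Rightarrow> (nat \<Rightarrow> nat \<Rightarrow> 'w \<Rightarrow> 'e) \<Rightarrow> (nat \<Rightarrow> nat \<Rightarrow> 'w \<Rightarrow> 'h::topological_space)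
    \<Rightarrow> nat \<Rightarrow> nat \<Rightarrow> 'w measure"
  where "Gsig M S X Y n i = sigma (space M)
    (sets (Fsig M S X Y n i) \<union> sets (vimage_algebra (space M) (X n (i + 1)) S))"

definition FDsig ::
  "'w measure \<Rightarrow> 'e measure \<Rightarrow> ('e \<Rightarrow> 'e \<Rightarrow> real) \<Rightarrow> (nat \<Rightarrow> nat \<Rightarrow> 'w \<Rightarrow> 'e)
    \<Rightarrow> (nat \<Rightarrow> nat \<Rightarrow> 'w \<Rightarrow> 'h::topological_space) \<Rightarrow> 'e \<Rightarrow> nat \<Rightarrow> nat \<Rightarrow> 'w measure"
  where "FDsig M S d X Y y n i = sigma (space M)
    (sets (Fsig M S X Y n (i - 1)) \<union>
     sets (vimage_algebra (space M) (\<lambda>\<omega>. d y (X n i \<omega>)) (borel :: real measure)))"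

text \<open>The small ball function \<open>F\<^sub>y(u)\<close>; the \<open>X\<^sub>n\<^sub>,\<^sub>i\<close> are identically distributed.\<close>

definition small_ball ::
  "'w measure \<Rightarrow> ('e \<Rightarrow> 'e \<Rightarrow> real) \<Rightarrow> (nat \<Rightarrow> nat \<Rightarrow> 'w \<Rightarrow> 'e) \<Rightarrow> 'e \<Rightarrow> real \<Rightarrow> real"
  where "small_ball M d X y u = measure M {\<omega> \<in> space M. d y (X 1 1 \<omega>) \<le> u}"

definition Delta ::
  "('e \<Rightarrow> 'e \<Rightarrow> real) \<Rightarrow> (real \<Rightarrow> real) \<Rightarrow> (nat \<Rightarrow> nat \<Rightarrow> 'w \<Rightarrow> 'e) \<Rightarrow> 'e \<Rightarrow> real
    \<Rightarrow> nat \<Rightarrow> nat \<Rightarrow> 'w \<Rightarrow> real"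
  where "Delta d K X x h n i \<omega> = K (d x (X n i \<omega>) / h)"

definition rhat1 ::
  "'w measure \<Rightarrow> ('e \<Rightarrow> 'e \<Rightarrow> real) \<Rightarrow> (real \<Rightarrow> real) \<Rightarrow> (nat \<Rightarrow> nat \<Rightarrow> 'w \<Rightarrow> 'e) \<Rightarrow> 'e
    \<Rightarrow> (nat \<Rightarrow> real) \<Rightarrow> nat \<Rightarrow> 'w \<Rightarrow> real"
  where "rhat1 M d K X x h n \<omega> =
    (\<Sum>i=1..n. Delta d K X x (h n) n i \<omega>) /
    (real n * (LINT \<omega>'|M. Delta d K X x (h n) 1 1 \<omega>'))"

definition rbar1 ::
  "'w measure \<Rightarrow> 'e measure \<Rightarrow> ('e \<Rightarrow> 'e \<Rightarrow> real) \<Rightarrow> (real \<Rightarrow> real) \<Rightarrow> (nat \<Rightarrow> nat \<Rightarrow> 'w \<Rightarrow> 'e)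
    \<Rightarrow> (nat \<Rightarrow> nat \<Rightarrow> 'w \<Rightarrow> 'h::topological_space) \<Rightarrow> 'e \<Rightarrow> (nat \<Rightarrow> real) \<Rightarrow> nat \<Rightarrow> 'w \<Rightarrow> real"
  where "rbar1 M S d K X Y x h n \<omega> =
    (\<Sum>i=1..n. real_cond_exp M (Fsig M S X Y n (i - 1)) (Delta d K X x (h n) n i) \<omega>) /
    (real n * (LINT \<omega>'|M. Delta d K X x (h n) 1 1 \<omega>'))"

definition rbar2 ::
  "'w measure \<Rightarrow> 'e measure \<Rightarrow> ('e \<Rightarrow> 'e \<Rightarrow> real) \<Rightarrow> (real \<Rightarrow> real) \<Rightarrow> (nat \<Rightarrow> nat \<Rightarrow> 'w \<Rightarrow> 'e)
    \<Rightarrow> (nat \<Rightarrow> nat \<Rightarrow> 'w \<Rightarrow> 'h::{banach, second_countable_topology}) \<Rightarrow> 'e \<Rightarrow> (nat \<Rightarrow> real)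
    \<Rightarrow> nat \<Rightarrow> 'w \<Rightarrow> 'h"
  where "rbar2 M S d K X Y x h n \<omega> =
    (\<Sum>i=1..n. cond_exp M (Fsig M S X Y n (i - 1))
        (\<lambda>\<omega>'. Delta d K X x (h n) n i \<omega>' *\<^sub>R Y n i \<omega>') \<omega>) /\<^sub>R
    (real n * (LINT \<omega>'|M. Delta d K X x (h n) 1 1 \<omega>'))"

definition Bn ::
  "'w measure \<Rightarrow> 'e measure \<Rightarrow> ('e \<Rightarrow> 'e \<Rightarrow> real) \<Rightarrow> (real \<Rightarrow> real) \<Rightarrow> (nat \<Rightarrow> nat \<Rightarrow> 'w \<Rightarrow> 'e)
    \<Rightarrow> (nat \<Rightarrow> nat \<Rightarrow> 'w \<Rightarrow> 'h::{banach, second_countable_topology}) \<Rightarrow> ('e \<Rightarrow> 'h) \<Rightarrow> 'e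
    \<Rightarrow> (nat \<Rightarrow> real) \<Rightarrow> nat \<Rightarrow> 'w \<Rightarrow> 'h"
  where "Bn M S d K X Y r x h n \<omega> =
    rbar2 M S d K X Y x h n \<omega> /\<^sub>R rbar1 M S d K X Y x h n \<omega> - r x"

definition Rn ::
  "'w measure \<Rightarrow> 'e measure \<Rightarrow> ('e \<Rightarrow> 'e \<Rightarrow> real) \<Rightarrow> (real \<Rightarrow> real) \<Rightarrow> (nat \<Rightarrow> nat \<Rightarrow> 'w \<Rightarrow> 'e)
    \<Rightarrow> (nat \<Rightarrow> nat \<Rightarrow> 'w \<Rightarrow> 'h::{banach, second_countable_topology}) \<Rightarrow> ('e \<Rightarrow> 'h) \<Rightarrow> 'e
    \<Rightarrow> (nat \<Rightarrow> real) \<Rightarrow> nat \<Rightarrow> 'w \<Rightarrow> 'h"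
  where "Rn M S d K X Y r x h n \<omega> =
    (rhat1 M d K X x h n \<omega> - rbar1 M S d K X Y x h n \<omega>) *\<^sub>R (- Bn M S d K X Y r x h n \<omega>)"

text \<open>
  Derivatives on \<open>[0,1]\<close> are taken within \<open>[0,1]\<close>, i.e. one-sided at the end points, since the
  kernel jumps at \<open>1\<close>.
\<close>

definition deriv01 :: "(real \<Rightarrow> real) \<Rightarrow> real \<Rightarrow> real"
  where "deriv01 f s = vector_derivative f (at s within {0..1})"

definition M0 :: "(real \<Rightarrow> real) \<Rightarrow> (real \<Rightarrow> real) \<Rightarrow> real"
  where "M0 K \<tau> = K 1 - integral {0..1} (\<lambda>s. deriv01 (\<lambda>t. K t * t) s * \<tau> s)"

definition M1 :: "(real \<Rightarrow> real) \<Rightarrow> (real \<Rightarrow> real) \<Rightarrow> real"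
  where "M1 K \<tau> = K 1 - integral {0..1} (\<lambda>s. deriv01 K s * \<tau> s)"

text \<open>Derivative of a function of a distance \<open>s \<ge> 0\<close>; one-sided at \<open>0\<close>.\<close>

definition deriv_nonneg :: "(real \<Rightarrow> real) \<Rightarrow> real \<Rightarrow> real"
  where "deriv_nonneg f s = vector_derivative f (at s within {0..})"

end

theory Submission
  imports Defs
begin

text \<open>
  Write \<open>D\<^sub>i\<close> for the distance of \<open>X\<^sub>n\<^sub>,\<^sub>i\<close> to \<open>x\<close>, and \<open>p\<^sub>i\<close>, \<open>q\<^sub>i\<close>, \<open>Z\<^sub>i\<close> for the conditional means of
  \<open>K(D\<^sub>i/h)\<close>, \<open>K(D\<^sub>i/h) D\<^sub>i/h\<close> and \<open>K(D\<^sub>i/h) Y\<^sub>n\<^sub>,\<^sub>i\<close> given the past.  The normalisation cancels in \<open>B\<^sub>n\<close>, which is the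
  \<open>p\<close>-weighted mean of the conditional increments of the regression function.

  \<^emph>\<open>Linearisation.\<close>  By (A3) the response may be replaced by \<open>r(X\<^sub>n\<^sub>,\<^sub>i)\<close>, and by (A4) the increments of
  its \<open>k\<close>-th coordinate by \<open>\<psi>\<^sub>k(D\<^sub>i)\<close> plus a random error evaluated at the random radius \<open>D\<^sub>i\<close>.  The
  error is controlled almost surely at each fixed radius only.  That suffices because (A2)(i) makes
  the conditional distribution function of \<open>D\<^sub>i\<close> Lipschitz away from \<open>0\<close>, so that the joint law of
  \<open>(\<omega>, D\<^sub>i)\<close> does not charge measurable sets with null sections (\<open>AE_substitution_avoids_null_sections\<close>,
  \<open>AE_bound_at_random_radius\<close>).  Hence each coordinate equals \<open>\<psi>\<^sub>k'(0) h q\<^sub>i\<close> up to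
  \<open>2 L\<^sub>k h\<^sup>1\<^sup>+\<^sup>\<alpha> p\<^sub>i\<close> (\<open>conditional_coordinate_bound\<close>), and square summability of \<open>L\<^sub>k\<close> turns this into
  a bound in norm (\<open>norm_le_of_coefficients_le\<close>).  So \<open>B\<^sub>n\<close> is \<open>h (\<Sum>q\<^sub>i / \<Sum>p\<^sub>i)\<close> times the vector of
  derivatives, up to \<open>O(h\<^sup>1\<^sup>+\<^sup>\<alpha>)\<close>.

  \<^emph>\<open>The constants.\<close>  A \<open>C\<^sup>1\<close> kernel is a mixture of indicators of balls, so kernel means are mixtures
  of small ball probabilities, and \<open>\<phi>(h s)/\<phi>(h) \<rightarrow> \<tau>\<^sub>0(s)\<close> gives the limits \<open>M\<^sub>1 f\<^sub>1(x)\<close> and \<open>M\<^sub>0 f\<^sub>1(x)\<close>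
  for the kernels \<open>K(t)\<close> and \<open>t K(t)\<close> (\<open>kernel_mean_limit\<close>).  Conditional ball probabilities are given
  up to null sets that depend on the radius, so the mixture cannot be formed pathwise; for the
  row averages of \<open>p\<^sub>i\<close> and \<open>q\<^sub>i\<close> step functions with finitely many radii take its place
  (\<open>conditional_kernel_average_limit\<close>).

  \<^emph>\<open>The remainder.\<close>  \<open>R\<^sub>n\<close> is the product of \<open>B\<^sub>n = O(h)\<close> and of a normalised sum of martingale
  differences, whose conditional variances add up to at most \<open>sup K \<cdot> \<Sum>p\<^sub>i = O(n \<phi>(h))\<close>.  An exponential
  supermartingale and the Borel-Cantelli lemma bound the sum by
  \<open>O((ln n \<cdot> n \<phi>(h))\<^sup>1\<^sup>/\<^sup>2)\<close> (\<open>centred_triangular_sum_bigo\<close>).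
\<close>

section \<open>Coefficients with respect to an orthonormal basis\<close>

text \<open>Half of Parseval's identity.  An element of the span close to \<open>v\<close> involves finitely many basis
  vectors, and the partial Fourier sum \<open>p\<close> of \<open>v\<close> over these is at least as close, because \<open>v - p\<close> is
  orthogonal to both.\<close>

lemma norm_le_of_coefficients_le:
  fixes e :: "nat \<Rightarrow> 'h::{real_inner, banach}" and v :: 'h
  assumes e: "orthonormal_basis e"
    and le: "\<And>k. \<bar>v \<bullet> e k\<bar> \<le> c k" and c: "summable (\<lambda>k. (c k)\<^sup>2)"
  shows "norm v \<le> sqrt (\<Sum>k. (c k)\<^sup>2)"
proof (rule field_le_epsilon)
  fix \<epsilon> :: real assume "\<epsilon> > 0"
  have on: "e j \<bullet> e k = (if j = k then 1 else 0)" for j k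
    using e by (simp add: orthonormal_basis_def)
  have "v \<in> closure (span (range e))" using e by (simp add: orthonormal_basis_def)
  then obtain u where u: "u \<in> span (range e)" "dist u v < \<epsilon>"
    using \<open>\<epsilon> > 0\<close> unfolding closure_approachable by blast
  have "\<exists>N. \<forall>w. (\<forall>k<N. w \<bullet> e k = 0) \<longrightarrow> w \<bullet> u = 0"
    using u(1)
  proof (induction rule: span_induct_alt)
    case base
    show ?case by simp
  next
    case (step a x y)
    from step(1) obtain j where "x = e j" by blast
    from step(2) obtain N where N: "\<forall>w. (\<forall>k<N. w \<bullet> e k = 0) \<longrightarrow> w \<bullet> y = 0" by blast
    have "w \<bullet> (a *\<^sub>R x + y) = 0" if w: "\<forall>k<max N (Suc j). w \<bullet> e k = 0" for w
    proof -
      have "w \<bullet> e j = 0" using w by simp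
      moreover have "w \<bullet> y = 0" using w N by simp
      ultimately show ?thesis using \<open>x = e j\<close> by (simp add: inner_add_right)
    qed
    then show ?case by blast
  qed
  then obtain N where N: "\<And>w. (\<forall>k<N. w \<bullet> e k = 0) \<Longrightarrow> w \<bullet> u = 0" by blast
  define p where "p = (\<Sum>k<N. (v \<bullet> e k) *\<^sub>R e k)"
  have pe: "p \<bullet> e k = v \<bullet> e k" if "k < N" for k
    using that by (simp add: p_def inner_sum_left on if_distrib sum.delta cong: if_cong)
  have 1: "(v - p) \<bullet> u = 0" using pe by (intro N) (auto simp: inner_diff_left)
  have "(v - p) \<bullet> (\<Sum>k<N. (v \<bullet> e k) *\<^sub>R e k) = 0"
    by (simp add: inner_sum_right inner_diff_left pe)
  then have 2: "(v - p) \<bullet> p = 0" by (simp flip: p_def)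
  have "(norm (v - p))\<^sup>2 = (v - p) \<bullet> (v - u)"
    using 1 2 by (simp add: power2_norm_eq_inner inner_diff_right)
  also have "\<dots> \<le> norm (v - p) * norm (v - u)" by (rule norm_cauchy_schwarz)
  finally have "norm (v - p) \<le> norm (v - u)"
    by (cases "v = p") (simp_all add: power2_eq_square)
  then have vp: "norm (v - p) \<le> \<epsilon>" using u(2) by (simp add: dist_norm norm_minus_commute)
  have "(norm p)\<^sup>2 = p \<bullet> (\<Sum>k<N. (v \<bullet> e k) *\<^sub>R e k)"
    by (simp add: power2_norm_eq_inner flip: p_def)
  also have "\<dots> = (\<Sum>k<N. (v \<bullet> e k)\<^sup>2)"
    by (simp add: inner_sum_right pe power2_eq_square)
  also have "\<dots> \<le> (\<Sum>k<N. (c k)\<^sup>2)"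
    using le by (intro sum_mono) (metis abs_ge_zero power2_abs power_mono)
  also have "\<dots> \<le> (\<Sum>k. (c k)\<^sup>2)" by (intro sum_le_suminf c) auto
  finally have "norm p \<le> sqrt (\<Sum>k. (c k)\<^sup>2)" by (rule real_le_rsqrt)
  then show "norm v \<le> sqrt (\<Sum>k. (c k)\<^sup>2) + \<epsilon>"
    using vp norm_triangle_sub[of v p] by linarith
qed

lemma square_summable_imp_summable_orthonormal:
  fixes e :: "nat \<Rightarrow> 'h::{real_inner, banach}"
  assumes on: "\<And>j k. e j \<bullet> e k = (if j = k then 1 else 0)" and a: "summable (\<lambda>k. (a k)\<^sup>2)"
  shows "summable (\<lambda>k. a k *\<^sub>R e k)"
  unfolding summable_Cauchy
proof (intro allI impI)
  fix \<epsilon> :: real assume "\<epsilon> > 0"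
  then have "\<epsilon>\<^sup>2 > 0" by simp
  then obtain N where N: "\<And>m n. m \<ge> N \<Longrightarrow> norm (\<Sum>k=m..<n. (a k)\<^sup>2) < \<epsilon>\<^sup>2"
    using a unfolding summable_Cauchy by blast
  have "norm (\<Sum>k=m..<n. a k *\<^sub>R e k) < \<epsilon>" if "m \<ge> N" for m n
  proof -
    have "(norm (\<Sum>k=m..<n. a k *\<^sub>R e k))\<^sup>2 = (\<Sum>k=m..<n. (a k)\<^sup>2)"
      unfolding power2_norm_eq_inner
      by (simp add: inner_sum_left inner_sum_right on if_distrib sum.delta
          power2_eq_square cong: if_cong)
    also have "\<dots> < \<epsilon>\<^sup>2" using N[OF that, of n] by simp
    finally show ?thesis using \<open>\<epsilon> > 0\<close> by (simp add: power2_less_imp_less)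
  qed
  then show "\<exists>N. \<forall>m\<ge>N. \<forall>n. norm (\<Sum>k=m..<n. a k *\<^sub>R e k) < \<epsilon>" by blast
qed

lemma inner_suminf_orthonormal:
  fixes e :: "nat \<Rightarrow> 'h::{real_inner, banach}"
  assumes on: "\<And>j k. e j \<bullet> e k = (if j = k then 1 else 0)" and a: "summable (\<lambda>k. a k *\<^sub>R e k)"
  shows "(\<Sum>k. a k *\<^sub>R e k) \<bullet> e j = a j"
proof -
  have "(\<lambda>k. (a k *\<^sub>R e k) \<bullet> e j) sums ((\<Sum>k. a k *\<^sub>R e k) \<bullet> e j)"
    by (rule bounded_linear.sums[OF bounded_linear_inner_left summable_sums[OF a]])
  moreover have "(\<lambda>k. (a k *\<^sub>R e k) \<bullet> e j) = (\<lambda>k. if k = j then a k else 0)"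
    by (auto simp: on)
  moreover have "(\<lambda>k. if k = j then a k else 0) sums a j"
    by (rule sums_single)
  ultimately show ?thesis using sums_unique2 by metis
qed

section \<open>Kernels as mixtures of indicators\<close>

text \<open>The step function takes on \<open>((j-1)/m, j/m]\<close> the value of the kernel at \<open>j/m\<close>; written with
  the indicators of the half lines \<open>(-\<infinity>, j/m]\<close>, its coefficients are the decrements of the kernel.\<close>

lemma kernel_step_approximation:
  fixes \<kappa> :: "real \<Rightarrow> real"
  assumes cont: "continuous_on {0..1} \<kappa>" and supp: "\<And>t. t > 1 \<Longrightarrow> \<kappa> t = 0" and "\<epsilon> > 0"
  obtains m :: nat and c where "m > 0"
    "\<And>t. t \<ge> 0 \<Longrightarrow>
      \<bar>\<kappa> t - (\<Sum>j=1..m. c j * indicat_real {..real j / real m} t)\<bar> \<le> \<epsilon> * indicat_real {..1} t"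
proof -
  have "uniformly_continuous_on {0..1} \<kappa>"
    using cont by (rule compact_uniformly_continuous) simp
  then obtain \<delta> where "\<delta> > 0" and \<delta>:
    "\<And>s t. s \<in> {0..1} \<Longrightarrow> t \<in> {0..1} \<Longrightarrow> dist s t < \<delta> \<Longrightarrow> dist (\<kappa> s) (\<kappa> t) < \<epsilon>"
    using \<open>\<epsilon> > 0\<close> unfolding uniformly_continuous_on_def by metis
  obtain m :: nat where m: "m > 0" "1 / real m < \<delta>"
    using \<open>\<delta> > 0\<close> by (metis nat_approx_posE inverse_eq_divide zero_less_Suc)
  define c where "c j = (if j < m then \<kappa> (real j / m) - \<kappa> (real (Suc j) / m) else \<kappa> 1)" for j
  have tail: "i \<le> m \<Longrightarrow> (\<Sum>j=i..m. c j) = \<kappa> (real i / m)" for i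
  proof (induction i rule: inc_induct)
    case base
    then show ?case using \<open>m > 0\<close> by (simp add: c_def)
  next
    case (step i)
    then have "(\<Sum>j=i..m. c j) = c i + (\<Sum>j=Suc i..m. c j)"
      by (intro sum.atLeast_Suc_atMost) simp
    then show ?case using step by (simp add: c_def)
  qed
  have "\<bar>\<kappa> t - (\<Sum>j=1..m. c j * indicat_real {..real j / m} t)\<bar> \<le> \<epsilon> * indicat_real {..1} t"
    if "t \<ge> 0" for t
  proof (cases "t \<le> 1")
    case False
    have "indicat_real {..real j / m} t = 0" if "j \<in> {1..m}" for j
    proof -
      have "real j / m \<le> 1" using that \<open>m > 0\<close> by (simp add: field_simps)
      then show ?thesis using False by simp
    qed
    then show ?thesis using False supp[of t] by simp
  next
    case True
    define i where "i = max 1 (nat \<lceil>t * m\<rceil>)"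
    have i1: "1 \<le> i" by (simp add: i_def)
    have im: "i \<le> m"
    proof -
      have "t * m \<le> m" using True \<open>m > 0\<close> by simp
      then have "\<lceil>t * m\<rceil> \<le> int m" by (simp add: ceiling_le_iff)
      then show ?thesis using \<open>m > 0\<close> unfolding i_def by linarith
    qed
    have ti: "t \<le> real i / m"
    proof -
      have "t * m \<le> real (nat \<lceil>t * m\<rceil>)" using \<open>t \<ge> 0\<close> by (simp add: real_nat_ceiling_ge)
      also have "\<dots> \<le> real i" by (simp add: i_def)
      finally show ?thesis using \<open>m > 0\<close> by (simp add: field_simps)
    qed
    have it: "real i - 1 \<le> t * m"
      using \<open>t \<ge> 0\<close> \<open>m > 0\<close> unfolding i_def
      by (smt (verit) of_int_ceiling_le_add_one of_nat_1 of_nat_max of_nat_nat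
          zero_le_ceiling mult_nonneg_nonneg of_nat_0_le_iff max_def nat_le_0 of_nat_0)
    have iff: "t \<le> real j / m \<longleftrightarrow> i \<le> j" if "j \<in> {1..m}" for j
    proof
      assume "t \<le> real j / m"
      then have "t * m \<le> real j" using \<open>m > 0\<close> by (simp add: field_simps)
      then have "nat \<lceil>t * m\<rceil> \<le> j" by (simp add: ceiling_le_iff nat_le_iff)
      then show "i \<le> j" using that by (simp add: i_def)
    next
      assume "i \<le> j"
      then have "real i / m \<le> real j / m" by (simp add: divide_right_mono)
      then show "t \<le> real j / m" using ti by linarith
    qed
    have "(\<Sum>j=1..m. c j * indicat_real {..real j / m} t) = (\<Sum>j=i..m. c j)"
      using i1 iff by (intro sum.mono_neutral_cong_right) (auto simp: indicator_def)
    also have "\<dots> = \<kappa> (real i / m)" using im by (rule tail)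
    finally have eq: "(\<Sum>j=1..m. c j * indicat_real {..real j / m} t) = \<kappa> (real i / m)" .
    have "real i / m - t = (real i - t * m) / m" using \<open>m > 0\<close> by (simp add: field_simps)
    also have "\<dots> \<le> 1 / m" using it by (intro divide_right_mono) auto
    finally have "real i / m - t \<le> 1 / m" .
    then have "dist t (real i / m) < \<delta>" using ti m(2) by (simp add: dist_real_def)
    moreover have "real i / m \<in> {0..1}" using im \<open>m > 0\<close> by simp
    ultimately have "dist (\<kappa> t) (\<kappa> (real i / m)) < \<epsilon>"
      using \<open>t \<ge> 0\<close> True by (intro \<delta>) auto
    then show ?thesis using True eq by (simp add: dist_real_def)
  qed
  then show thesis using that \<open>m > 0\<close> by blast
qed

section \<open>Kernel means and small ball probabilities\<close>

text \<open>For \<open>t \<ge> 0\<close> the kernel is \<open>\<kappa>(1) 1{t \<le> 1} - \<integral>\<^sub>0\<^sup>1 \<kappa>'(s) 1{t \<le> s} ds\<close>, so by Fubini's theorem its mean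
  is the corresponding mixture of the probabilities of the balls of radius \<open>h s\<close>; the limit
  follows by dominated convergence.\<close>

lemma kernel_mean_limit:
  fixes D :: "'w \<Rightarrow> real" and \<kappa> \<kappa>' q :: "real \<Rightarrow> real" and h p :: "nat \<Rightarrow> real"
  assumes "prob_space M" and D [measurable]: "D \<in> borel_measurable M" and D_pos: "\<And>\<omega>. 0 \<le> D \<omega>"
    and deriv: "\<And>s. s \<in> {0..1} \<Longrightarrow> (\<kappa> has_vector_derivative \<kappa>' s) (at s within {0..1})"
    and cont: "continuous_on {0..1} \<kappa>'" and supp: "\<And>t. t > 1 \<Longrightarrow> \<kappa> t = 0"
    and h: "eventually (\<lambda>n. h n > 0) sequentially" and p: "eventually (\<lambda>n. p n > 0) sequentially"
    and lim: "\<And>s. s \<in> {0<..1} \<Longrightarrow> (\<lambda>n. measure M {\<omega>\<in>space M. D \<omega> \<le> h n * s} / p n) \<longlonglongrightarrow> q s"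
  shows "(\<lambda>n. (LINT \<omega>|M. \<kappa> (D \<omega> / h n)) / p n) \<longlonglongrightarrow> \<kappa> 1 * q 1 - integral {0..1} (\<lambda>s. \<kappa>' s * q s)"
proof -
  interpret prob_space M by fact
  interpret pair_sigma_finite M lborel by unfold_locales
  define P where "P n s = measure M {\<omega>\<in>space M. D \<omega> \<le> h n * s}" for n s
  define k where "k s = indicator {0..1} s * \<kappa>' s" for s :: real
  have k_meas [measurable]: "k \<in> borel_measurable borel"
    using borel_measurable_continuous_on_indicator[OF _ cont] by (simp add: k_def[abs_def])
  obtain C where C: "\<And>s. s \<in> {0..1} \<Longrightarrow> \<bar>\<kappa>' s\<bar> \<le> C"
    using compact_imp_bounded[OF compact_continuous_image[OF cont]]
    unfolding bounded_iff by (metis compact_Icc imageI real_norm_def)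
  have C0: "C \<ge> 0" using C[of 0] by simp
  have k_bd: "\<bar>k s\<bar> \<le> C * indicator {0..1} s" for s
    using C[of s] by (auto simp: k_def indicator_def)
  have rep: "\<kappa> t = \<kappa> 1 * indicator {..1} t - (LINT s|lborel. k s * indicator {t..} s)" if "t \<ge> 0" for t
  proof (cases "t \<le> 1")
    case True
    have "(LINT s|lborel. indicator {t..1} s *\<^sub>R \<kappa>' s) = \<kappa> 1 - \<kappa> t"
    proof (rule integral_FTC_atLeastAtMost[OF True])
      show "(\<kappa> has_vector_derivative \<kappa>' s) (at s within {t..1})" if "t \<le> s" "s \<le> 1" for s
        using deriv[of s] that \<open>t \<ge> 0\<close> by (rule_tac has_vector_derivative_within_subset) auto
      show "continuous_on {t..1} \<kappa>'" using cont \<open>t \<ge> 0\<close> by (rule_tac continuous_on_subset) auto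
    qed
    moreover have "(\<lambda>s. indicator {t..1} s *\<^sub>R \<kappa>' s) = (\<lambda>s. k s * indicator {t..} s)"
      using \<open>t \<ge> 0\<close> by (auto simp: k_def indicator_def)
    ultimately show ?thesis using True by simp
  next
    case False
    then have "(\<lambda>s. k s * indicator {t..} s) = (\<lambda>_. 0)" by (auto simp: k_def indicator_def)
    then show ?thesis using False supp[of t] by simp
  qed
  have mean: "(LINT \<omega>|M. \<kappa> (D \<omega> / h n)) = \<kappa> 1 * P n 1 - (LINT s|lborel. k s * P n s)" if "h n > 0" for n
  proof -
    let ?f = "\<lambda>\<omega> s. k s * indicator {D \<omega> / h n..} s"
    have f_meas [measurable]: "case_prod ?f \<in> borel_measurable (M \<Otimes>\<^sub>M lborel)"
    proof -
      have "case_prod ?f = (\<lambda>x. if D (fst x) / h n \<le> snd x then k (snd x) else 0)"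
        by (auto simp: indicator_def)
      then show ?thesis by simp
    qed
    have int: "integrable (M \<Otimes>\<^sub>M lborel) (case_prod ?f)"
    proof (rule integrableI_bounded_set[where A = "space M \<times> {0..1}" and B = C])
      have "emeasure (M \<Otimes>\<^sub>M lborel) (space M \<times> {0..1::real}) = emeasure M (space M) * emeasure lborel {0..1::real}"
        by (rule lborel.emeasure_pair_measure_Times) auto
      then show "emeasure (M \<Otimes>\<^sub>M lborel) (space M \<times> {0..1::real}) < \<infinity>" by (simp add: emeasure_space_1)
      show "AE x in M \<Otimes>\<^sub>M lborel. x \<in> space M \<times> {0..1::real} \<longrightarrow> norm (case_prod ?f x) \<le> C"
      proof (intro AE_I2 impI)
        fix x assume "x \<in> space M \<times> {0..1::real}"
        then have "snd x \<in> {0..1}" by auto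
        then have "\<bar>k (snd x)\<bar> \<le> C" using k_bd[of "snd x"] by simp
        then show "norm (case_prod ?f x) \<le> C"
          using C0 by (cases x) (simp add: indicator_def)
      qed
      show "AE x in M \<Otimes>\<^sub>M lborel. x \<notin> space M \<times> {0..1::real} \<longrightarrow> case_prod ?f x = 0"
        by (intro AE_I2) (auto simp: k_def indicator_def space_pair_measure)
    qed (auto simp: f_meas)
    have "(LINT \<omega>|M. \<kappa> (D \<omega> / h n)) = (LINT \<omega>|M. \<kappa> 1 * indicator {..1} (D \<omega> / h n) - (LINT s|lborel. ?f \<omega> s))"
      using that D_pos by (intro Bochner_Integration.integral_cong refl rep) auto
    also have "\<dots> = (LINT \<omega>|M. \<kappa> 1 * indicator {..1} (D \<omega> / h n)) - (LINT \<omega>|M. LINT s|lborel. ?f \<omega> s)"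
    proof (rule Bochner_Integration.integral_diff)
      show "integrable M (\<lambda>\<omega>. \<kappa> 1 * indicator {..1} (D \<omega> / h n))"
        by (intro integrable_const_bound[where B = "\<bar>\<kappa> 1\<bar>"]) (auto simp: indicator_def)
      show "integrable M (\<lambda>\<omega>. LINT s|lborel. ?f \<omega> s)"
        using integrable_fst'[OF int] by simp
    qed
    also have "(LINT \<omega>|M. \<kappa> 1 * indicator {..1} (D \<omega> / h n)) = \<kappa> 1 * P n 1"
    proof -
      have "(LINT \<omega>|M. \<kappa> 1 * indicator {..1} (D \<omega> / h n)) = \<kappa> 1 * (LINT \<omega>|M. indicator {\<omega>\<in>space M. D \<omega> \<le> h n * 1} \<omega>)"
        using that by (subst integral_mult_right_zero[symmetric], intro Bochner_Integration.integral_cong refl) (auto simp: indicator_def field_simps)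
      then show ?thesis by (simp add: P_def)
    qed
    also have "(LINT \<omega>|M. LINT s|lborel. ?f \<omega> s) = (LINT s|lborel. LINT \<omega>|M. ?f \<omega> s)"
      by (rule Fubini_integral[OF int, symmetric])
    also have "\<dots> = (LINT s|lborel. k s * P n s)"
    proof (intro Bochner_Integration.integral_cong refl)
      fix s
      have "(LINT \<omega>|M. ?f \<omega> s) = k s * (LINT \<omega>|M. indicator {\<omega>\<in>space M. D \<omega> \<le> h n * s} \<omega>)"
        using that by (subst integral_mult_right_zero[symmetric], intro Bochner_Integration.integral_cong refl) (auto simp: indicator_def field_simps)
      then show "(LINT \<omega>|M. ?f \<omega> s) = k s * P n s" by (simp add: P_def)
    qed
    finally show ?thesis .
  qed
  \<comment> \<open>nothing is known about the ball of radius \<open>0\<close>, so the integrands are cut to \<open>(0, 1]\<close>\<close>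
  define r where "r s = (if s \<in> {0<..1} then q s else 0)" for s
  have "(\<lambda>n. P n 1 / p n) \<longlonglongrightarrow> q 1" using lim[of 1] by (simp add: P_def)
  then have "eventually (\<lambda>n. P n 1 / p n < q 1 + 1) sequentially" by (rule order_tendstoD) simp
  then have "eventually (\<lambda>n. h n > 0 \<and> p n > 0 \<and> P n 1 / p n < q 1 + 1) sequentially"
    using h p by eventually_elim auto
  then obtain N where N: "\<And>n. n \<ge> N \<Longrightarrow> h n > 0" "\<And>n. n \<ge> N \<Longrightarrow> p n > 0" "\<And>n. n \<ge> N \<Longrightarrow> P n 1 / p n < q 1 + 1"
    by (auto simp: eventually_sequentially)
  have P_mono: "P (n + N) s \<le> P (n + N) t" if "s \<le> t" for n s t
    using N(1)[of "n + N"] that unfolding P_def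
    by (intro finite_measure_mono) (auto intro: order_trans mult_left_mono)
  have P_meas [measurable]: "P (n + N) \<in> borel_measurable borel" for n
    using P_mono by (intro borel_measurable_mono) (auto simp: mono_def)
  have P_nonneg: "P n s \<ge> 0" for n s by (simp add: P_def)
  define fn where "fn n s = indicator {0<..} s * (k s * (P (n + N) s / p (n + N)))" for n and s :: real
  define f where "f s = indicator {0<..} s * (k s * r s)" for s :: real
  have fn_meas [measurable]: "fn n \<in> borel_measurable borel" for n unfolding fn_def by measurable
  have fn_lim: "(\<lambda>n. fn n s) \<longlonglongrightarrow> f s" for s
  proof (cases "s \<in> {0<..1}")
    case True
    have "(\<lambda>n. P (n + N) s / p (n + N)) \<longlonglongrightarrow> q s"
      using LIMSEQ_ignore_initial_segment[OF lim[OF True], of N] by (simp add: P_def)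
    then have "(\<lambda>n. k s * (P (n + N) s / p (n + N))) \<longlonglongrightarrow> k s * q s" by (rule tendsto_mult_left)
    then show ?thesis using True by (simp add: fn_def f_def r_def)
  next
    case False
    then have "fn n s = 0" "f s = 0" for n by (auto simp: fn_def f_def k_def indicator_def)
    then show ?thesis by simp
  qed
  have f_meas [measurable]: "f \<in> borel_measurable borel"
    using fn_lim by (rule borel_measurable_LIMSEQ_real) simp
  have fn_bd: "\<bar>fn n s\<bar> \<le> C * (q 1 + 1) * indicator {0..1} s" for n s
  proof (cases "s \<in> {0..1}")
    case True
    have "P (n + N) s / p (n + N) \<le> P (n + N) 1 / p (n + N)"
      using True N(2)[of "n + N"] by (intro divide_right_mono P_mono) auto
    then have "P (n + N) s / p (n + N) \<le> q 1 + 1" using N(3)[of "n + N"] by simp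
    moreover have "P (n + N) s / p (n + N) \<ge> 0" using N(2)[of "n + N"] P_nonneg by simp
    ultimately have "\<bar>k s\<bar> * (P (n + N) s / p (n + N)) \<le> C * (q 1 + 1)"
      using k_bd[of s] True C0 by (intro mult_mono) auto
    then show ?thesis using True N(2)[of "n + N"] P_nonneg[of "n + N" s]
      by (cases "s = 0") (auto simp: fn_def abs_mult intro: order_trans[rotated])
  next
    case False
    then show ?thesis by (auto simp: fn_def k_def indicator_def)
  qed
  have bd_int: "integrable lborel (\<lambda>s. C * (q 1 + 1) * indicator {0..1::real} s)" by simp
  have lim_int: "(\<lambda>n. LINT s|lborel. fn n s) \<longlonglongrightarrow> (LINT s|lborel. f s)"
    by (rule integral_dominated_convergence[OF _ _ bd_int]) (use fn_lim fn_bd in auto)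
  have f_int: "integrable lborel f"
  proof (rule Bochner_Integration.integrable_bound[OF bd_int])
    have "\<bar>f s\<bar> \<le> C * (q 1 + 1) * indicator {0..1} s" for s
      using fn_bd by (intro LIMSEQ_le_const2[OF tendsto_rabs[OF fn_lim]]) auto
    then show "AE s in lborel. norm (f s) \<le> norm (C * (q 1 + 1) * indicator {0..1::real} s)"
      by (intro AE_I2) (simp add: order.trans[OF _ abs_ge_self])
  qed simp
  have f_eq: "(LINT s|lborel. f s) = integral {0..1} (\<lambda>s. \<kappa>' s * q s)"
  proof -
    have f01: "f = (\<lambda>s. indicator {0..1} s *\<^sub>R f s)" by (auto simp: f_def k_def indicator_def)
    then have "set_integrable lborel {0..1} f" using f_int by (simp add: set_integrable_def)
    from set_borel_integral_eq_integral(2)[OF this] f01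
    have "(LINT s|lborel. f s) = integral {0..1} f" by (simp add: set_lebesgue_integral_def)
    also have "\<dots> = integral {0..1} (\<lambda>s. \<kappa>' s * q s)"
      by (rule integral_spike[where S = "{0}"]) (auto simp: f_def k_def r_def)
    finally show ?thesis .
  qed
  have fn_eq: "(LINT s|lborel. fn n s) = (LINT s|lborel. k s * P (n + N) s) / p (n + N)" for n
  proof -
    have "(LINT s|lborel. fn n s) = (LINT s|lborel. k s * P (n + N) s / p (n + N))"
    proof (rule integral_cong_AE)
      have "AE s::real in lborel. s \<noteq> 0" by (rule AE_lborel_singleton)
      then show "AE s in lborel. fn n s = k s * P (n + N) s / p (n + N)"
        by eventually_elim (auto simp: fn_def k_def indicator_def)
    qed auto
    then show ?thesis by simp
  qed
  have "(\<lambda>n. \<kappa> 1 * (P (n + N) 1 / p (n + N)) - (LINT s|lborel. fn n s)) \<longlonglongrightarrow> \<kappa> 1 * q 1 - integral {0..1} (\<lambda>s. \<kappa>' s * q s)"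
    using lim_int LIMSEQ_ignore_initial_segment[OF lim[of 1], of N] unfolding f_eq
    by (intro tendsto_intros) (auto simp: P_def)
  moreover have "\<kappa> 1 * (P (n + N) 1 / p (n + N)) - (LINT s|lborel. fn n s) = (LINT \<omega>|M. \<kappa> (D \<omega> / h (n + N))) / p (n + N)" for n
    using N(1)[of "n + N"] by (simp add: fn_eq mean diff_divide_distrib)
  ultimately have "(\<lambda>n. (LINT \<omega>|M. \<kappa> (D \<omega> / h (n + N))) / p (n + N)) \<longlonglongrightarrow> \<kappa> 1 * q 1 - integral {0..1} (\<lambda>s. \<kappa>' s * q s)"
    by simp
  then show ?thesis by (rule LIMSEQ_offset)
qed

text \<open>Uniform approximation of the kernel by step functions reduces row averages of conditional
  kernel means to those of conditional ball probabilities, which converge almost surely for each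
  of the finitely many radii involved.  The unconditional means are approximated by the same
  steps, so the two limits agree.\<close>

lemma conditional_kernel_average_limit:
  fixes D :: "nat \<Rightarrow> nat \<Rightarrow> 'w \<Rightarrow> real" and CF :: "nat \<Rightarrow> nat \<Rightarrow> real \<Rightarrow> 'w \<Rightarrow> real"
  assumes "prob_space M"
    and CF: "\<And>n i u. i \<in> {1..n} \<Longrightarrow> is_cond_exp M (F n i) (\<lambda>\<omega>. indicat_real {..u} (D n i \<omega>)) (CF n i u)"
    and D: "\<And>n i. i \<in> {1..n} \<Longrightarrow> D n i \<in> borel_measurable M" and D_pos: "\<And>n i \<omega>. 0 \<le> D n i \<omega>"
    and D0 [measurable]: "D0 \<in> borel_measurable M" and D0_pos: "\<And>\<omega>. 0 \<le> D0 \<omega>"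
    and h: "\<And>n. n \<ge> 1 \<Longrightarrow> h n > 0"
    and a: "eventually (\<lambda>n. a n > 0) sequentially" and p: "eventually (\<lambda>n. p n > 0) sequentially"
    and cont: "continuous_on {0..1} \<kappa>" and supp: "\<And>t. t > 1 \<Longrightarrow> \<kappa> t = 0"
    and \<kappa>_meas [measurable]: "\<kappa> \<in> borel_measurable borel"
    and lim: "\<And>s. s \<in> {0<..1} \<Longrightarrow> AE \<omega> in M. (\<lambda>n. (\<Sum>i=1..n. CF n i (h n * s) \<omega>) / a n) \<longlonglongrightarrow> q s"
    and lim0: "\<And>s. s \<in> {0<..1} \<Longrightarrow> (\<lambda>n. measure M {\<omega>\<in>space M. D0 \<omega> \<le> h n * s} / p n) \<longlonglongrightarrow> q s"
    and mean: "(\<lambda>n. (LINT \<omega>|M. \<kappa> (D0 \<omega> / h n)) / p n) \<longlonglongrightarrow> l"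
  shows "AE \<omega> in M. (\<lambda>n. (\<Sum>i=1..n. real_cond_exp M (F n i) (\<lambda>\<omega>. \<kappa> (D n i \<omega> / h n)) \<omega>) / a n) \<longlonglongrightarrow> l"
proof -
  interpret prob_space M by fact
  define A where "A n \<omega> = (\<Sum>i=1..n. real_cond_exp M (F n i) (\<lambda>\<omega>. \<kappa> (D n i \<omega> / h n)) \<omega>) / a n" for n \<omega>
  obtain B where B: "\<And>t. t \<in> {0..1} \<Longrightarrow> \<bar>\<kappa> t\<bar> \<le> B"
    using compact_imp_bounded[OF compact_continuous_image[OF cont]]
    unfolding bounded_iff by (metis compact_Icc imageI real_norm_def)
  have "B \<ge> 0" using B[of 0] by simp
  have \<kappa>_bd: "\<bar>\<kappa> t\<bar> \<le> B" if "t \<ge> 0" for t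
    using B[of t] supp[of t] that \<open>B \<ge> 0\<close> by (cases "t \<le> 1") auto
  have q1: "q 1 \<ge> 0"
    using p by (intro tendsto_lowerbound[OF lim0[of 1]]) (auto elim!: eventually_mono)
  have "AE \<omega> in M. eventually (\<lambda>n. \<bar>A n \<omega> - l\<bar> \<le> \<epsilon> * (2 * q 1 + 2)) sequentially" if \<epsilon>: "\<epsilon> > 0" for \<epsilon>
  proof -
    obtain m :: nat and c where m: "m > 0" and step: "\<And>t. t \<ge> 0 \<Longrightarrow>
      \<bar>\<kappa> t - (\<Sum>j=1..m. c j * indicat_real {..real j / real m} t)\<bar> \<le> \<epsilon> * indicat_real {..1} t"
      using kernel_step_approximation[OF cont supp \<epsilon>] by metis
    define s where "s j = real j / real m" for j
    have s: "s j \<in> {0<..1}" if "j \<in> {1..m}" for j using that m by (simp add: s_def)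
    have step_h: "\<bar>\<kappa> (d / h n) - (\<Sum>j=1..m. c j * indicat_real {..h n * s j} d)\<bar> \<le> \<epsilon> * indicat_real {..h n * 1} d"
      if "n \<ge> 1" "d \<ge> 0" for n d
    proof -
      have "indicat_real {..u} (d / h n) = indicat_real {..h n * u} d" for u
        using h[OF that(1)] by (simp add: indicator_def field_simps)
      then show ?thesis using step[of "d / h n"] that h[OF that(1)] unfolding s_def by simp
    qed
    have "\<bar>l - (\<Sum>j=1..m. c j * q (s j))\<bar> \<le> \<epsilon> * q 1"
    proof (rule tendsto_le[OF sequentially_bot])
      show "(\<lambda>n. \<epsilon> * (measure M {\<omega>\<in>space M. D0 \<omega> \<le> h n * 1} / p n)) \<longlonglongrightarrow> \<epsilon> * q 1"
        by (intro tendsto_intros lim0) simp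
      show "(\<lambda>n. \<bar>(LINT \<omega>|M. \<kappa> (D0 \<omega> / h n)) / p n - (\<Sum>j=1..m. c j * (measure M {\<omega>\<in>space M. D0 \<omega> \<le> h n * s j} / p n))\<bar>)
          \<longlonglongrightarrow> \<bar>l - (\<Sum>j=1..m. c j * q (s j))\<bar>"
        by (intro tendsto_intros lim0 mean s)
      show "\<forall>\<^sub>F n in sequentially. \<bar>(LINT \<omega>|M. \<kappa> (D0 \<omega> / h n)) / p n
          - (\<Sum>j=1..m. c j * (measure M {\<omega>\<in>space M. D0 \<omega> \<le> h n * s j} / p n))\<bar>
          \<le> \<epsilon> * (measure M {\<omega>\<in>space M. D0 \<omega> \<le> h n * 1} / p n)"
        using p eventually_ge_at_top[of 1]
      proof eventually_elim
        case (elim n)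
        define I0 where "I0 u \<omega> = indicat_real {..u} (D0 \<omega>)" for u \<omega>
        have I: "integrable M (I0 u)" for u
          by (intro integrable_const_bound[where B = 1]) (auto simp: I0_def[abs_def])
        have IE: "(LINT \<omega>|M. I0 u \<omega>) = measure M {\<omega>\<in>space M. D0 \<omega> \<le> u}" for u
        proof -
          have "(LINT \<omega>|M. I0 u \<omega>) = (LINT \<omega>|M. indicat_real {\<omega>\<in>space M. D0 \<omega> \<le> u} \<omega>)"
            by (intro Bochner_Integration.integral_cong) (auto simp: I0_def indicator_def)
          then show ?thesis by simp
        qed
        have K: "integrable M (\<lambda>\<omega>. \<kappa> (D0 \<omega> / h n))"
          using h[OF elim(2)] D0_pos by (intro integrable_const_bound[where B = B]) (auto intro!: \<kappa>_bd AE_I2)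
        have "(LINT \<omega>|M. \<kappa> (D0 \<omega> / h n)) - (\<Sum>j=1..m. c j * measure M {\<omega>\<in>space M. D0 \<omega> \<le> h n * s j})
          = (LINT \<omega>|M. \<kappa> (D0 \<omega> / h n) - (\<Sum>j=1..m. c j * I0 (h n * s j) \<omega>))"
          using I K by (simp add: IE)
        also have "\<bar>\<dots>\<bar> \<le> (LINT \<omega>|M. \<epsilon> * I0 (h n * 1) \<omega>)"
          using I K step_h[OF elim(2) D0_pos, folded I0_def]
          by (intro order.trans[OF integral_abs_bound integral_mono]) auto
        also have "\<dots> = \<epsilon> * measure M {\<omega>\<in>space M. D0 \<omega> \<le> h n * 1}" using I by (simp only: integral_mult_right_zero IE)
        finally have "\<bar>(LINT \<omega>|M. \<kappa> (D0 \<omega> / h n)) - (\<Sum>j=1..m. c j * measure M {\<omega>\<in>space M. D0 \<omega> \<le> h n * s j})\<bar> / p n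
          \<le> \<epsilon> * measure M {\<omega>\<in>space M. D0 \<omega> \<le> h n * 1} / p n"
          using elim(1) by (intro divide_right_mono) auto
        moreover have "(LINT \<omega>|M. \<kappa> (D0 \<omega> / h n)) / p n - (\<Sum>j=1..m. c j * (measure M {\<omega>\<in>space M. D0 \<omega> \<le> h n * s j} / p n))
          = ((LINT \<omega>|M. \<kappa> (D0 \<omega> / h n)) - (\<Sum>j=1..m. c j * measure M {\<omega>\<in>space M. D0 \<omega> \<le> h n * s j})) / p n"
          by (simp add: diff_divide_distrib sum_divide_distrib)
        ultimately show ?case using elim(1) by (simp add: abs_divide)
      qed
    qed
    note l_bd = this
    have cond: "AE \<omega> in M. \<bar>real_cond_exp M (F n i) (\<lambda>\<omega>. \<kappa> (D n i \<omega> / h n)) \<omega> - (\<Sum>j=1..m. c j * CF n i (h n * s j) \<omega>)\<bar>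
        \<le> \<epsilon> * CF n i (h n * 1) \<omega>" if i: "i \<in> {1..n}" for n i
    proof -
      have sub: "subalgebra M (F n i)" using CF[OF i] by (simp add: is_cond_exp_def)
      interpret finite_measure_subalgebra M "F n i" using sub by unfold_locales
      have n: "n \<ge> 1" using i by simp
      have [measurable]: "D n i \<in> borel_measurable M" using D[OF i] .
      define I where "I u \<omega> = indicat_real {..u} (D n i \<omega>)" for u \<omega>
      have I: "integrable M (I u)" for u unfolding I_def
        by (intro integrable_const_bound[where B = 1]) auto
      have K: "integrable M (\<lambda>\<omega>. \<kappa> (D n i \<omega> / h n))"
        using h[OF n] D_pos by (intro integrable_const_bound[where B = B]) (auto intro!: \<kappa>_bd AE_I2)
      have CI: "AE \<omega> in M. CF n i u \<omega> = real_cond_exp M (F n i) (I u) \<omega>" for u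
        using is_cond_exp_real_iff[OF prob_space_axioms sub, of "I u"] CF[OF i, of u] I unfolding I_def by auto
      define St where "St \<omega> = (\<Sum>j=1..m. c j * I (h n * s j) \<omega>)" for \<omega>
      have St: "integrable M St" unfolding St_def using I by auto
      have S1: "AE \<omega> in M. real_cond_exp M (F n i) St \<omega> = (\<Sum>j=1..m. real_cond_exp M (F n i) (\<lambda>\<omega>. c j * I (h n * s j) \<omega>) \<omega>)"
        unfolding St_def using I by (intro real_cond_exp_sum) auto
      have S2: "AE \<omega> in M. \<forall>j\<in>{1..m}. real_cond_exp M (F n i) (\<lambda>\<omega>. c j * I (h n * s j) \<omega>) \<omega> = c j * CF n i (h n * s j) \<omega>"
      proof (subst AE_ball_countable, simp, rule ballI)
        fix j
        show "AE \<omega> in M. real_cond_exp M (F n i) (\<lambda>\<omega>. c j * I (h n * s j) \<omega>) \<omega> = c j * CF n i (h n * s j) \<omega>"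
          using real_cond_exp_cmult[OF I, of "c j" "h n * s j"] CI[of "h n * s j"] by eventually_elim simp
      qed
      have S3: "AE \<omega> in M. real_cond_exp M (F n i) (\<lambda>\<omega>. \<epsilon> * I (h n * 1) \<omega>) \<omega> = \<epsilon> * CF n i (h n * 1) \<omega>"
        using real_cond_exp_cmult[OF I, of \<epsilon> "h n * 1"] CI[of "h n * 1"] by eventually_elim simp
      have S4: "AE \<omega> in M. real_cond_exp M (F n i) (\<lambda>\<omega>. \<kappa> (D n i \<omega> / h n)) \<omega>
          \<le> real_cond_exp M (F n i) (\<lambda>\<omega>. St \<omega> + \<epsilon> * I (h n * 1) \<omega>) \<omega>"
      proof (intro real_cond_exp_mono K AE_I2)
        fix \<omega> show "\<kappa> (D n i \<omega> / h n) \<le> St \<omega> + \<epsilon> * I (h n * 1) \<omega>"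
          using step_h[OF n D_pos[of n i \<omega>]] by (simp add: St_def I_def)
      qed (use St I in auto)
      have S5: "AE \<omega> in M. real_cond_exp M (F n i) (\<lambda>\<omega>. \<kappa> (D n i \<omega> / h n)) \<omega>
          \<ge> real_cond_exp M (F n i) (\<lambda>\<omega>. St \<omega> - \<epsilon> * I (h n * 1) \<omega>) \<omega>"
      proof (intro real_cond_exp_mono K AE_I2)
        fix \<omega> show "St \<omega> - \<epsilon> * I (h n * 1) \<omega> \<le> \<kappa> (D n i \<omega> / h n)"
          using step_h[OF n D_pos[of n i \<omega>]] by (simp add: St_def I_def)
      qed (use St I in auto)
      have S6: "AE \<omega> in M. real_cond_exp M (F n i) (\<lambda>\<omega>. St \<omega> + \<epsilon> * I (h n * 1) \<omega>) \<omega>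
          = real_cond_exp M (F n i) St \<omega> + real_cond_exp M (F n i) (\<lambda>\<omega>. \<epsilon> * I (h n * 1) \<omega>) \<omega>"
        using St I by (intro real_cond_exp_add) auto
      have S7: "AE \<omega> in M. real_cond_exp M (F n i) (\<lambda>\<omega>. St \<omega> - \<epsilon> * I (h n * 1) \<omega>) \<omega>
          = real_cond_exp M (F n i) St \<omega> - real_cond_exp M (F n i) (\<lambda>\<omega>. \<epsilon> * I (h n * 1) \<omega>) \<omega>"
        using St I by (intro real_cond_exp_diff) auto
      show ?thesis using S1 S2 S3 S4 S5 S6 S7
      proof eventually_elim
        case (elim \<omega>)
        have "(\<Sum>j=1..m. real_cond_exp M (F n i) (\<lambda>\<omega>. c j * I (h n * s j) \<omega>) \<omega>) = (\<Sum>j=1..m. c j * CF n i (h n * s j) \<omega>)"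
          using elim(2) by (intro sum.cong) auto
        then show ?case using elim by linarith
      qed
    qed
    have "AE \<omega> in M. \<forall>n. \<forall>i\<in>{1..n}. \<bar>real_cond_exp M (F n i) (\<lambda>\<omega>. \<kappa> (D n i \<omega> / h n)) \<omega> - (\<Sum>j=1..m. c j * CF n i (h n * s j) \<omega>)\<bar>
        \<le> \<epsilon> * CF n i (h n * 1) \<omega>"
      using cond by (subst AE_all_countable, intro allI, subst AE_ball_countable) auto
    moreover have "AE \<omega> in M. \<forall>j\<in>{1..m}. (\<lambda>n. (\<Sum>i=1..n. CF n i (h n * s j) \<omega>) / a n) \<longlonglongrightarrow> q (s j)"
      using lim s by (subst AE_ball_countable) auto
    moreover have "AE \<omega> in M. (\<lambda>n. (\<Sum>i=1..n. CF n i (h n * 1) \<omega>) / a n) \<longlonglongrightarrow> q 1"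
      by (rule lim) simp
    ultimately show ?thesis
    proof eventually_elim
      case (elim \<omega>)
      define G where "G u n = (\<Sum>i=1..n. CF n i (h n * u) \<omega>) / a n" for u n
      have "(\<lambda>n. \<Sum>j=1..m. c j * G (s j) n) \<longlonglongrightarrow> (\<Sum>j=1..m. c j * q (s j))"
        using elim(2) unfolding G_def by (intro tendsto_intros) auto
      then have "eventually (\<lambda>n. dist (\<Sum>j=1..m. c j * G (s j) n) (\<Sum>j=1..m. c j * q (s j)) < \<epsilon>) sequentially"
        using \<epsilon> by (rule tendstoD)
      moreover have "eventually (\<lambda>n. G 1 n < q 1 + 1) sequentially"
        using elim(3) unfolding G_def by (rule order_tendstoD) simp
      ultimately show ?case using a
      proof eventually_elim
        case (elim n)
        have "(\<Sum>j=1..m. c j * G (s j) n) = (\<Sum>i=1..n. \<Sum>j=1..m. c j * CF n i (h n * s j) \<omega>) / a n"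
          unfolding G_def sum_distrib_left times_divide_eq_right sum_divide_distrib by (rule sum.swap)
        then have "A n \<omega> - (\<Sum>j=1..m. c j * G (s j) n)
           = (\<Sum>i=1..n. real_cond_exp M (F n i) (\<lambda>\<omega>. \<kappa> (D n i \<omega> / h n)) \<omega> - (\<Sum>j=1..m. c j * CF n i (h n * s j) \<omega>)) / a n"
          by (simp add: A_def sum_subtractf diff_divide_distrib)
        also have "\<bar>\<dots>\<bar> \<le> (\<Sum>i=1..n. \<epsilon> * CF n i (h n * 1) \<omega>) / a n"
          using \<open>\<forall>n. \<forall>i\<in>{1..n}. _\<close> elim(3) unfolding abs_divide
          by (auto intro!: divide_right_mono order.trans[OF sum_abs] sum_mono)
        also have "\<dots> = \<epsilon> * G 1 n" by (simp add: G_def sum_distrib_left)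
        also have "\<dots> \<le> \<epsilon> * (q 1 + 1)" using elim(2) \<epsilon> by (intro mult_left_mono) auto
        finally have "\<bar>A n \<omega> - (\<Sum>j=1..m. c j * G (s j) n)\<bar> \<le> \<epsilon> * (q 1 + 1)" .
        then show ?case using elim(1) l_bd by (simp add: dist_real_def algebra_simps)
      qed
    qed
  qed
  then have "AE \<omega> in M. \<forall>N. eventually (\<lambda>n. \<bar>A n \<omega> - l\<bar> \<le> inverse (real (Suc N)) * (2 * q 1 + 2)) sequentially"
    by (subst AE_all_countable) simp
  then show ?thesis
  proof eventually_elim
    case (elim \<omega>)
    have "(\<lambda>n. A n \<omega>) \<longlonglongrightarrow> l"
    proof (rule tendstoI)
      fix \<eta> :: real assume "\<eta> > 0"
      have "(\<lambda>N. inverse (real (Suc N)) * (2 * q 1 + 2)) \<longlonglongrightarrow> 0 * (2 * q 1 + 2)"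
        by (intro tendsto_intros LIMSEQ_inverse_real_of_nat)
      then have "eventually (\<lambda>N. inverse (real (Suc N)) * (2 * q 1 + 2) < \<eta>) sequentially"
        using \<open>\<eta> > 0\<close> by (intro order_tendstoD(2)) auto
      then obtain N where N: "inverse (real (Suc N)) * (2 * q 1 + 2) < \<eta>"
        by (auto simp: eventually_sequentially)
      show "eventually (\<lambda>n. dist (A n \<omega>) l < \<eta>) sequentially"
        using elim[rule_format, of N] by eventually_elim (use N in \<open>simp add: dist_real_def\<close>)
    qed
    then show ?case by (simp add: A_def)
  qed
qed

section \<open>Substituting a random argument outside null sections\<close>

text \<open>The sets approximable in both measures at once form a sigma-algebra: a countable union is
  first cut off at a finite index, by continuity from above.\<close>

lemma sets_approximated_by_algebra:
  assumes "finite_measure \<mu>" "finite_measure \<nu>" "algebra \<Omega> G"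
    and sets: "sets \<mu> = sigma_sets \<Omega> G" "sets \<nu> = sigma_sets \<Omega> G"
    and A: "A \<in> sigma_sets \<Omega> G" and "\<epsilon> > 0"
  shows "\<exists>B\<in>G. measure \<mu> ((A - B) \<union> (B - A)) < \<epsilon> \<and> measure \<nu> ((A - B) \<union> (B - A)) < \<epsilon>"
proof -
  interpret \<mu>: finite_measure \<mu> by fact
  interpret \<nu>: finite_measure \<nu> by fact
  interpret algebra \<Omega> G by fact
  have G1: "B \<in> sets \<mu>" "B \<in> sets \<nu>" if "B \<in> G" for B using that sets by auto
  show ?thesis using A \<open>\<epsilon> > 0\<close>
  proof (induction arbitrary: \<epsilon> rule: sigma_sets.induct)
    case (Basic a)
    then show ?case by (intro bexI[of _ a]) auto
  next
    case Empty
    then show ?case by (intro bexI[of _ "{}"]) auto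
  next
    case (Compl a)
    then obtain B where B: "B \<in> G" "measure \<mu> ((a - B) \<union> (B - a)) < \<epsilon>" "measure \<nu> ((a - B) \<union> (B - a)) < \<epsilon>"
      by blast
    have "a \<subseteq> \<Omega>" using sigma_sets_into_sp[OF space_closed Compl(1)] .
    moreover have "B \<subseteq> \<Omega>" using B(1) space_closed by auto
    ultimately have "(\<Omega> - a - (\<Omega> - B)) \<union> (\<Omega> - B - (\<Omega> - a)) = (a - B) \<union> (B - a)" by auto
    then show ?case using B by (intro bexI[of _ "\<Omega> - B"]) auto
  next
    case (Union a)
    have a: "a i \<in> sets \<mu>" "a i \<in> sets \<nu>" for i using Union(1) sets by auto
    define C where "C n = (\<Union>i. a i) - (\<Union>i<n. a i)" for n :: nat
    have C: "range C \<subseteq> sets \<mu>" "range C \<subseteq> sets \<nu>" using a by (auto simp: C_def)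
    have "decseq C" by (auto simp: C_def decseq_def)
    have "(\<Inter>n. C n) = {}" by (auto simp: C_def)
    have "(\<lambda>n. measure \<mu> (C n)) \<longlonglongrightarrow> 0"
      using \<mu>.finite_Lim_measure_decseq[OF C(1) \<open>decseq C\<close>] \<open>(\<Inter>n. C n) = {}\<close> by simp
    moreover have "(\<lambda>n. measure \<nu> (C n)) \<longlonglongrightarrow> 0"
      using \<nu>.finite_Lim_measure_decseq[OF C(2) \<open>decseq C\<close>] \<open>(\<Inter>n. C n) = {}\<close> by simp
    ultimately have "eventually (\<lambda>n. measure \<mu> (C n) < \<epsilon> / 2 \<and> measure \<nu> (C n) < \<epsilon> / 2) sequentially"
      using \<open>\<epsilon> > 0\<close> by (intro eventually_conj order_tendstoD) auto
    then obtain n where n: "measure \<mu> (C n) < \<epsilon> / 2" "measure \<nu> (C n) < \<epsilon> / 2"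
      by (auto simp: eventually_sequentially)
    define \<eta> where "\<eta> = \<epsilon> / (2 * (real n + 1))"
    have "\<eta> > 0" using \<open>\<epsilon> > 0\<close> by (simp add: \<eta>_def)
    then have "\<forall>i. \<exists>B\<in>G. measure \<mu> ((a i - B) \<union> (B - a i)) < \<eta> \<and> measure \<nu> ((a i - B) \<union> (B - a i)) < \<eta>"
      using Union.IH by blast
    then obtain B where B: "\<And>i. B i \<in> G" "\<And>i. measure \<mu> ((a i - B i) \<union> (B i - a i)) < \<eta>"
      "\<And>i. measure \<nu> ((a i - B i) \<union> (B i - a i)) < \<eta>" by metis
    define U where "U = (\<Union>i<n. B i)"
    have U: "U \<in> G" unfolding U_def using B(1) by (intro finite_UN) auto
    let ?S = "((\<Union>i. a i) - U) \<union> (U - (\<Union>i. a i))"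
    have S: "?S \<subseteq> C n \<union> (\<Union>i<n. (a i - B i) \<union> (B i - a i))"
      by (auto simp: C_def U_def)
    have n\<eta>: "real n * \<eta> \<le> \<epsilon> / 2" using \<open>\<epsilon> > 0\<close> by (simp add: \<eta>_def field_simps)
    have "measure M ?S < \<epsilon>"
      if "finite_measure M" and Cn: "measure M (C n) < \<epsilon> / 2" and CM: "range C \<subseteq> sets M"
        and aM: "\<And>i. a i \<in> sets M" and BM: "\<And>i. B i \<in> sets M"
        and Bm: "\<And>i. measure M ((a i - B i) \<union> (B i - a i)) < \<eta>" for M
    proof -
      interpret finite_measure M by fact
      have "measure M ?S \<le> measure M (C n \<union> (\<Union>i<n. (a i - B i) \<union> (B i - a i)))"
        using CM aM BM by (intro finite_measure_mono S) auto
      also have "\<dots> \<le> measure M (C n) + measure M (\<Union>i<n. (a i - B i) \<union> (B i - a i))"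
        using CM aM BM by (intro measure_Un_le) auto
      also have "measure M (\<Union>i<n. (a i - B i) \<union> (B i - a i)) \<le> (\<Sum>i<n. measure M ((a i - B i) \<union> (B i - a i)))"
        using aM BM by (intro finite_measure_subadditive_finite) auto
      also have "\<dots> \<le> (\<Sum>i<n. \<eta>)" using Bm by (intro sum_mono less_imp_le)
      also have "\<dots> \<le> \<epsilon> / 2" using n\<eta> by simp
      finally show ?thesis using Cn by simp
    qed
    from this[OF assms(1) n(1) C(1) a(1) _ B(2)] this[OF assms(2) n(2) C(2) a(2) _ B(3)] G1 B(1) U
    show ?case by blast
  qed
qed

text \<open>For radii in \<open>(a, b]\<close> the law of \<open>(\<omega>, D \<omega>)\<close> on \<open>F \<Otimes> borel\<close> is dominated by a multiple of the product measure on
  dyadic step sets, that is, on sets whose section at \<open>s\<close> depends on \<open>\<lceil>2\<^sup>m s\<rceil>\<close> only.  These form an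
  algebra that generates \<open>F \<Otimes> borel\<close>, so the law is absolutely continuous with respect to the
  product measure, for which a set with null sections is null.\<close>

lemma AE_substitution_avoids_null_sections:
  fixes D :: "'w \<Rightarrow> real"
  assumes "prob_space M" and sub: "subalgebra M F" and D [measurable]: "D \<in> borel_measurable M"
    and "C \<ge> 0"
    and bound: "\<And>A s t. A \<in> sets F \<Longrightarrow> a \<le> s \<Longrightarrow> s < t \<Longrightarrow> t \<le> b \<Longrightarrow>
      measure M {\<omega> \<in> A. D \<omega> \<in> {s<..t}} \<le> C * measure M A * (t - s)"
    and N: "N \<in> sets (F \<Otimes>\<^sub>M borel)"
    and null: "\<And>s. s \<in> {a<..b} \<Longrightarrow> AE \<omega> in M. (\<omega>, s) \<notin> N"
  shows "AE \<omega> in M. D \<omega> \<in> {a<..b} \<longrightarrow> (\<omega>, D \<omega>) \<notin> N"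
proof -
  interpret prob_space M by fact
  have FM: "sets F \<subseteq> sets M" and spF: "space F = space M" using sub by (auto simp: subalgebra_def)
  define P where "P = restr_to_subalg M F"
  have spP: "space P = space M" and setsP [measurable_cong]: "sets P = sets F"
    using sub by (simp_all add: P_def space_restr_to_subalg sets_restr_to_subalg)
  have emP: "emeasure P A = emeasure M A" if "A \<in> sets F" for A
    using that sub by (simp add: P_def emeasure_restr_to_subalg)
  interpret P: prob_space P
    by (rule prob_spaceI) (use sub in \<open>simp add: spP emP subalgebra_def flip: emeasure_space_1; metis emP sets.top spF\<close>)
  define \<Lambda> where "\<Lambda> = density lborel (\<lambda>s. indicator {a<..b} s :: ennreal)"
  have emL: "emeasure \<Lambda> B = emeasure lborel (B \<inter> {a<..b})" if "B \<in> sets borel" for B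
    using that by (simp add: \<Lambda>_def emeasure_density Int_commute flip: indicator_inter_arith)
  have setsL [measurable_cong]: "sets \<Lambda> = sets borel" and spL: "space \<Lambda> = UNIV" by (simp_all add: \<Lambda>_def)
  interpret L: finite_measure \<Lambda>
    by (rule finite_measureI) (use emL[of UNIV] in \<open>cases "a \<le> b"; simp add: spL\<close>)
  interpret PL: pair_sigma_finite P \<Lambda> by unfold_locales
  interpret PLf: finite_measure "P \<Otimes>\<^sub>M \<Lambda>" by (intro finite_measure_pair_measure) unfold_locales
  have sets\<nu>: "sets (P \<Otimes>\<^sub>M \<Lambda>) = sets (F \<Otimes>\<^sub>M borel)" by (intro sets_pair_measure_cong) (auto simp: setsP setsL)
  define \<mu> where "\<mu> = distr (density M (\<lambda>\<omega>. indicator {\<omega>\<in>space M. D \<omega> \<in> {a<..b}} \<omega>)) (F \<Otimes>\<^sub>M borel) (\<lambda>\<omega>. (\<omega>, D \<omega>))"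
  have id: "(\<lambda>\<omega>. \<omega>) \<in> M \<rightarrow>\<^sub>M F" using FM spF by (intro measurableI) (auto simp: subset_iff dest: sets.sets_into_space)
  then have pair [measurable]: "(\<lambda>\<omega>. (\<omega>, D \<omega>)) \<in> M \<rightarrow>\<^sub>M F \<Otimes>\<^sub>M borel" by simp
  have sets\<mu>: "sets \<mu> = sets (F \<Otimes>\<^sub>M borel)" by (simp add: \<mu>_def)
  have em\<mu>: "emeasure \<mu> B = emeasure M {\<omega>\<in>space M. D \<omega> \<in> {a<..b} \<and> (\<omega>, D \<omega>) \<in> B}"
    if B [measurable]: "B \<in> sets (F \<Otimes>\<^sub>M borel)" for B
  proof -
    have "emeasure \<mu> B = emeasure (density M (\<lambda>\<omega>. indicator {\<omega>\<in>space M. D \<omega> \<in> {a<..b}} \<omega>)) ((\<lambda>\<omega>. (\<omega>, D \<omega>)) -` B \<inter> space M)"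
      unfolding \<mu>_def by (subst emeasure_distr) auto
    also have "\<dots> = (\<integral>\<^sup>+\<omega>. indicator {\<omega>\<in>space M. D \<omega> \<in> {a<..b}} \<omega> * indicator ((\<lambda>\<omega>. (\<omega>, D \<omega>)) -` B \<inter> space M) \<omega> \<partial>M)"
      by (rule emeasure_density) measurable
    also have "\<dots> = (\<integral>\<^sup>+\<omega>. indicator {\<omega>\<in>space M. D \<omega> \<in> {a<..b} \<and> (\<omega>, D \<omega>) \<in> B} \<omega> \<partial>M)"
      by (intro nn_integral_cong) (auto simp: indicator_def)
    also have "\<dots> = emeasure M {\<omega>\<in>space M. D \<omega> \<in> {a<..b} \<and> (\<omega>, D \<omega>) \<in> B}"
      by (rule nn_integral_indicator) measurable
    finally show ?thesis .
  qed
  interpret \<mu>: finite_measure \<mu>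
    by (rule finite_measureI) (simp add: em\<mu> sets\<mu> flip: sets\<mu> sets.top)

  \<comment> \<open>the interval may stick out of \<open>(a, b]\<close>, where neither measure has mass\<close>
  have rect: "emeasure \<mu> (A \<times> {l<..u}) \<le> ennreal C * emeasure (P \<Otimes>\<^sub>M \<Lambda>) (A \<times> {l<..u})"
    if A: "A \<in> sets F" for A and l u :: real
  proof -
    define s t where "s = max l a" and "t = min u b"
    have AM: "A \<in> sets M" using A FM by auto
    have int: "{l<..u} \<inter> {a<..b} = {s<..t}" by (auto simp: s_def t_def)
    have 1: "emeasure (P \<Otimes>\<^sub>M \<Lambda>) (A \<times> {l<..u}) = emeasure M A * emeasure lborel {s<..t}"
      using A by (subst L.emeasure_pair_measure_Times) (auto simp: setsP setsL emP emL s_def t_def)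
    have "{\<omega>\<in>space M. D \<omega> \<in> {a<..b} \<and> (\<omega>, D \<omega>) \<in> A \<times> {l<..u}} = {\<omega> \<in> A. D \<omega> \<in> {s<..t}}"
      using sets.sets_into_space[OF AM] by (auto simp: s_def t_def)
    then have 2: "emeasure \<mu> (A \<times> {l<..u}) = measure M {\<omega> \<in> A. D \<omega> \<in> {s<..t}}"
      using A by (subst em\<mu>) (auto simp: emeasure_eq_measure)
    show ?thesis
    proof (cases "s < t")
      case True
      have "measure M {\<omega> \<in> A. D \<omega> \<in> {s<..t}} \<le> C * measure M A * (t - s)"
        using True by (intro bound A) (auto simp: s_def t_def)
      then have "ennreal (measure M {\<omega> \<in> A. D \<omega> \<in> {s<..t}}) \<le> ennreal (C * measure M A * (t - s))"
        by (rule ennreal_leI)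
      also have "\<dots> = ennreal C * (ennreal (measure M A) * ennreal (t - s))"
        using True \<open>C \<ge> 0\<close> by (simp add: ennreal_mult mult.assoc)
      finally show ?thesis unfolding 1 2 using True by (simp add: emeasure_eq_measure)
    next
      case False
      then have "{s<..t} = {}" by auto
      then show ?thesis unfolding 1 2 by simp
    qed
  qed

  define Rs where "Rs m A = {p \<in> space F \<times> UNIV. fst p \<in> A \<lceil>2 ^ m * snd p :: real\<rceil>}" for m :: nat and A :: "int \<Rightarrow> 'w set"
  define G where "G = {Rs m A |m A. \<forall>j. A j \<in> sets F}"
  have refine: "Rs m A = Rs (Suc m) (\<lambda>j. A \<lceil>of_int j / 2 :: real\<rceil>)" for m A
  proof -
    have "\<lceil>of_int \<lceil>2 ^ Suc m * s\<rceil> / 2 :: real\<rceil> = \<lceil>2 ^ m * s\<rceil>" for s :: real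
    proof -
      have "\<lceil>of_int \<lceil>2 * y\<rceil> / 2 :: real\<rceil> = \<lceil>y\<rceil>" for y :: real
      proof (rule ceiling_unique)
        have "2 * y \<le> of_int \<lceil>2 * y\<rceil>" by (rule le_of_int_ceiling)
        then show "of_int \<lceil>y\<rceil> - 1 < (of_int \<lceil>2 * y\<rceil> / 2 :: real)" by linarith
        have "\<lceil>2 * y\<rceil> \<le> 2 * \<lceil>y\<rceil>" unfolding ceiling_le_iff using le_of_int_ceiling[of y] by simp
        then show "(of_int \<lceil>2 * y\<rceil> / 2 :: real) \<le> of_int \<lceil>y\<rceil>" by linarith
      qed
      from this[of "2 ^ m * s"] show ?thesis by (simp add: mult.assoc)
    qed
    then show ?thesis by (simp add: Rs_def)
  qed
  have refine': "\<exists>A'. (\<forall>j. A' j \<in> sets F) \<and> Rs m A = Rs (m + k) A'" if "\<forall>j. A j \<in> sets F" for m k A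
  proof (induction k)
    case 0 show ?case using that by auto
  next
    case (Suc k)
    then obtain A' where A': "\<forall>j. A' j \<in> sets F" "Rs m A = Rs (m + k) A'" by blast
    then have "Rs m A = Rs (m + Suc k) (\<lambda>j. A' \<lceil>of_int j / 2 :: real\<rceil>)" using refine[of "m + k" A'] by simp
    then show ?case using A'(1) by (intro exI[of _ "\<lambda>j. A' \<lceil>of_int j / 2 :: real\<rceil>"]) blast
  qed
  have "algebra (space F \<times> UNIV) G"
    unfolding algebra_iff_Un
  proof (intro conjI ballI)
    show "G \<subseteq> Pow (space F \<times> UNIV)" by (auto simp: G_def Rs_def)
    have "{} = Rs 0 (\<lambda>_. {})" by (auto simp: Rs_def)
    then show "{} \<in> G" unfolding G_def by blast
  next
    fix R assume "R \<in> G"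
    then obtain m A where "R = Rs m A" "\<forall>j. A j \<in> sets F" by (auto simp: G_def)
    moreover from this have "space F \<times> UNIV - R = Rs m (\<lambda>j. space F - A j)" by (auto simp: Rs_def)
    ultimately show "space F \<times> UNIV - R \<in> G" unfolding G_def by blast
  next
    fix R R' assume "R \<in> G" "R' \<in> G"
    then obtain m A m' A' where R: "R = Rs m A" "\<forall>j. A j \<in> sets F" "R' = Rs m' A'" "\<forall>j. A' j \<in> sets F"
      by (auto simp: G_def)
    from refine'[OF R(2), of m m'] refine'[OF R(4), of m' m]
    obtain B B' where B: "\<forall>j. B j \<in> sets F" "R = Rs (m + m') B" "\<forall>j. B' j \<in> sets F" "R' = Rs (m + m') B'"
      using R by (metis add.commute)
    then have "R \<union> R' = Rs (m + m') (\<lambda>j. B j \<union> B' j)" by (auto simp: Rs_def)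
    moreover have "\<forall>j. B j \<union> B' j \<in> sets F" using B by auto
    ultimately show "R \<union> R' \<in> G" unfolding G_def by blast
  qed
  have slab: "{p \<in> space F \<times> UNIV. \<lceil>2 ^ m * snd p :: real\<rceil> = j \<and> fst p \<in> A} = A \<times> {(of_int j - 1) / 2 ^ m<..of_int j / 2 ^ m}"
    if "A \<in> sets F" for A m j
    using sets.sets_into_space[OF that]
    by (auto simp: ceiling_eq_iff field_simps)
  have Rs_UN: "Rs m A = (\<Union>j. A j \<times> {(of_int j - 1) / 2 ^ m<..of_int j / 2 ^ m})" if A: "\<forall>j. A j \<in> sets F" for m A
    unfolding slab[OF A[rule_format], symmetric] by (auto simp: Rs_def)
  have G_sets: "R \<in> sets (F \<Otimes>\<^sub>M borel)" if "R \<in> G" for R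
  proof -
    obtain m A where R: "R = Rs m A" and A: "\<forall>j. A j \<in> sets F" using \<open>R \<in> G\<close> by (auto simp: G_def)
    show ?thesis unfolding R Rs_UN[OF A] using A by (intro sets.countable_UN' pair_measureI) auto
  qed
  have gen: "sets (F \<Otimes>\<^sub>M borel) = sigma_sets (space F \<times> UNIV) G"
  proof
    let ?S = "sigma (space F \<times> UNIV) G"
    have Gs: "G \<subseteq> Pow (space F \<times> (UNIV::real set))" by (auto simp: G_def Rs_def)
    have "fst \<in> ?S \<rightarrow>\<^sub>M F"
    proof (rule measurableI)
      fix A assume A: "A \<in> sets F"
      have "fst -` A \<inter> space ?S = Rs 0 (\<lambda>_. A)" using Gs by (auto simp: Rs_def)
      moreover have "Rs 0 (\<lambda>_. A) \<in> G" using A by (auto simp: G_def)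
      ultimately show "fst -` A \<inter> space ?S \<in> sets ?S" using Gs by auto
    qed (use Gs in auto)
    moreover have "snd \<in> ?S \<rightarrow>\<^sub>M borel"
    proof (rule borel_measurable_LIMSEQ_real)
      show "(\<lambda>m. of_int \<lceil>2 ^ m * snd p\<rceil> / 2 ^ m) \<longlonglongrightarrow> snd p" for p :: "'w \<times> real"
      proof (rule tendsto_sandwich[of "\<lambda>_. snd p" _ _ "\<lambda>m. snd p + (1/2) ^ m"])
        show "\<forall>\<^sub>F m in sequentially. snd p \<le> of_int \<lceil>2 ^ m * snd p\<rceil> / 2 ^ m"
          by (intro always_eventually allI) (simp add: field_simps)
        show "\<forall>\<^sub>F m in sequentially. of_int \<lceil>2 ^ m * snd p\<rceil> / 2 ^ m \<le> snd p + (1/2) ^ m"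
        proof (intro always_eventually allI)
          fix m :: nat
          have "of_int \<lceil>2 ^ m * snd p\<rceil> \<le> 2 ^ m * snd p + 1" by (rule of_int_ceiling_le_add_one)
          then show "of_int \<lceil>2 ^ m * snd p\<rceil> / 2 ^ m \<le> snd p + (1/2) ^ m"
            by (simp add: field_simps power_divide)
        qed
        have "(\<lambda>m. snd p + (1/2) ^ m) \<longlonglongrightarrow> snd p + 0"
          by (intro tendsto_intros LIMSEQ_power_zero) simp
        then show "(\<lambda>m. snd p + (1/2) ^ m) \<longlonglongrightarrow> snd p" by simp
      qed simp
      fix m
      have "(\<lambda>p. \<lceil>2 ^ m * snd p\<rceil>) \<in> ?S \<rightarrow>\<^sub>M count_space UNIV"
      proof (rule measurable_count_space_eq2_countable[THEN iffD2], safe)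
        fix j :: int
        have "(\<lambda>p. \<lceil>2 ^ m * snd p :: real\<rceil>) -` {j} \<inter> space ?S = Rs m (\<lambda>i. if i = j then space F else {})"
          using Gs by (auto simp: Rs_def split: if_splits)
        moreover have "Rs m (\<lambda>i. if i = j then space F else {}) \<in> G"
          unfolding G_def by (auto intro!: exI[of _ m] exI[of _ "\<lambda>i. if i = j then space F else {}"])
        ultimately show "(\<lambda>p. \<lceil>2 ^ m * snd p :: real\<rceil>) -` {j} \<inter> space ?S \<in> sets ?S" using Gs by auto
      qed auto
      then show "(\<lambda>p. of_int \<lceil>2 ^ m * snd p\<rceil> / 2 ^ m :: real) \<in> borel_measurable ?S"
        by measurable
    qed
    ultimately have "(\<lambda>p. (fst p, snd p)) \<in> ?S \<rightarrow>\<^sub>M F \<Otimes>\<^sub>M borel" by measurable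
    then have *: "(\<lambda>p. p) \<in> ?S \<rightarrow>\<^sub>M F \<Otimes>\<^sub>M borel" by simp
    show "sets (F \<Otimes>\<^sub>M borel) \<subseteq> sigma_sets (space F \<times> UNIV) G"
    proof
      fix B assume B: "B \<in> sets (F \<Otimes>\<^sub>M (borel :: real measure))"
      then have "B \<subseteq> space F \<times> UNIV" using sets.sets_into_space[OF B] by (simp add: space_pair_measure)
      then have "(\<lambda>p. p) -` B \<inter> space ?S = B" using Gs by auto
      then show "B \<in> sigma_sets (space F \<times> UNIV) G" using measurable_sets[OF * B] Gs by auto
    qed
    show "sigma_sets (space F \<times> UNIV) G \<subseteq> sets (F \<Otimes>\<^sub>M borel)"
      using G_sets sets.sigma_sets_subset[of G "F \<Otimes>\<^sub>M borel"] by (auto simp: space_pair_measure)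
  qed
  have dom: "measure \<mu> R \<le> C * measure (P \<Otimes>\<^sub>M \<Lambda>) R" if "R \<in> G" for R
  proof -
    obtain m A where R: "R = Rs m A" and A: "\<forall>j. A j \<in> sets F" using \<open>R \<in> G\<close> by (auto simp: G_def)
    let ?I = "\<lambda>j::int. A j \<times> {(of_int j - 1) / 2 ^ m<..of_int j / 2 ^ m :: real}"
    have disj: "disjoint_family ?I"
      unfolding slab[OF A[rule_format], symmetric] by (auto simp: disjoint_family_on_def)
    have I: "?I j \<in> sets (F \<Otimes>\<^sub>M borel)" for j using A by auto
    have "emeasure \<mu> R = (\<integral>\<^sup>+j. emeasure \<mu> (?I j) \<partial>count_space UNIV)"
      unfolding R Rs_UN[OF A] using I disj by (intro emeasure_UN_countable) (auto simp: sets\<mu>)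
    also have "\<dots> \<le> (\<integral>\<^sup>+j. ennreal C * emeasure (P \<Otimes>\<^sub>M \<Lambda>) (?I j) \<partial>count_space UNIV)"
      using A by (intro nn_integral_mono rect) auto
    also have "\<dots> = ennreal C * (\<integral>\<^sup>+j. emeasure (P \<Otimes>\<^sub>M \<Lambda>) (?I j) \<partial>count_space UNIV)"
      by (rule nn_integral_cmult) simp
    also have "(\<integral>\<^sup>+j. emeasure (P \<Otimes>\<^sub>M \<Lambda>) (?I j) \<partial>count_space UNIV) = emeasure (P \<Otimes>\<^sub>M \<Lambda>) R"
      unfolding R Rs_UN[OF A] using I disj by (intro emeasure_UN_countable[symmetric]) (auto simp: sets\<nu>)
    finally show ?thesis using \<open>C \<ge> 0\<close>
      by (simp add: \<mu>.emeasure_eq_measure PLf.emeasure_eq_measure flip: ennreal_mult')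
  qed
  have \<nu>N: "measure (P \<Otimes>\<^sub>M \<Lambda>) N = 0"
  proof -
    have N': "N \<in> sets (P \<Otimes>\<^sub>M \<Lambda>)" using N sets\<nu> by simp
    have sec: "(\<lambda>\<omega>. (\<omega>, s)) -` N \<in> sets F" for s using sets_Pair2[OF N] .
    have "emeasure P ((\<lambda>\<omega>. (\<omega>, s)) -` N) = 0" if "s \<in> {a<..b}" for s
    proof -
      have "AE \<omega> in M. \<omega> \<notin> (\<lambda>\<omega>. (\<omega>, s)) -` N" using null[OF that] by simp
      then have "(\<lambda>\<omega>. (\<omega>, s)) -` N \<in> null_sets M"
        using sec FM by (subst (asm) AE_iff_null_sets[symmetric]) auto
      then show ?thesis using sec by (simp add: emP null_sets_def)
    qed
    then have "AE s in \<Lambda>. emeasure P ((\<lambda>\<omega>. (\<omega>, s)) -` N) = 0"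
      unfolding \<Lambda>_def by (subst AE_density) (auto simp: indicator_def)
    then have "(\<integral>\<^sup>+s. emeasure P ((\<lambda>\<omega>. (\<omega>, s)) -` N) \<partial>\<Lambda>) = (\<integral>\<^sup>+s. 0 \<partial>\<Lambda>)"
      by (rule nn_integral_cong_AE)
    then have "emeasure (P \<Otimes>\<^sub>M \<Lambda>) N = 0"
      by (simp add: PL.emeasure_pair_measure_alt2[OF N'])
    then show ?thesis by (simp add: measure_def)
  qed
  \<comment> \<open>domination holds on the algebra only; approximation in both measures carries it over to \<open>N\<close>\<close>
  have "measure \<mu> N \<le> 0"
  proof (rule field_le_epsilon)
    fix \<eta> :: real assume "\<eta> > 0"
    define \<epsilon> where "\<epsilon> = \<eta> / (C + 1)"
    have "\<epsilon> > 0" using \<open>\<eta> > 0\<close> \<open>C \<ge> 0\<close> by (simp add: \<epsilon>_def)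
    obtain R where R: "R \<in> G" "measure \<mu> ((N - R) \<union> (R - N)) < \<epsilon>"
      "measure (P \<Otimes>\<^sub>M \<Lambda>) ((N - R) \<union> (R - N)) < \<epsilon>"
      using sets_approximated_by_algebra[OF \<mu>.finite_measure_axioms PLf.finite_measure_axioms
          \<open>algebra (space F \<times> UNIV) G\<close>, of N \<epsilon>] N \<open>\<epsilon> > 0\<close> gen sets\<mu> sets\<nu> by metis
    have RS: "R \<in> sets (F \<Otimes>\<^sub>M borel)" using G_sets R(1) .
    have "measure \<mu> N \<le> measure \<mu> (R \<union> ((N - R) \<union> (R - N)))"
      using RS N by (intro \<mu>.finite_measure_mono) (auto simp: sets\<mu>)
    also have "\<dots> \<le> measure \<mu> R + measure \<mu> ((N - R) \<union> (R - N))"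
      using RS N by (intro measure_Un_le) (auto simp: sets\<mu>)
    also have "\<dots> \<le> C * measure (P \<Otimes>\<^sub>M \<Lambda>) R + \<epsilon>" using dom[OF R(1)] R(2) by simp
    also have "measure (P \<Otimes>\<^sub>M \<Lambda>) R \<le> measure (P \<Otimes>\<^sub>M \<Lambda>) (N \<union> ((N - R) \<union> (R - N)))"
      using RS N by (intro PLf.finite_measure_mono) (auto simp: sets\<nu>)
    also have "\<dots> \<le> measure (P \<Otimes>\<^sub>M \<Lambda>) N + measure (P \<Otimes>\<^sub>M \<Lambda>) ((N - R) \<union> (R - N))"
      using RS N by (intro measure_Un_le) (auto simp: sets\<nu>)
    also have "\<dots> \<le> \<epsilon>" using \<nu>N R(3) by simp
    finally have "measure \<mu> N \<le> C * \<epsilon> + \<epsilon>" using \<open>C \<ge> 0\<close> by (simp add: mult_left_mono)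
    also have "\<dots> = (C + 1) * \<epsilon>" by (simp add: algebra_simps)
    also have "\<dots> = \<eta>" using \<open>C \<ge> 0\<close> by (simp add: \<epsilon>_def)
    finally show "measure \<mu> N \<le> 0 + \<eta>" by simp
  qed
  then have "emeasure \<mu> N = 0" by (simp add: \<mu>.emeasure_eq_measure measure_nonneg antisym)
  then have "emeasure M {\<omega>\<in>space M. D \<omega> \<in> {a<..b} \<and> (\<omega>, D \<omega>) \<in> N} = 0" using em\<mu>[OF N] by simp
  moreover have "{\<omega>\<in>space M. D \<omega> \<in> {a<..b} \<and> (\<omega>, D \<omega>) \<in> N} \<in> sets M"
    using N by measurable
  ultimately show ?thesis by (intro AE_I') (auto simp: null_sets_def)
qed

section \<open>An exponential inequality\<close>

lemma exp_le_one_plus_square: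
  fixes z :: real
  assumes "\<bar>z\<bar> \<le> 1"
  shows "exp z \<le> 1 + z + z\<^sup>2"
proof (cases "z \<ge> 0")
  case True
  then show ?thesis using exp_bound assms by simp
next
  case False
  \<comment> \<open>For \<open>y = -z\<close> in \<open>[0,1]\<close>: \<open>exp z = 1 / exp y \<le> 1 / (1 + y) \<le> 1 - y + y\<^sup>2\<close>.\<close>
  define y where "y = - z"
  have y: "0 \<le> y" "y \<le> 1" using False assms by (auto simp: y_def)
  have "exp (- y) = inverse (exp y)" by (simp add: exp_minus)
  also have "\<dots> \<le> inverse (1 + y)"
    using y by (intro le_imp_inverse_le exp_ge_add_one_self) auto
  also have "\<dots> \<le> 1 - y + y\<^sup>2"
  proof -
    have "(1 - y + y\<^sup>2) * (1 + y) = 1 + y ^ 3" by (simp add: algebra_simps power2_eq_square power3_eq_cube)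
    then have "1 \<le> (1 - y + y\<^sup>2) * (1 + y)" using y by simp
    then show ?thesis using y by (simp add: field_simps)
  qed
  finally show ?thesis by (simp add: y_def)
qed

text \<open>The compensated exponential is a supermartingale: conditionally on the past, \<open>exp (l Z)\<close> has
  mean at most \<open>1 + (l + l\<^sup>2 \<kappa>) p \<le> exp ((l + l\<^sup>2 \<kappa>) p)\<close>, where \<open>p\<close> is the conditional mean of
  \<open>Z \<in> [0, \<kappa>]\<close>, because then \<open>Z\<^sup>2 \<le> \<kappa> Z\<close>.\<close>

lemma compensated_exponential_mean_le_1:
  fixes Z :: "nat \<Rightarrow> 'w \<Rightarrow> real" and F :: "nat \<Rightarrow> 'w measure"
  assumes "prob_space M"
    and sub: "\<And>i. i \<in> {1..n} \<Longrightarrow> subalgebra M (F (i - 1))"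
    and mono: "\<And>i j. i \<le> j \<Longrightarrow> j < n \<Longrightarrow> sets (F i) \<subseteq> sets (F j)"
    and Z_F: "\<And>i j. 1 \<le> i \<Longrightarrow> i \<le> j \<Longrightarrow> j < n \<Longrightarrow> Z i \<in> borel_measurable (F j)"
    and Z_meas: "\<And>i. i \<in> {1..n} \<Longrightarrow> Z i \<in> borel_measurable M"
    and Z: "\<And>i \<omega>. i \<in> {1..n} \<Longrightarrow> Z i \<omega> \<in> {0..\<kappa>}"
    and l: "\<bar>l\<bar> * \<kappa> \<le> 1"
  defines "p \<equiv> \<lambda>i. real_cond_exp M (F (i - 1)) (Z i)"
  shows "integrable M (\<lambda>\<omega>. exp (\<Sum>i=1..n. l * Z i \<omega> - (l + l\<^sup>2 * \<kappa>) * p i \<omega>))"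
    and "(LINT \<omega>|M. exp (\<Sum>i=1..n. l * Z i \<omega> - (l + l\<^sup>2 * \<kappa>) * p i \<omega>)) \<le> 1"
proof -
  interpret prob_space M by fact
  let ?q = "l + l\<^sup>2 * \<kappa>"
  have pmeas [measurable]: "p i \<in> borel_measurable M" for i
    unfolding p_def by (rule borel_measurable_cond_exp2)
  define E where "E m \<omega> = exp (\<Sum>i=1..m. l * Z i \<omega> - ?q * p i \<omega>)" for m \<omega>
  have p_bd: "AE \<omega> in M. p i \<omega> \<in> {0..\<kappa>}" if i: "i \<in> {1..n}" for i
  proof -
    interpret finite_measure_subalgebra M "F (i - 1)" using sub[OF i] by unfold_locales
    have [measurable]: "Z i \<in> borel_measurable M" using Z_meas[OF i] .
    have int: "integrable M (Z i)"
      using Z[OF i] by (intro integrable_const_bound[where B = \<kappa>]) auto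
    have "AE \<omega> in M. real_cond_exp M (F (i - 1)) (Z i) \<omega> \<ge> 0"
      using Z[OF i] by (intro real_cond_exp_ge_c int) auto
    moreover have "AE \<omega> in M. real_cond_exp M (F (i - 1)) (Z i) \<omega> \<le> \<kappa>"
      using Z[OF i] by (intro real_cond_exp_le_c int) auto
    ultimately show ?thesis unfolding p_def by eventually_elim auto
  qed
  have E_meas: "E m \<in> borel_measurable M" if "m \<le> n" for m
  proof -
    have [measurable]: "\<And>i. i \<in> {1..m} \<Longrightarrow> Z i \<in> borel_measurable M" using Z_meas that by auto
    show ?thesis unfolding E_def by measurable
  qed
  have E_int: "integrable M (E m)" if m: "m \<le> n" for m
  proof (rule integrable_const_bound)
    have "AE \<omega> in M. \<forall>i\<in>{1..m}. p i \<omega> \<in> {0..\<kappa>}"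
      using p_bd m by (subst AE_ball_countable) auto
    then show "AE \<omega> in M. norm (E m \<omega>) \<le> exp (\<Sum>i=1..m. \<bar>l\<bar> * \<kappa> + \<bar>?q\<bar> * \<kappa>)"
    proof eventually_elim
      case (elim \<omega>)
      have "l * Z i \<omega> - ?q * p i \<omega> \<le> \<bar>l\<bar> * \<kappa> + \<bar>?q\<bar> * \<kappa>" if i: "i \<in> {1..m}" for i
      proof -
        have "l * Z i \<omega> \<le> \<bar>l\<bar> * \<kappa>"
          using Z[of i \<omega>] i m by (intro order.trans[OF mult_right_mono[OF abs_ge_self] mult_left_mono]) auto
        moreover have "- ?q * p i \<omega> \<le> \<bar>?q\<bar> * \<kappa>"
        proof -
          have "- ?q * p i \<omega> \<le> \<bar>?q\<bar> * p i \<omega>"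
            using elim i by (intro mult_right_mono) auto
          also have "\<dots> \<le> \<bar>?q\<bar> * \<kappa>" using elim i by (intro mult_left_mono) auto
          finally show ?thesis .
        qed
        ultimately show ?thesis by linarith
      qed
      then show ?case by (simp only: E_def norm_exp real_norm_def abs_exp_cancel exp_le_cancel_iff) (rule sum_mono)
    qed
  qed (rule E_meas[OF m])
  have "(LINT \<omega>|M. E m \<omega>) \<le> 1" if "m \<le> n" for m
    using that
  proof (induction m)
    case 0
    show ?case by (simp add: E_def prob_space)
  next
    case (Suc m)
    then have i: "Suc m \<in> {1..n}" by simp
    interpret fs: finite_measure_subalgebra M "F m" using sub[OF i] by unfold_locales simp
    let ?Z = "Z (Suc m)" and ?p = "p (Suc m)"
    have [measurable]: "?Z \<in> borel_measurable M" using Z_meas[OF i] .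
    have Zb: "\<And>\<omega>. 0 \<le> ?Z \<omega>" "\<And>\<omega>. ?Z \<omega> \<le> \<kappa>" using Z[OF i] by auto
    have intZ: "integrable M ?Z"
      using Zb by (intro integrable_const_bound[where B = \<kappa>]) auto
    have p_eq: "?p = real_cond_exp M (F m) ?Z" by (simp add: p_def)
    \<comment> \<open>\<open>G\<close> collects the factors that are known before \<open>Z (Suc m)\<close> is revealed\<close>
    define G where "G \<omega> = E m \<omega> * exp (- ?q * ?p \<omega>)" for \<omega>
    have pF: "p i \<in> borel_measurable (F m)" if "i \<in> {1..Suc m}" for i
    proof -
      have "sets (F (i - 1)) \<subseteq> sets (F m)" using that Suc.prems by (intro mono) auto
      moreover have "space (F (i - 1)) = space (F m)"
        using sub[of i] sub[OF i] that Suc.prems by (auto simp: subalgebra_def)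
      ultimately have "subalgebra (F m) (F (i - 1))" by (simp add: subalgebra_def)
      then show ?thesis unfolding p_def
        by (rule measurable_from_subalg) (rule borel_measurable_cond_exp)
    qed
    have G_F: "G \<in> borel_measurable (F m)"
    proof -
      have [measurable]: "\<And>i. i \<in> {1..m} \<Longrightarrow> Z i \<in> borel_measurable (F m)"
        using Suc.prems by (intro Z_F) auto
      have [measurable]: "\<And>i. i \<in> {1..m} \<Longrightarrow> p i \<in> borel_measurable (F m)" "?p \<in> borel_measurable (F m)"
        using pF by auto
      show ?thesis unfolding G_def E_def by measurable
    qed
    have ES: "E (Suc m) \<omega> = G \<omega> * exp (l * ?Z \<omega>)" for \<omega>
      by (simp add: E_def G_def exp_add exp_diff exp_minus field_simps)
    have EG: "E m \<omega> = G \<omega> * exp (?q * ?p \<omega>)" for \<omega>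
      by (simp add: G_def mult.assoc flip: exp_add distrib_right)
    have G_pos: "G \<omega> \<ge> 0" for \<omega> by (simp add: G_def E_def)
    have G_int: "integrable M G"
    proof (rule Bochner_Integration.integrable_bound[OF integrable_mult_right[OF E_int[of m], of "exp (\<bar>?q\<bar> * \<kappa>)"]])
      show "AE \<omega> in M. norm (G \<omega>) \<le> norm (exp (\<bar>?q\<bar> * \<kappa>) * E m \<omega>)"
        using p_bd[OF i]
      proof eventually_elim
        case (elim \<omega>)
        have "- ?q * ?p \<omega> \<le> \<bar>?q\<bar> * ?p \<omega>" using elim by (intro mult_right_mono) auto
        also have "\<dots> \<le> \<bar>?q\<bar> * \<kappa>" using elim by (intro mult_left_mono) auto
        finally have "E m \<omega> * exp (- ?q * ?p \<omega>) \<le> E m \<omega> * exp (\<bar>?q\<bar> * \<kappa>)"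
          by (intro mult_left_mono) (simp_all add: E_def)
        then show ?case by (simp add: G_def E_def mult.commute abs_mult)
      qed
      show "G \<in> borel_measurable M" using measurable_from_subalg[OF fs.subalg G_F] .
    qed (use Suc.prems in simp)
    have GM [measurable]: "G \<in> borel_measurable M" using G_int by auto
    have GZ_int: "integrable M (\<lambda>\<omega>. G \<omega> * ?Z \<omega>)"
      using Zb by (intro Bochner_Integration.integrable_bound[OF integrable_mult_left[OF G_int, of \<kappa>]])
        (auto simp: abs_mult G_pos intro!: AE_I2 mult_left_mono order.trans[OF _ abs_ge_self])
    have "(LINT \<omega>|M. E (Suc m) \<omega>) \<le> (LINT \<omega>|M. G \<omega> + ?q * (G \<omega> * ?Z \<omega>))"
    proof (intro integral_mono E_int Suc.prems)
      fix \<omega>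
      have "\<bar>l * ?Z \<omega>\<bar> \<le> \<bar>l\<bar> * \<kappa>" using Zb by (simp add: abs_mult mult_left_mono)
      then have "exp (l * ?Z \<omega>) \<le> 1 + l * ?Z \<omega> + (l * ?Z \<omega>)\<^sup>2"
        using l by (intro exp_le_one_plus_square) linarith
      also have "(l * ?Z \<omega>)\<^sup>2 \<le> l\<^sup>2 * (\<kappa> * ?Z \<omega>)"
        unfolding power_mult_distrib power2_eq_square[of "?Z \<omega>"]
        using Zb by (intro mult_left_mono mult_right_mono) auto
      finally have "exp (l * ?Z \<omega>) \<le> 1 + ?q * ?Z \<omega>" by (simp add: algebra_simps)
      then have "G \<omega> * exp (l * ?Z \<omega>) \<le> G \<omega> * (1 + ?q * ?Z \<omega>)"
        using G_pos by (rule mult_left_mono)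
      then show "E (Suc m) \<omega> \<le> G \<omega> + ?q * (G \<omega> * ?Z \<omega>)" by (simp add: ES algebra_simps)
    qed (use G_int GZ_int in auto)
    also have "\<dots> = (LINT \<omega>|M. G \<omega>) + ?q * (LINT \<omega>|M. G \<omega> * ?Z \<omega>)"
      using G_int GZ_int by simp
    also have "(LINT \<omega>|M. G \<omega> * ?Z \<omega>) = (LINT \<omega>|M. G \<omega> * ?p \<omega>)"
      unfolding p_eq using fs.real_cond_exp_intg(2)[OF GZ_int G_F] by simp
    also have "(LINT \<omega>|M. G \<omega>) + ?q * (LINT \<omega>|M. G \<omega> * ?p \<omega>) = (LINT \<omega>|M. G \<omega> + ?q * (G \<omega> * ?p \<omega>))"
      using G_int fs.real_cond_exp_intg(1)[OF GZ_int G_F] by (simp add: p_eq)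
    also have "\<dots> \<le> (LINT \<omega>|M. E m \<omega>)"
    proof (intro integral_mono)
      show "integrable M (\<lambda>\<omega>. G \<omega> + ?q * (G \<omega> * ?p \<omega>))"
        using G_int fs.real_cond_exp_intg(1)[OF GZ_int G_F] by (simp add: p_eq)
      fix \<omega>
      have "G \<omega> * (1 + ?q * ?p \<omega>) \<le> G \<omega> * exp (?q * ?p \<omega>)"
        using G_pos by (intro mult_left_mono exp_ge_add_one_self) auto
      then show "G \<omega> + ?q * (G \<omega> * ?p \<omega>) \<le> E m \<omega>" unfolding EG by (simp add: algebra_simps)
    qed (use Suc.prems E_int in simp)
    also have "\<dots> \<le> 1" using Suc by simp
    finally show ?case .
  qed
  from this[of n] E_int[of n]
  show "integrable M (\<lambda>\<omega>. exp (\<Sum>i=1..n. l * Z i \<omega> - ?q * p i \<omega>))"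
    "(LINT \<omega>|M. exp (\<Sum>i=1..n. l * Z i \<omega> - ?q * p i \<omega>)) \<le> 1"
    by (simp_all add: E_def[abs_def])
qed

section \<open>Centred sums over triangular arrays\<close>

text \<open>Markov's inequality for the compensated exponential at \<open>l = \<plusminus> sqrt (ln n / v\<^sub>n)\<close> and the level
  \<open>n\<^sup>2\<close> gives summable probabilities.  By Borel-Cantelli, almost surely eventually
  \<open>l (\<Sum>Z - \<Sum>p) \<le> l\<^sup>2 \<kappa> \<Sum>p + 2 ln n = O(ln n)\<close>, whatever the dependence between rows.\<close>

lemma centred_triangular_sum_bigo:
  fixes Z :: "nat \<Rightarrow> nat \<Rightarrow> 'w \<Rightarrow> real" and F :: "nat \<Rightarrow> nat \<Rightarrow> 'w measure" and v :: "nat \<Rightarrow> real"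
  assumes "prob_space M"
    and sub: "\<And>n i. i \<in> {1..n} \<Longrightarrow> subalgebra M (F n (i - 1))"
    and mono: "\<And>n i j. i \<le> j \<Longrightarrow> j < n \<Longrightarrow> sets (F n i) \<subseteq> sets (F n j)"
    and Z_F: "\<And>n i j. 1 \<le> i \<Longrightarrow> i \<le> j \<Longrightarrow> j < n \<Longrightarrow> Z n i \<in> borel_measurable (F n j)"
    and Z_meas: "\<And>n i. i \<in> {1..n} \<Longrightarrow> Z n i \<in> borel_measurable M"
    and Z: "\<And>n i \<omega>. i \<in> {1..n} \<Longrightarrow> Z n i \<omega> \<in> {0..\<kappa>}"
    and v_pos: "eventually (\<lambda>n. v n > 0) sequentially" and v: "(\<lambda>n. ln (real n) / v n) \<longlonglongrightarrow> 0"
    and p_bd: "AE \<omega> in M. \<exists>C. eventually (\<lambda>n.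
      (\<Sum>i=1..n. real_cond_exp M (F n (i - 1)) (Z n i) \<omega>) \<le> C * v n) sequentially"
  shows "AE \<omega> in M. (\<lambda>n. (\<Sum>i=1..n. Z n i \<omega>) - (\<Sum>i=1..n. real_cond_exp M (F n (i - 1)) (Z n i) \<omega>))
    \<in> O(\<lambda>n. sqrt (ln (real n) * v n))"
proof -
  interpret prob_space M by fact
  define p where "p n i = real_cond_exp M (F n (i - 1)) (Z n i)" for n i
  have p_meas [measurable]: "p n i \<in> borel_measurable M" for n i
    unfolding p_def by (rule borel_measurable_cond_exp2)
  define \<kappa>' where "\<kappa>' = max \<kappa> 0"
  define u where "u n = sqrt (ln (real n) / v n)" for n
  have "(\<lambda>n. u n * \<kappa>') \<longlonglongrightarrow> sqrt 0 * \<kappa>'"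
    unfolding u_def by (intro tendsto_intros v)
  then have "eventually (\<lambda>n. u n * \<kappa>' < 1) sequentially" by (intro order_tendstoD) auto
  with v_pos eventually_ge_at_top[of 2]
  have ev: "eventually (\<lambda>n. v n > 0 \<and> n \<ge> 2 \<and> u n * \<kappa>' < 1) sequentially"
    by eventually_elim auto
  have one_sided: "AE \<omega> in M. eventually (\<lambda>n. \<sigma> * u n * ((\<Sum>i=1..n. Z n i \<omega>) - (\<Sum>i=1..n. p n i \<omega>))
      \<le> (u n)\<^sup>2 * \<kappa>' * (\<Sum>i=1..n. p n i \<omega>) + 2 * ln (real n)) sequentially"
    if \<sigma>: "\<sigma> = 1 \<or> \<sigma> = - 1" for \<sigma> :: real
  proof -
    define l where "l n = \<sigma> * u n" for n
    define T where "T n \<omega> = (\<Sum>i=1..n. l n * Z n i \<omega> - (l n + (l n)\<^sup>2 * \<kappa>') * p n i \<omega>)" for n \<omega>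
    define good where "good n \<longleftrightarrow> v n > 0 \<and> n \<ge> 2 \<and> u n * \<kappa>' < 1" for n
    define A where "A n = (if good n then {\<omega>\<in>space M. exp (T n \<omega>) \<ge> (real n)\<^sup>2} else {})" for n
    have T_meas [measurable]: "T n \<in> borel_measurable M" for n
    proof -
      have [measurable]: "\<And>i. i \<in> {1..n} \<Longrightarrow> Z n i \<in> borel_measurable M" by (rule Z_meas)
      show ?thesis unfolding T_def by measurable
    qed
    have A_sets [measurable]: "A n \<in> sets M" for n unfolding A_def by simp
    have A_le: "measure M (A n) \<le> inverse ((real n)\<^sup>2)" for n
    proof (cases "good n")
      case True
      then have g: "v n > 0" "n \<ge> 2" "u n * \<kappa>' < 1" by (auto simp: good_def)
      have l1: "\<bar>l n\<bar> * \<kappa>' \<le> 1"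
        using \<sigma> g by (auto simp: l_def abs_mult u_def)
      have Z1: "Z n i \<omega> \<in> {0..\<kappa>'}" if "i \<in> {1..n}" for i \<omega>
        using Z[OF that, of \<omega>] by (auto simp: \<kappa>'_def)
      note exp_bound = compensated_exponential_mean_le_1[where F = "F n" and Z = "Z n" and n = n and \<kappa> = \<kappa>' and l = "l n",
          OF prob_space_axioms sub mono Z_F Z_meas Z1 l1]
      have T: "integrable M (\<lambda>\<omega>. exp (T n \<omega>))" "(LINT \<omega>|M. exp (T n \<omega>)) \<le> 1"
        using exp_bound unfolding T_def p_def by blast+
      have "measure M {\<omega>\<in>space M. exp (T n \<omega>) \<ge> (real n)\<^sup>2} \<le> (LINT \<omega>|M. exp (T n \<omega>)) / (real n)\<^sup>2"
        using T(1) g by (intro integral_Markov_inequality_measure[where A = "{}"]) auto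
      also have "\<dots> \<le> 1 / (real n)\<^sup>2" using T(2) by (intro divide_right_mono) auto
      finally show ?thesis using True by (simp add: A_def inverse_eq_divide)
    qed (simp add: A_def)
    have "AE \<omega> in M. eventually (\<lambda>n. \<omega> \<in> space M - A n) sequentially"
    proof (rule borel_cantelli_AE1)
      show "emeasure M (A n) < \<infinity>" for n by (simp add: emeasure_eq_measure)
      show "summable (\<lambda>n. measure M (A n))"
        using A_le by (intro summable_comparison_test'[OF inverse_power_summable[of 2], of 0]) auto
    qed simp
    then show ?thesis
    proof eventually_elim
      case (elim \<omega>)
      with ev show ?case
      proof eventually_elim
        case (elim n)
        then have n: "real n > 0" "exp (T n \<omega>) < (real n)\<^sup>2" by (auto simp: A_def good_def not_le)
        then have "T n \<omega> < ln ((real n)\<^sup>2)"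
          by (metis exp_gt_zero ln_exp ln_less_cancel_iff order.strict_trans)
        also have "\<dots> = 2 * ln (real n)" using n by (simp add: ln_realpow)
        finally have "T n \<omega> \<le> 2 * ln (real n)" by simp
        moreover have "T n \<omega> = l n * ((\<Sum>i=1..n. Z n i \<omega>) - (\<Sum>i=1..n. p n i \<omega>)) - (l n)\<^sup>2 * \<kappa>' * (\<Sum>i=1..n. p n i \<omega>)"
          by (simp add: T_def sum_subtractf sum.distrib sum_distrib_left algebra_simps)
        moreover have "(l n)\<^sup>2 = (u n)\<^sup>2" using \<sigma> by (auto simp: l_def)
        ultimately show ?case by (simp add: l_def)
      qed
    qed
  qed
  show ?thesis
    using one_sided[of 1, OF disjI1[OF refl]] one_sided[of "-1", OF disjI2[OF refl]] p_bd
  proof eventually_elim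
    case (elim \<omega>)
    then obtain C where "eventually (\<lambda>n. (\<Sum>i=1..n. p n i \<omega>) \<le> C * v n) sequentially"
      by (auto simp: p_def)
    with elim(1,2) ev
    have "eventually (\<lambda>n. norm ((\<Sum>i=1..n. Z n i \<omega>) - (\<Sum>i=1..n. p n i \<omega>))
      \<le> (\<kappa>' * C + 2) * norm (sqrt (ln (real n) * v n))) sequentially"
    proof eventually_elim
      case (elim n)
      define S where "S = (\<Sum>i=1..n. Z n i \<omega>) - (\<Sum>i=1..n. p n i \<omega>)"
      have v: "v n > 0" and ln: "ln (real n) > 0" using elim(3) by auto
      have u: "u n > 0" using v ln by (simp add: u_def)
      have u2: "(u n)\<^sup>2 = ln (real n) / v n" using v ln by (simp add: u_def)
      have "(u n)\<^sup>2 * \<kappa>' * (\<Sum>i=1..n. p n i \<omega>) \<le> (u n)\<^sup>2 * \<kappa>' * (C * v n)"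
        using elim(4) by (intro mult_left_mono) (auto simp: \<kappa>'_def)
      also have "\<dots> = \<kappa>' * C * ln (real n)" using v by (simp add: u2)
      finally have "u n * \<bar>S\<bar> \<le> (\<kappa>' * C + 2) * ln (real n)"
        using elim(1,2) unfolding S_def[symmetric] by (cases "S \<ge> 0") (auto simp: algebra_simps)
      also have "ln (real n) = u n * sqrt (ln (real n) * v n)"
      proof -
        have "u n * sqrt (ln (real n) * v n) = sqrt (ln (real n) / v n * (ln (real n) * v n))"
          unfolding u_def by (rule real_sqrt_mult[symmetric])
        also have "ln (real n) / v n * (ln (real n) * v n) = (ln (real n))\<^sup>2" using v by (simp add: power2_eq_square)
        finally show ?thesis using ln by simp
      qed
      finally have "u n * \<bar>S\<bar> \<le> u n * ((\<kappa>' * C + 2) * sqrt (ln (real n) * v n))" by (simp add: ac_simps)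
      then have "\<bar>S\<bar> \<le> (\<kappa>' * C + 2) * sqrt (ln (real n) * v n)" using u by simp
      then show ?case using v ln by (simp add: S_def)
    qed
    then show ?case unfolding p_def by (rule bigoI)
  qed
qed

section \<open>Conditional moments of the kernel-weighted response\<close>

text \<open>A bounded \<open>G\<close>-measurable weight lets \<open>W\<close> be replaced by its conditional expectation given the
  larger sigma-algebra \<open>G\<close> before conditioning on \<open>F\<close>.\<close>

lemma real_cond_exp_tower_replace:
  fixes W T \<Delta> :: "'w \<Rightarrow> real"
  assumes "prob_space M" and FG: "subalgebra G F" and ce: "is_cond_exp M G W T"
    and \<Delta>: "\<Delta> \<in> borel_measurable G" and bd: "\<And>\<omega>. \<bar>\<Delta> \<omega>\<bar> \<le> B"
  shows "AE \<omega> in M. real_cond_exp M F (\<lambda>\<omega>. \<Delta> \<omega> * W \<omega>) \<omega> = real_cond_exp M F (\<lambda>\<omega>. \<Delta> \<omega> * T \<omega>) \<omega>"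
proof -
  interpret prob_space M by fact
  have MG: "subalgebra M G" and W: "integrable M W" and T: "integrable M T"
    using ce by (auto simp: is_cond_exp_def)
  have MF: "subalgebra M F" using MG FG by (auto simp: subalgebra_def)
  interpret G: finite_measure_subalgebra M G using MG by unfold_locales
  interpret F: finite_measure_subalgebra M F using MF by unfold_locales
  have \<Delta>M [measurable]: "\<Delta> \<in> borel_measurable M" using measurable_from_subalg[OF MG \<Delta>] .
  have int: "integrable M (\<lambda>\<omega>. \<Delta> \<omega> * V \<omega>)" if "integrable M V" for V
  proof (rule Bochner_Integration.integrable_bound[OF integrable_mult_right[OF that, of B]])
    show "AE \<omega> in M. norm (\<Delta> \<omega> * V \<omega>) \<le> norm (B * V \<omega>)"
      using bd by (intro AE_I2) (auto simp: abs_mult intro!: mult_right_mono order.trans[OF bd abs_ge_self])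
  qed (use that in measurable)
  have "AE \<omega> in M. real_cond_exp M G (\<lambda>\<omega>. \<Delta> \<omega> * W \<omega>) \<omega> = \<Delta> \<omega> * T \<omega>"
    using G.real_cond_exp_mult[OF \<Delta> _ int[OF W]] is_cond_exp_real_iff[OF assms(1) MG W, of T] ce W
    by auto
  then have "AE \<omega> in M. real_cond_exp M F (real_cond_exp M G (\<lambda>\<omega>. \<Delta> \<omega> * W \<omega>)) \<omega>
      = real_cond_exp M F (\<lambda>\<omega>. \<Delta> \<omega> * T \<omega>) \<omega>"
    using int[OF T] by (intro F.real_cond_exp_cong) auto
  moreover have "AE \<omega> in M. real_cond_exp M F (real_cond_exp M G (\<lambda>\<omega>. \<Delta> \<omega> * W \<omega>)) \<omega>
      = real_cond_exp M F (\<lambda>\<omega>. \<Delta> \<omega> * W \<omega>) \<omega>"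
    using F.real_cond_exp_nested_subalg[OF MG FG int[OF W]] .
  ultimately show ?thesis by eventually_elim simp
qed

text \<open>Conditioning first on \<open>G\<close> replaces the response by its regression \<open>R\<close>; conditioning first on
  \<open>H\<close> then replaces the increment of \<open>R\<close> by \<open>T\<close>, which is compared with a multiple of \<open>U\<close>.\<close>

lemma conditional_coordinate_bound:
  fixes Y R :: "'w \<Rightarrow> 'h::{real_inner, banach, second_countable_topology}" and \<Delta> U T :: "'w \<Rightarrow> real"
  assumes "prob_space M" and GF: "subalgebra G F" and HF: "subalgebra H F"
    and YR: "is_cond_exp M G Y R" and RT: "is_cond_exp M H (\<lambda>\<omega>. R \<omega> \<bullet> v - \<rho>) T"
    and \<Delta>: "\<Delta> \<in> borel_measurable G" "\<Delta> \<in> borel_measurable H" "\<And>\<omega>. 0 \<le> \<Delta> \<omega>" "\<And>\<omega>. \<Delta> \<omega> \<le> B"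
    and U: "integrable M U"
    and close: "AE \<omega> in M. \<bar>\<Delta> \<omega> * T \<omega> - c * U \<omega>\<bar> \<le> \<beta> * \<Delta> \<omega>"
  shows "AE \<omega> in M. \<bar>cond_exp M F (\<lambda>\<omega>. \<Delta> \<omega> *\<^sub>R Y \<omega>) \<omega> \<bullet> v - \<rho> * real_cond_exp M F \<Delta> \<omega>
      - c * real_cond_exp M F U \<omega>\<bar> \<le> \<beta> * real_cond_exp M F \<Delta> \<omega>"
proof -
  interpret prob_space M by fact
  have MG: "subalgebra M G" and Y: "integrable M Y" and R: "integrable M R"
    using YR by (auto simp: is_cond_exp_def)
  have T: "integrable M T" using RT by (auto simp: is_cond_exp_def)
  have MF: "subalgebra M F" using MG GF by (auto simp: subalgebra_def)
  interpret F: finite_measure_subalgebra M F using MF by unfold_locales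
  have \<Delta>M [measurable]: "\<Delta> \<in> borel_measurable M" using measurable_from_subalg[OF MG \<Delta>(1)] .
  have bd: "\<bar>\<Delta> \<omega>\<bar> \<le> B" for \<omega> using \<Delta>(3,4) by simp
  have \<Delta>i: "integrable M \<Delta>" using bd by (intro integrable_const_bound[where B = B]) auto
  have int: "integrable M (\<lambda>\<omega>. \<Delta> \<omega> *\<^sub>R V \<omega>)" if "integrable M V" for V :: "'w \<Rightarrow> 'b::{banach, second_countable_topology}"
  proof (rule Bochner_Integration.integrable_bound[OF integrable_mult_right[OF integrable_norm[OF that], of B]])
    show "AE \<omega> in M. norm (\<Delta> \<omega> *\<^sub>R V \<omega>) \<le> norm (B * norm (V \<omega>))"
      using bd by (intro AE_I2) (auto simp: abs_mult intro!: mult_right_mono order.trans[OF bd abs_ge_self])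
  qed (use that in measurable)
  have \<Delta>T: "integrable M (\<lambda>\<omega>. \<Delta> \<omega> * T \<omega>)" using int[OF T] by simp
  have "is_cond_exp M F (\<lambda>\<omega>. (\<Delta> \<omega> *\<^sub>R Y \<omega>) \<bullet> v) (\<lambda>\<omega>. cond_exp M F (\<lambda>\<omega>. \<Delta> \<omega> *\<^sub>R Y \<omega>) \<omega> \<bullet> v)"
    by (rule is_cond_exp_inner[OF is_cond_exp_cond_exp[OF assms(1) MF int[OF Y]]])
  then have 1: "AE \<omega> in M. cond_exp M F (\<lambda>\<omega>. \<Delta> \<omega> *\<^sub>R Y \<omega>) \<omega> \<bullet> v = real_cond_exp M F (\<lambda>\<omega>. \<Delta> \<omega> * (Y \<omega> \<bullet> v)) \<omega>"
    using is_cond_exp_real_iff[OF assms(1) MF, of "\<lambda>\<omega>. (\<Delta> \<omega> *\<^sub>R Y \<omega>) \<bullet> v"]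
      integrable_inner_left[OF int[OF Y]]
    by simp
  have 2: "AE \<omega> in M. real_cond_exp M F (\<lambda>\<omega>. \<Delta> \<omega> * (Y \<omega> \<bullet> v)) \<omega> = real_cond_exp M F (\<lambda>\<omega>. \<Delta> \<omega> * (R \<omega> \<bullet> v)) \<omega>"
    by (rule real_cond_exp_tower_replace[OF assms(1) GF is_cond_exp_inner[OF YR] \<Delta>(1) bd])
  have 3: "AE \<omega> in M. real_cond_exp M F (\<lambda>\<omega>. \<Delta> \<omega> * (R \<omega> \<bullet> v - \<rho>)) \<omega> = real_cond_exp M F (\<lambda>\<omega>. \<Delta> \<omega> * T \<omega>) \<omega>"
    by (rule real_cond_exp_tower_replace[OF assms(1) HF RT \<Delta>(2) bd])
  have \<Delta>R: "integrable M (\<lambda>\<omega>. \<Delta> \<omega> * (R \<omega> \<bullet> v))" using int[of "\<lambda>\<omega>. R \<omega> \<bullet> v"] R by simp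
  have 4: "AE \<omega> in M. real_cond_exp M F (\<lambda>\<omega>. \<Delta> \<omega> * (R \<omega> \<bullet> v) - \<rho> * \<Delta> \<omega>) \<omega>
      = real_cond_exp M F (\<lambda>\<omega>. \<Delta> \<omega> * (R \<omega> \<bullet> v)) \<omega> - real_cond_exp M F (\<lambda>\<omega>. \<rho> * \<Delta> \<omega>) \<omega>"
    using \<Delta>R \<Delta>i by (intro F.real_cond_exp_diff) auto
  have 5: "AE \<omega> in M. real_cond_exp M F (\<lambda>\<omega>. \<rho> * \<Delta> \<omega>) \<omega> = \<rho> * real_cond_exp M F \<Delta> \<omega>"
    by (rule F.real_cond_exp_cmult[OF \<Delta>i])
  have 6: "AE \<omega> in M. real_cond_exp M F (\<lambda>\<omega>. \<Delta> \<omega> * T \<omega> - c * U \<omega>) \<omega>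
      = real_cond_exp M F (\<lambda>\<omega>. \<Delta> \<omega> * T \<omega>) \<omega> - real_cond_exp M F (\<lambda>\<omega>. c * U \<omega>) \<omega>"
    using \<Delta>T U by (intro F.real_cond_exp_diff) auto
  have 7: "AE \<omega> in M. real_cond_exp M F (\<lambda>\<omega>. c * U \<omega>) \<omega> = c * real_cond_exp M F U \<omega>"
    by (rule F.real_cond_exp_cmult[OF U])
  have 8: "AE \<omega> in M. real_cond_exp M F (\<lambda>\<omega>. \<Delta> \<omega> * T \<omega> - c * U \<omega>) \<omega> \<le> real_cond_exp M F (\<lambda>\<omega>. \<beta> * \<Delta> \<omega>) \<omega>"
  proof (rule F.real_cond_exp_mono)
    show "AE \<omega> in M. \<Delta> \<omega> * T \<omega> - c * U \<omega> \<le> \<beta> * \<Delta> \<omega>" using close by eventually_elim auto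
  qed (use \<Delta>T U \<Delta>i in auto)
  have 9: "AE \<omega> in M. real_cond_exp M F (\<lambda>\<omega>. - \<beta> * \<Delta> \<omega>) \<omega> \<le> real_cond_exp M F (\<lambda>\<omega>. \<Delta> \<omega> * T \<omega> - c * U \<omega>) \<omega>"
  proof (rule F.real_cond_exp_mono)
    show "AE \<omega> in M. - \<beta> * \<Delta> \<omega> \<le> \<Delta> \<omega> * T \<omega> - c * U \<omega>" using close by eventually_elim auto
  qed (use \<Delta>T U \<Delta>i in auto)
  have 10: "AE \<omega> in M. real_cond_exp M F (\<lambda>\<omega>. \<beta> * \<Delta> \<omega>) \<omega> = \<beta> * real_cond_exp M F \<Delta> \<omega>"
    "AE \<omega> in M. real_cond_exp M F (\<lambda>\<omega>. - \<beta> * \<Delta> \<omega>) \<omega> = - \<beta> * real_cond_exp M F \<Delta> \<omega>"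
    by (rule F.real_cond_exp_cmult[OF \<Delta>i])+
  have eq: "(\<lambda>\<omega>. \<Delta> \<omega> * (R \<omega> \<bullet> v) - \<rho> * \<Delta> \<omega>) = (\<lambda>\<omega>. \<Delta> \<omega> * (R \<omega> \<bullet> v - \<rho>))"
    by (simp add: algebra_simps)
  show ?thesis
    using 1 2 3 4[unfolded eq] 5 6 7 8 9 10
    by eventually_elim linarith
qed

text \<open>A conditional distribution function that grows at most linearly away from \<open>0\<close> gives no
  mass to null sections, so a bound that holds almost surely at each fixed radius also holds at
  the random radius.\<close>

lemma AE_bound_at_random_radius:
  fixes D :: "'w \<Rightarrow> real" and CF gb :: "real \<Rightarrow> 'w \<Rightarrow> real" and \<beta> :: "real \<Rightarrow> real"
  assumes "prob_space M" and D [measurable]: "D \<in> borel_measurable M"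
    and CF: "\<And>u. is_cond_exp M F (\<lambda>\<omega>. indicat_real {..u} (D \<omega>)) (CF u)"
    and "L \<ge> 0"
    and incr: "AE \<omega> in M. \<forall>u\<in>{0<..<\<delta>}. \<forall>\<epsilon>\<in>{0..<u}.
      (CF (u + \<epsilon>) \<omega> - CF (u - \<epsilon>) \<omega>) / CF u \<omega> \<le> L * \<epsilon> * inverse u"
    and gb: "(\<lambda>(\<omega>, s). gb s \<omega>) \<in> borel_measurable (F \<Otimes>\<^sub>M borel)"
    and \<beta> [measurable]: "\<beta> \<in> borel_measurable borel"
    and bd: "\<And>s. s \<in> {0<..\<rho>} \<Longrightarrow> AE \<omega> in M. \<bar>gb s \<omega>\<bar> \<le> \<beta> s" and "\<rho> < \<delta>"
  shows "AE \<omega> in M. D \<omega> \<in> {0<..\<rho>} \<longrightarrow> \<bar>gb (D \<omega>) \<omega>\<bar> \<le> \<beta> (D \<omega>)"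
proof -
  interpret prob_space M by fact
  have MF: "subalgebra M F" using CF by (auto simp: is_cond_exp_def)
  interpret F: finite_measure_subalgebra M F using MF by unfold_locales
  have FM: "sets F \<subseteq> sets M" using MF by (auto simp: subalgebra_def)
  define I where "I u \<omega> = indicat_real {..u} (D \<omega>)" for u \<omega>
  have Ii: "integrable M (I u)" for u unfolding I_def
    by (intro integrable_const_bound[where B = 1]) auto
  have CI: "AE \<omega> in M. CF u \<omega> = real_cond_exp M F (I u) \<omega>" for u
    using is_cond_exp_real_iff[OF prob_space_axioms MF, of "I u"] CF[of u] Ii unfolding I_def by auto
  have CF_mono: "AE \<omega> in M. CF s \<omega> \<le> CF t \<omega>" if "s \<le> t" for s t
  proof -
    have "AE \<omega> in M. real_cond_exp M F (I s) \<omega> \<le> real_cond_exp M F (I t) \<omega>"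
      using that by (intro F.real_cond_exp_mono Ii AE_I2) (auto simp: I_def indicator_def)
    then show ?thesis using CI[of s] CI[of t] by eventually_elim simp
  qed
  have CF_01: "AE \<omega> in M. 0 \<le> CF u \<omega> \<and> CF u \<omega> \<le> 1" for u
  proof -
    have "AE \<omega> in M. real_cond_exp M F (I u) \<omega> \<ge> 0"
      by (intro F.real_cond_exp_ge_c Ii) (auto simp: I_def)
    moreover have "AE \<omega> in M. real_cond_exp M F (I u) \<omega> \<le> 1"
      by (intro F.real_cond_exp_le_c Ii) (auto simp: I_def indicator_def)
    ultimately show ?thesis using CI[of u] by eventually_elim simp
  qed
  have lip: "measure M {\<omega> \<in> A. D \<omega> \<in> {s<..t}} \<le> L / a * measure M A * (t - s)"
    if a: "a > 0" and A: "A \<in> sets F" and st: "a \<le> s" "s < t" "t \<le> \<rho>" for a s t A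
  proof -
    have AM [measurable]: "A \<in> sets M" using A FM by auto
    have CF_le: "AE \<omega> in M. CF t \<omega> \<le> CF (2 * t - s) \<omega>" using st by (intro CF_mono) simp
    \<comment> \<open>centring the increment at \<open>t\<close> covers the case \<open>CF t \<omega> = 0\<close>, in which the hypothesis is void\<close>
    have inc: "AE \<omega> in M. CF t \<omega> - CF s \<omega> \<le> L / a * (t - s)"
      using incr CF_le CF_01[of s] CF_01[of t]
    proof eventually_elim
      case prems: (elim \<omega>)
      have "2 * t - s = t + (t - s)" by simp
      have nn: "0 \<le> L / a * (t - s)" using a st \<open>L \<ge> 0\<close> by simp
      show ?case
      proof (cases "CF t \<omega> = 0")
        case True
        then show ?thesis using prems nn by linarith
      next
        case False
        then have pos: "CF t \<omega> > 0" using prems by auto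
        have "(CF (t + (t - s)) \<omega> - CF (t - (t - s)) \<omega>) / CF t \<omega> \<le> L * (t - s) * inverse t"
        proof -
          have "t \<in> {0<..<\<delta>}" "t - s \<in> {0..<t}" using a st \<open>\<rho> < \<delta>\<close> by auto
          then show ?thesis using prems(1) by blast
        qed
        then have "CF (t + (t - s)) \<omega> - CF s \<omega> \<le> L * (t - s) * inverse t * CF t \<omega>"
          using pos by (simp add: divide_le_eq)
        also have "\<dots> \<le> L * (t - s) * inverse a * 1"
          using prems a st \<open>L \<ge> 0\<close> by (intro mult_mono le_imp_inverse_le mult_nonneg_nonneg) auto
        finally have "CF (2 * t - s) \<omega> - CF s \<omega> \<le> L / a * (t - s)"
          by (simp add: field_simps)
        moreover have "CF t \<omega> \<le> CF (2 * t - s) \<omega>" using prems(2) st by simp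
        ultimately show ?thesis by linarith
      qed
    qed
    have int: "(LINT \<omega>:A|M. CF u \<omega>) = (LINT \<omega>:A|M. I u \<omega>)" for u
      using CF[of u] A by (simp add: is_cond_exp_def I_def)
    have iI: "integrable M (\<lambda>\<omega>. indicator A \<omega> * I u \<omega>)" for u
      using integrable_mult_indicator[OF AM Ii] by simp
    have iC: "integrable M (\<lambda>\<omega>. indicator A \<omega> * CF u \<omega>)" for u
      using integrable_mult_indicator[OF AM, of "CF u"] CF[of u] by (simp add: is_cond_exp_def)
    have iK: "integrable M (\<lambda>\<omega>. indicat_real A \<omega> * (L / a * (t - s)))"
      by (intro integrable_mult_left integrable_real_indicator) (auto simp: emeasure_eq_measure)
    have "measure M {\<omega> \<in> A. D \<omega> \<in> {s<..t}} = (LINT \<omega>|M. indicator {\<omega> \<in> A. D \<omega> \<in> {s<..t}} \<omega>)"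
    proof -
      have "{\<omega> \<in> A. D \<omega> \<in> {s<..t}} = A \<inter> {\<omega> \<in> space M. D \<omega> \<in> {s<..t}}"
        using sets.sets_into_space[OF AM] by auto
      then show ?thesis by simp
    qed
    also have "\<dots> = (LINT \<omega>|M. indicator A \<omega> * I t \<omega> - indicator A \<omega> * I s \<omega>)"
      using st by (intro Bochner_Integration.integral_cong) (auto simp: I_def indicator_def)
    also have "\<dots> = (LINT \<omega>:A|M. I t \<omega>) - (LINT \<omega>:A|M. I s \<omega>)"
      using iI by (simp add: set_lebesgue_integral_def)
    also have "\<dots> = (LINT \<omega>|M. indicator A \<omega> * CF t \<omega> - indicator A \<omega> * CF s \<omega>)"
      using iC unfolding int[symmetric] by (simp add: set_lebesgue_integral_def)
    also have "\<dots> \<le> (LINT \<omega>|M. indicator A \<omega> * (L / a * (t - s)))"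
    proof (rule integral_mono_AE)
      show "AE \<omega> in M. indicator A \<omega> * CF t \<omega> - indicator A \<omega> * CF s \<omega> \<le> indicator A \<omega> * (L / a * (t - s))"
        using inc by eventually_elim (auto simp: indicator_def)
    qed (intro Bochner_Integration.integrable_diff iC iK)+
    also have "\<dots> = L / a * measure M A * (t - s)" by simp
    finally show ?thesis .
  qed
  define N where "N = {z \<in> space (F \<Otimes>\<^sub>M borel). \<bar>(\<lambda>(\<omega>, s). gb s \<omega>) z\<bar> > \<beta> (snd z)}"
  have N: "N \<in> sets (F \<Otimes>\<^sub>M borel)"
    unfolding N_def using gb by measurable
  have Nmem: "(\<omega>, s) \<in> N \<longleftrightarrow> \<bar>gb s \<omega>\<bar> > \<beta> s" if "\<omega> \<in> space M" for \<omega> s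
    using that MF by (auto simp: N_def space_pair_measure subalgebra_def)
  have "AE \<omega> in M. D \<omega> \<in> {inverse (real (Suc m))<..\<rho>} \<longrightarrow> (\<omega>, D \<omega>) \<notin> N" for m
  proof (rule AE_substitution_avoids_null_sections[OF assms(1) MF D _ _ N])
    show "0 \<le> L / inverse (real (Suc m))" using \<open>L \<ge> 0\<close> by simp
    show "measure M {\<omega> \<in> A. D \<omega> \<in> {s<..t}} \<le> L / inverse (real (Suc m)) * measure M A * (t - s)"
      if "A \<in> sets F" "inverse (real (Suc m)) \<le> s" "s < t" "t \<le> \<rho>" for A s t
      using that by (intro lip) auto
    show "AE \<omega> in M. (\<omega>, s) \<notin> N" if s: "s \<in> {inverse (real (Suc m))<..\<rho>}" for s
    proof -
      have "0 < inverse (real (Suc m))" by simp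
      then have "s \<in> {0<..\<rho>}" using s unfolding greaterThanAtMost_iff by linarith
      from bd[OF this] AE_space show ?thesis by eventually_elim (auto simp: Nmem)
    qed
  qed
  then have "AE \<omega> in M. \<forall>m. D \<omega> \<in> {inverse (real (Suc m))<..\<rho>} \<longrightarrow> (\<omega>, D \<omega>) \<notin> N"
    by (subst AE_all_countable) simp
  with AE_space show ?thesis
  proof eventually_elim
    case (elim \<omega>)
    show ?case
    proof
      assume D: "D \<omega> \<in> {0<..\<rho>}"
      then obtain m where "inverse (real (Suc m)) < D \<omega>" using reals_Archimedean[of "D \<omega>"] by auto
      then have "(\<omega>, D \<omega>) \<notin> N" using elim(2) D by auto
      then show "\<bar>gb (D \<omega>) \<omega>\<bar> \<le> \<beta> (D \<omega>)" using Nmem[OF elim(1)] by auto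
    qed
  qed
qed

section \<open>The sigma-algebras of the array\<close>

lemma sets_Fsig:
  "sets (Fsig M S X Y n i) = sigma_sets (space M)
    (\<Union>j\<in>{1..i}. sets (vimage_algebra (space M) (\<lambda>\<omega>. (X n j \<omega>, Y n j \<omega>)) (S \<Otimes>\<^sub>M borel)))"
  unfolding Fsig_def by (intro sets_measure_of) (auto dest!: sets.sets_into_space)

lemma space_Fsig [simp]: "space (Fsig M S X Y n i) = space M"
  unfolding Fsig_def by (intro space_measure_of) (auto dest!: sets.sets_into_space)

lemma sets_Fsig_mono: "i \<le> j \<Longrightarrow> sets (Fsig M S X Y n i) \<subseteq> sets (Fsig M S X Y n j)"
  unfolding sets_Fsig by (rule sigma_sets_mono') (auto, force)

lemma subalgebra_Gsig_Fsig: "subalgebra (Gsig M S X Y n i) (Fsig M S X Y n i)"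
proof -
  have sub: "sets (Fsig M S X Y n i) \<union> sets (vimage_algebra (space M) (X n (i + 1)) S) \<subseteq> Pow (space M)"
    by (auto dest!: sets.sets_into_space)
  show ?thesis using sub by (auto simp: subalgebra_def Gsig_def)
qed

lemma subalgebra_FDsig_Fsig: "subalgebra (FDsig M S d X Y y n i) (Fsig M S X Y n (i - 1))"
proof -
  have sub: "sets (Fsig M S X Y n (i - 1)) \<union>
     sets (vimage_algebra (space M) (\<lambda>\<omega>. d y (X n i \<omega>)) (borel :: real measure)) \<subseteq> Pow (space M)"
    by (auto dest!: sets.sets_into_space)
  show ?thesis using sub by (auto simp: subalgebra_def FDsig_def)
qed

lemma measurable_Fsig:
  assumes "space S = UNIV" "j \<in> {1..i}"
  shows "X n j \<in> Fsig M S X Y n i \<rightarrow>\<^sub>M S"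
proof -
  let ?V = "vimage_algebra (space M) (\<lambda>\<omega>. (X n j \<omega>, Y n j \<omega>)) (S \<Otimes>\<^sub>M borel)"
  have "(\<lambda>\<omega>. (X n j \<omega>, Y n j \<omega>)) \<in> ?V \<rightarrow>\<^sub>M S \<Otimes>\<^sub>M borel"
    using assms(1) by (intro measurable_vimage_algebra1) (auto simp: space_pair_measure)
  from measurable_compose[OF this measurable_fst] have "X n j \<in> ?V \<rightarrow>\<^sub>M S" by simp
  moreover have "subalgebra (Fsig M S X Y n i) ?V"
    unfolding subalgebra_def sets_Fsig using assms(2) by (auto intro!: sigma_sets.Basic)
  ultimately show ?thesis using measurable_from_subalg by blast
qed

lemma measurable_Gsig:
  assumes "space S = UNIV"
  shows "X n (i + 1) \<in> Gsig M S X Y n i \<rightarrow>\<^sub>M S"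
proof -
  have sub: "sets (Fsig M S X Y n i) \<union> sets (vimage_algebra (space M) (X n (i + 1)) S) \<subseteq> Pow (space M)"
    by (auto dest!: sets.sets_into_space)
  have "X n (i + 1) \<in> vimage_algebra (space M) (X n (i + 1)) S \<rightarrow>\<^sub>M S"
    using assms by (intro measurable_vimage_algebra1) auto
  moreover have "subalgebra (Gsig M S X Y n i) (vimage_algebra (space M) (X n (i + 1)) S)"
    using sub by (auto simp: subalgebra_def Gsig_def)
  ultimately show ?thesis using measurable_from_subalg by blast
qed

lemma measurable_FDsig:
  "(\<lambda>\<omega>. d y (X n i \<omega>)) \<in> borel_measurable (FDsig M S d X Y y n i)"
proof -
  have sub: "sets (Fsig M S X Y n (i - 1)) \<union>
     sets (vimage_algebra (space M) (\<lambda>\<omega>. d y (X n i \<omega>)) (borel :: real measure)) \<subseteq> Pow (space M)"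
    by (auto dest!: sets.sets_into_space)
  have "(\<lambda>\<omega>. d y (X n i \<omega>)) \<in> borel_measurable (vimage_algebra (space M) (\<lambda>\<omega>. d y (X n i \<omega>)) borel)"
    by (intro measurable_vimage_algebra1) auto
  moreover have "subalgebra (FDsig M S d X Y y n i) (vimage_algebra (space M) (\<lambda>\<omega>. d y (X n i \<omega>)) borel)"
    using sub by (auto simp: subalgebra_def FDsig_def)
  ultimately show ?thesis using measurable_from_subalg by blast
qed

section \<open>Rates and local expansions\<close>

lemma eventually_log_square_le:
  fixes v :: "nat \<Rightarrow> real"
  assumes lim: "filterlim (\<lambda>n. v n powr (1/2) * ln (real n) powr (- \<gamma>)) at_top sequentially"
    and "\<gamma> \<ge> 2" and nonneg: "\<And>n. n \<ge> 1 \<Longrightarrow> v n \<ge> 0"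
  shows "eventually (\<lambda>n. v n > 0 \<and> (ln (real n))\<^sup>2 \<le> v n) sequentially"
proof -
  have "eventually (\<lambda>n. 1 \<le> v n powr (1/2) * ln (real n) powr (- \<gamma>)) sequentially"
    using lim unfolding filterlim_at_top by blast
  moreover have "eventually (\<lambda>n. 1 \<le> ln (real n)) sequentially"
    using filterlim_compose[OF ln_at_top filterlim_real_sequentially] unfolding filterlim_at_top by blast
  ultimately show ?thesis using eventually_ge_at_top[of 1]
  proof eventually_elim
    case (elim n)
    let ?l = "ln (real n)"
    have "v n \<noteq> 0" using elim(1) by auto
    moreover have "v n \<ge> 0" using nonneg elim(3) by simp
    ultimately have v: "v n > 0" by simp
    have "?l powr 2 \<le> ?l powr \<gamma>" using elim(2) \<open>\<gamma> \<ge> 2\<close> by (intro powr_mono) auto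
    also have "\<dots> \<le> v n powr (1/2)" using elim(1,2) by (simp add: powr_minus field_simps)
    finally have "?l\<^sup>2 \<le> sqrt (v n)" using elim(2) v by (simp add: powr_half_sqrt powr_numeral)
    then have "(?l\<^sup>2)\<^sup>2 \<le> v n" using v by (metis real_le_rsqrt real_sqrt_le_iff real_sqrt_pow2 power_mono zero_le_power2 less_imp_le)
    moreover have "?l\<^sup>2 * 1 \<le> ?l\<^sup>2 * ?l\<^sup>2" using elim(2) by (intro mult_left_mono) (auto simp: one_le_power)
    ultimately show ?case using v by (simp add: power2_eq_square)
  qed
qed

lemma linear_approximation_error_le:
  fixes \<psi> :: "real \<Rightarrow> real"
  assumes "s > 0" and "\<psi> 0 = 0"
    and diff: "\<And>u. u \<in> {0..s} \<Longrightarrow> \<psi> differentiable (at u within {0..})"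
    and bd: "\<And>u. u \<in> {0..s} \<Longrightarrow> \<bar>deriv_nonneg \<psi> u - c\<bar> * s \<le> \<beta>"
  shows "\<bar>\<psi> s - c * s\<bar> \<le> \<beta>"
proof -
  have "(\<psi> has_derivative (\<lambda>t. t * deriv_nonneg \<psi> u)) (at u within {0..s})" if "0 \<le> u" "u \<le> s" for u
  proof -
    have "(\<psi> has_vector_derivative deriv_nonneg \<psi> u) (at u within {0..})"
      using diff[of u] that by (simp add: deriv_nonneg_def vector_derivative_works)
    then have "(\<psi> has_vector_derivative deriv_nonneg \<psi> u) (at u within {0..s})"
      by (rule has_vector_derivative_within_subset) auto
    then show ?thesis by (simp add: has_vector_derivative_def)
  qed
  from mvt_simple[OF \<open>s > 0\<close> this] obtain u where u: "u \<in> {0<..<s}" "\<psi> s - \<psi> 0 = (s - 0) * deriv_nonneg \<psi> u"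
    by blast
  then have "\<psi> s - c * s = (deriv_nonneg \<psi> u - c) * s" using \<open>\<psi> 0 = 0\<close> by (simp add: algebra_simps)
  then have "\<bar>\<psi> s - c * s\<bar> = \<bar>deriv_nonneg \<psi> u - c\<bar> * s" using \<open>s > 0\<close> by (simp add: abs_mult)
  also have "\<dots> \<le> \<beta>" using u by (intro bd) auto
  finally show ?thesis .
qed

text \<open>The ratio of sums is a convex combination of the local ratios \<open>Z i / p i\<close>, each of which
  deviates from \<open>r + (h q i / p i) w\<close> by at most \<open>\<beta>\<close>; the multiplied form of the hypothesis also
  covers vanishing weights.\<close>

lemma weighted_mean_deviation_le:
  fixes Z :: "nat \<Rightarrow> 'h::real_normed_vector"
  assumes le: "\<And>i. i \<in> I \<Longrightarrow> norm (Z i - p i *\<^sub>R r - (h * q i) *\<^sub>R w) \<le> \<beta> * p i" and P: "sum p I > 0"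
  shows "norm (sum Z I /\<^sub>R sum p I - r - (h * (sum q I / sum p I)) *\<^sub>R w) \<le> \<beta>"
proof -
  let ?P = "sum p I"
  have "(\<Sum>i\<in>I. Z i - p i *\<^sub>R r - (h * q i) *\<^sub>R w) = sum Z I - ?P *\<^sub>R r - (h * sum q I) *\<^sub>R w"
    by (simp add: sum_subtractf scaleR_sum_left sum_distrib_left)
  also have "\<dots> = ?P *\<^sub>R (sum Z I /\<^sub>R ?P - r - (h * (sum q I / ?P)) *\<^sub>R w)"
    using P by (simp add: algebra_simps)
  finally have "?P * norm (sum Z I /\<^sub>R ?P - r - (h * (sum q I / ?P)) *\<^sub>R w)
      = norm (\<Sum>i\<in>I. Z i - p i *\<^sub>R r - (h * q i) *\<^sub>R w)"
    using P by simp
  also have "\<dots> \<le> (\<Sum>i\<in>I. \<beta> * p i)" using le by (rule sum_norm_le)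
  also have "\<dots> = ?P * \<beta>" by (simp add: sum_distrib_left mult.commute)
  finally show ?thesis using P by simp
qed

lemma Linf_norm_nonneg:
  assumes "prob_space M"
  shows "0 \<le> Linf_norm M f"
proof -
  interpret prob_space M by fact
  have "AE \<omega> in M. ereal \<bar>f \<omega>\<bar> \<le> Linf_norm M f" unfolding Linf_norm_def by (rule esssup_AE)
  then have "AE \<omega> in M. 0 \<le> Linf_norm M f" by eventually_elim (auto intro: order_trans[rotated])
  then show ?thesis by simp
qed

section \<open>The regression array\<close>

text \<open>The hypotheses of the theorem, gathered so that the intermediate limits can be stated one by one.\<close>

locale functional_regression_array =
  fixes M :: "'w measure"
    and S :: "'e measure"
    and d :: "'e \<Rightarrow> 'e \<Rightarrow> real"
    and e :: "nat \<Rightarrow> 'h::{real_inner, banach, second_countable_topology}"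
    and X :: "nat \<Rightarrow> nat \<Rightarrow> 'w \<Rightarrow> 'e"
    and Y :: "nat \<Rightarrow> nat \<Rightarrow> 'w \<Rightarrow> 'h"
    and r :: "'e \<Rightarrow> 'h"
    and rv :: "'h \<Rightarrow> 'e \<Rightarrow> real"
    and x :: 'e
    and K \<phi> \<tau>0 :: "real \<Rightarrow> real"
    and h b :: "nat \<Rightarrow> real"
    and \<alpha> Lbar :: real
    and Lt :: "nat \<Rightarrow> nat \<Rightarrow> real"
    and FF :: "nat \<Rightarrow> nat \<Rightarrow> 'e \<Rightarrow> real \<Rightarrow> 'w \<Rightarrow> real"
    and fr :: "nat \<Rightarrow> nat \<Rightarrow> 'e \<Rightarrow> 'w \<Rightarrow> real"
    and g :: "nat \<Rightarrow> nat \<Rightarrow> 'e \<Rightarrow> real \<Rightarrow> 'w \<Rightarrow> real"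
    and f1 :: "'e \<Rightarrow> real"
    and \<psi> :: "nat \<Rightarrow> 'e \<Rightarrow> real \<Rightarrow> real"
    and gb :: "nat \<Rightarrow> nat \<Rightarrow> nat \<Rightarrow> 'e \<Rightarrow> real \<Rightarrow> 'w \<Rightarrow> real"
    and L :: "nat \<Rightarrow> real"
  assumes prob: "prob_space M"
    and pm: "pseudometric d"
    and S_space: "space S = UNIV"
    and S_dist: "\<forall>y. d y \<in> borel_measurable S"
    and basis: "orthonormal_basis e"
    and X_meas: "\<forall>n. \<forall>i\<in>{1..n}. X n i \<in> M \<rightarrow>\<^sub>M S"
    and Y_meas: "\<forall>n. \<forall>i\<in>{1..n}. Y n i \<in> borel_measurable M"
    and same_distr: "\<forall>n. \<forall>i\<in>{1..n}.
      distr M (S \<Otimes>\<^sub>M borel) (\<lambda>\<omega>. (X n i \<omega>, Y n i \<omega>)) =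
      distr M (S \<Otimes>\<^sub>M borel) (\<lambda>\<omega>. (X 1 1 \<omega>, Y 1 1 \<omega>))"
    and r: "is_regression M S (X 1 1) (Y 1 1) r"
    and rv: "\<forall>v. is_regression M S (X 1 1) (\<lambda>\<omega>. Y 1 1 \<omega> \<bullet> v) (rv v)"
    and rv_r: "\<forall>v y. rv v y = r y \<bullet> v"
    and FF: "\<forall>n. \<forall>i\<in>{1..n}. \<forall>y u.
      is_cond_exp M (Fsig M S X Y n (i - 1)) (\<lambda>\<omega>. indicat_real {..u} (d y (X n i \<omega>))) (FF n i y u)"
    and h_pos: "\<forall>n\<ge>1. h n > 0"
    and b_pos: "\<forall>n\<ge>1. b n > 0"
    \<comment> \<open>(A1)\<close>
    and K_nonneg: "\<forall>t. 0 \<le> K t"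
    and K_bounded: "bounded (range K)"
    and K_support: "closure {t. K t \<noteq> 0} = {0..1}"
    and K_diff: "K differentiable_on {0..1}"
    and K_C1: "continuous_on {0..1} (deriv01 K)"
    and K_decr: "\<forall>t\<in>{0..1}. deriv01 K t \<le> 0"
    and K_1: "K 1 > 0"
    \<comment> \<open>(A2)(i)\<close>
    and \<alpha>: "0 < \<alpha>" "\<alpha> \<le> 1"
    and Lt_nonneg: "\<forall>n. \<forall>i\<in>{1..n}. 0 \<le> Lt n i"
    and A2i_Hoelder: "\<exists>\<delta>>0. \<forall>n. \<forall>i\<in>{1..n}. AE \<omega> in M. \<forall>u\<in>{0<..<\<delta>}. \<forall>y1 y2.
      \<bar>FF n i y1 u \<omega> - FF n i y2 u \<omega>\<bar> / FF n i x u \<omega> \<le> Lt n i * d y1 y2 powr \<alpha>"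
    and A2i_incr: "\<exists>\<delta>>0. \<forall>n. \<forall>i\<in>{1..n}. AE \<omega> in M. \<forall>u\<in>{0<..<\<delta>}. \<forall>\<epsilon>\<in>{0..<u}.
      (FF n i x (u + \<epsilon>) \<omega> - FF n i x (u - \<epsilon>) \<omega>) / FF n i x u \<omega> \<le> Lt n i * \<epsilon> * inverse u"
    and A2i_limsup: "limsup (\<lambda>n. ereal ((\<Sum>i=1..n. (Lt n i)\<^sup>2) / real n)) = ereal Lbar"
    \<comment> \<open>the functionals of (A2)\<close>
    and fr_meas: "\<forall>n. \<forall>i\<in>{1..n}. \<forall>y. fr n i y \<in> borel_measurable M"
    and fr_bounded: "\<forall>n. \<forall>i\<in>{1..n}. \<exists>C. \<forall>y. AE \<omega> in M. 0 \<le> fr n i y \<omega> \<and> fr n i y \<omega> \<le> C"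
    and g_meas: "\<forall>n. \<forall>i\<in>{1..n}. \<forall>y u. g n i y u \<in> borel_measurable M"
    and f1_nonneg: "\<forall>y. 0 \<le> f1 y"
    and f1_bounded: "bounded (range f1)"
    and \<phi>_nonneg: "\<forall>u\<ge>0. 0 \<le> \<phi> u"
    and \<phi>_0: "(\<phi> \<longlongrightarrow> 0) (at_right 0)"
    \<comment> \<open>(A2)(ii)\<close>
    and A2ii: "\<forall>y. (\<lambda>u. small_ball M d X y u - \<phi> u * f1 y) \<in> o[at_right 0](\<phi>)"
    \<comment> \<open>(A2)(iii)\<close>
    and A2iii_decomp: "\<forall>n. \<forall>i\<in>{1..n}. \<forall>y. \<forall>u>0. AE \<omega> in M.
      FF n i y u \<omega> = \<phi> u * fr n i y \<omega> + g n i y u \<omega>"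
    and A2iii_g: "\<forall>n. \<forall>i\<in>{1..n}. \<forall>y. AE \<omega> in M. (\<lambda>u. \<bar>g n i y u \<omega>\<bar>) \<in> o[at_right 0](\<phi>)"
    and A2iii_g_mean: "\<forall>y u. (\<forall>n. u n > 0) \<longrightarrow> u \<longlonglongrightarrow> 0 \<longrightarrow>
      (AE \<omega> in M. (\<lambda>n. (\<Sum>i=1..n. \<bar>g n i y (u n) \<omega>\<bar>) / real n) \<in> o(\<lambda>n. \<phi> (u n)))"
    and A2iii_bounds: "\<exists>\<delta>>0. \<forall>n. \<forall>i\<in>{1..n}. \<forall>y\<in>pm_cball d x \<delta>.
      Linf_norm M (fr n i y) \<le> ereal (Lt n i) \<and>
      (\<forall>u\<in>{0<..\<delta>}. ereal (inverse (\<phi> u)) * Linf_norm M (g n i y u) \<le> ereal (Lt n i))"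
    \<comment> \<open>(A2)(iv)\<close>
    and A2iv: "AE \<omega> in M. (\<lambda>n. (\<Sum>i=1..n. fr n i x \<omega>) / real n) \<longlonglongrightarrow> f1 x"
    and f1_pos: "f1 x > 0"
    \<comment> \<open>(A2)(v)\<close>
    and \<tau>0_range: "\<tau>0 ` {0..1} \<subseteq> {0..1}"
    and A2v: "uniform_limit {0..1} (\<lambda>\<eta> u. \<phi> (\<eta> * u) / \<phi> \<eta>) \<tau>0 (at_right 0)"
    \<comment> \<open>(A3)(i)\<close>
    and A3i: "\<forall>n. \<forall>i\<in>{1..n}. is_cond_exp M (Gsig M S X Y n (i - 1)) (Y n i) (\<lambda>\<omega>. r (X n i \<omega>))"
    \<comment> \<open>(A4)(i)\<close>
    and A4_cont: "\<forall>k. pm_continuous d (rv (e k))"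
    and \<psi>_meas: "\<forall>k y. \<psi> k y \<in> borel_measurable borel"
    and gb_meas: "\<forall>k n. \<forall>i\<in>{1..n}. \<forall>y.
      (\<lambda>(\<omega>, s). gb k n i y s \<omega>) \<in> borel_measurable (Fsig M S X Y n (i - 1) \<Otimes>\<^sub>M borel)"
    and A4_cond: "\<forall>k n. \<forall>i\<in>{1..n}. \<forall>y.
      is_cond_exp M (FDsig M S d X Y y n i)
        (\<lambda>\<omega>. rv (e k) (X n i \<omega>) - rv (e k) y)
        (\<lambda>\<omega>. \<psi> k y (d y (X n i \<omega>)) + gb k n i y (d y (X n i \<omega>)) \<omega>)"
    and \<psi>_0: "\<forall>k y. \<psi> k y 0 = 0"
    and A4_nhd: "\<exists>\<rho>>0.
      (\<forall>k. \<forall>y\<in>pm_cball d x \<rho>.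
        (\<forall>s\<in>{0..\<rho>}. \<psi> k y differentiable (at s within {0..})) \<and> deriv_nonneg (\<psi> k y) 0 \<noteq> 0) \<and>
      (\<forall>k. \<forall>s\<in>{0<..\<rho>}. \<forall>u\<in>{0..s}. \<forall>y\<in>pm_cball d x s. \<forall>n. \<forall>i\<in>{1..n}.
        ereal (\<bar>deriv_nonneg (\<psi> k y) u - deriv_nonneg (\<psi> k x) 0\<bar> * s) + Linf_norm M (gb k n i y s)
          \<le> ereal (L k * s powr (1 + \<alpha>)))"
    and A4_sum: "summable (\<lambda>k. (deriv_nonneg (\<psi> k x) 0)\<^sup>2 + (L k)\<^sup>2)"
    \<comment> \<open>(A5)\<close>
    and A5_h: "h \<longlonglongrightarrow> 0"
    and A5_b: "b \<longlonglongrightarrow> 0"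
    and A5_hb: "(\<lambda>n. h n / b n) \<longlonglongrightarrow> 0"
    and A5_log: "filterlim
      (\<lambda>n. (real n * \<phi> (h n)) powr (1/2) * ln (real n) powr (- max (2 + \<alpha>) (1/2))) at_top sequentially"
    and A5_ratio: "(\<lambda>n. \<phi> (h n) / \<phi> (b n) * (ln (real n))\<^sup>2) \<in> o(\<lambda>_. 1)"
    and A5_h_rate: "(\<lambda>n. h n * (real n * \<phi> (h n)) powr (1/2)) \<in> O(\<lambda>_. 1)"
    and A5_b_rate: "(\<lambda>n. b n powr (1 + \<alpha>) * (real n * \<phi> (h n)) powr (1/2)) \<in> o(\<lambda>_. 1)"
    and A5_b_h: "b \<in> o(\<lambda>n. h n * sqrt (real n * \<phi> (h n)))"
    and A5_h_log: "(\<lambda>n. h n * ln (real n) powr (1/2)) \<in> o(\<lambda>_. 1)"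
begin

interpretation prob_space M by (rule prob)

definition D where "D n i \<omega> = d x (X n i \<omega>)"

lemma D_pos: "0 \<le> D n i \<omega>" for n i \<omega> using pm by (simp add: D_def pseudometric_def)

lemma d_self: "d x x = 0" using pm by (simp add: pseudometric_def)

lemma D_meas: "D n i \<in> borel_measurable M" if "i \<in> {1..n}" for n i
  using measurable_compose[of "X n i" M S "d x" borel] X_meas S_dist that by (simp add: D_def[abs_def])

lemma D11 [measurable]: "D 1 1 \<in> borel_measurable M" using D_meas[of 1 1] by simp

text \<open>The simplifier turns the index \<open>1\<close> into \<open>Suc 0\<close>, which the rule above does not match.\<close>

lemma D_Suc_0_meas [measurable]: "D (Suc 0) (Suc 0) \<in> borel_measurable M" using D11 by simp

text \<open>The order of the number of observations within distance \<open>h\<close> of \<open>x\<close>.\<close>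

definition v where "v n = real n * \<phi> (h n)"

section \<open>Rates and small balls\<close>

lemma h_right: "filterlim h (at_right 0) sequentially"
  using A5_h h_pos unfolding filterlim_at by (auto simp: eventually_sequentially intro!: exI[of _ 1])

lemma v_log: "eventually (\<lambda>n. v n > 0 \<and> (ln (real n))\<^sup>2 \<le> v n) sequentially"
proof (rule eventually_log_square_le)
  show "filterlim (\<lambda>n. v n powr (1/2) * ln (real n) powr (- max (2 + \<alpha>) (1/2))) at_top sequentially"
    using A5_log by (simp add: v_def)
  show "v n \<ge> 0" if "n \<ge> 1" for n using that \<phi>_nonneg h_pos by (simp add: v_def less_imp_le)
qed (use \<alpha> in simp)

lemma v_pos: "eventually (\<lambda>n. v n > 0) sequentially" using v_log by eventually_elim auto

lemma \<phi>_pos: "eventually (\<lambda>n. \<phi> (h n) > 0) sequentially"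
  using v_pos eventually_ge_at_top[of 1] by eventually_elim (auto simp: v_def zero_less_mult_iff)

lemma log_over_v_limit: "(\<lambda>n. ln (real n) / v n) \<longlonglongrightarrow> 0"
proof (rule tendsto_sandwich[of "\<lambda>_. 0"])
  have ln_ev: "eventually (\<lambda>n. 1 \<le> ln (real n)) sequentially"
    using filterlim_compose[OF ln_at_top filterlim_real_sequentially] unfolding filterlim_at_top by blast
  show "eventually (\<lambda>n. 0 \<le> ln (real n) / v n) sequentially"
    using v_pos ln_ev by eventually_elim auto
  show "eventually (\<lambda>n. ln (real n) / v n \<le> inverse (ln (real n))) sequentially"
    using v_log ln_ev by eventually_elim (auto simp: field_simps power2_eq_square)
  show "(\<lambda>n. inverse (ln (real n))) \<longlonglongrightarrow> 0"
    by (intro tendsto_inverse_0_at_top filterlim_compose[OF ln_at_top filterlim_real_sequentially])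
qed simp

lemma phi_ratio_limit: "(\<lambda>n. \<phi> (h n * s) / \<phi> (h n)) \<longlonglongrightarrow> \<tau>0 s" if "s \<in> {0..1}" for s
  using filterlim_compose[OF tendsto_uniform_limitI[OF A2v that] h_right] .

text \<open>Along the bandwidths the ratio at \<open>u = 1\<close> is eventually \<open>1\<close>, not the default value \<open>0\<close> of a division
  by zero, because \<open>n \<phi>(h)\<close> tends to infinity.\<close>

lemma tau0_1: "\<tau>0 1 = 1"
proof -
  have "(\<lambda>n. \<phi> (h n * 1) / \<phi> (h n)) \<longlonglongrightarrow> 1"
    using \<phi>_pos by (intro tendsto_eventually) (auto elim!: eventually_mono)
  then show ?thesis using LIMSEQ_unique phi_ratio_limit[of 1] by fastforce
qed

lemma \<phi>_bigo: "(\<lambda>n. \<phi> (h n * s)) \<in> O(\<lambda>n. \<phi> (h n))" if "s \<in> {0..1}" for s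
  using \<phi>_pos by (intro bigoI_tendsto[OF phi_ratio_limit[OF that]]) (auto elim!: eventually_mono)

lemma scaled_h_right: "filterlim (\<lambda>n. h n * s) (at_right 0) sequentially" if "s > 0" for s
proof -
  have "(\<lambda>n. h n * s) \<longlonglongrightarrow> 0 * s" by (intro tendsto_intros A5_h)
  then show ?thesis
    using h_pos that unfolding filterlim_at by (auto simp: eventually_sequentially intro!: exI[of _ 1])
qed

lemma small_ball_ratio_limit: "(\<lambda>n. measure M {\<omega>\<in>space M. D 1 1 \<omega> \<le> h n * s} / \<phi> (h n)) \<longlonglongrightarrow> f1 x * \<tau>0 s"
  if s: "s \<in> {0<..1}" for s
proof -
  have "(\<lambda>n. small_ball M d X x (h n * s) - \<phi> (h n * s) * f1 x) \<in> o(\<lambda>n. \<phi> (h n * s))"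
    using s by (intro landau_o.small.compose[OF A2ii[rule_format]] scaled_h_right) auto
  also have "(\<lambda>n. \<phi> (h n * s)) \<in> O(\<lambda>n. \<phi> (h n))" using s by (intro \<phi>_bigo) auto
  finally have "(\<lambda>n. (small_ball M d X x (h n * s) - \<phi> (h n * s) * f1 x) / \<phi> (h n)) \<longlonglongrightarrow> 0"
    by (rule smalloD_tendsto)
  moreover have "(\<lambda>n. \<phi> (h n * s) / \<phi> (h n) * f1 x) \<longlonglongrightarrow> \<tau>0 s * f1 x"
    using s by (intro tendsto_intros phi_ratio_limit) auto
  ultimately have "(\<lambda>n. (small_ball M d X x (h n * s) - \<phi> (h n * s) * f1 x) / \<phi> (h n)
      + \<phi> (h n * s) / \<phi> (h n) * f1 x) \<longlonglongrightarrow> 0 + \<tau>0 s * f1 x"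
    by (rule tendsto_add)
  then show ?thesis by (simp add: small_ball_def D_def diff_divide_distrib mult.commute)
qed

text \<open>The main parts \<open>\<phi>(h s) f\<^sub>n\<^sub>,\<^sub>i\<^sub>,\<^sub>1\<close> average by (A2)(iv), and the average of the remainders is
  negligible along the radii \<open>h s\<close>.\<close>

lemma conditional_small_ball_average_limit: "AE \<omega> in M. (\<lambda>n. (\<Sum>i=1..n. FF n i x (h n * s) \<omega>) / v n) \<longlonglongrightarrow> f1 x * \<tau>0 s"
  if s: "s \<in> {0<..1}" for s
proof -
  \<comment> \<open>the bandwidth at index \<open>0\<close> may be nonpositive\<close>
  define u where "u n = (if n = 0 then 1 else h n * s)" for n :: nat
  have u_pos: "u n > 0" for n using h_pos s by (auto simp: u_def)
  have u_eq: "eventually (\<lambda>n. u n = h n * s) sequentially"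
    using eventually_gt_at_top[of 0] by eventually_elim (simp add: u_def)
  have "(\<lambda>n. h n * s) \<longlonglongrightarrow> 0" using scaled_h_right[of s] s unfolding filterlim_at by auto
  then have "u \<longlonglongrightarrow> 0" using u_eq by (subst filterlim_cong[OF refl refl]) auto
  then have "AE \<omega> in M. (\<lambda>n. (\<Sum>i=1..n. \<bar>g n i x (u n) \<omega>\<bar>) / real n) \<in> o(\<lambda>n. \<phi> (u n))"
    using A2iii_g_mean u_pos by blast
  moreover have "AE \<omega> in M. \<forall>n. \<forall>i\<in>{1..n}. FF n i x (u n) \<omega> = \<phi> (u n) * fr n i x \<omega> + g n i x (u n) \<omega>"
    using A2iii_decomp u_pos by (subst AE_all_countable, intro allI, subst AE_ball_countable) auto
  ultimately show ?thesis using A2iv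
  proof eventually_elim
    case (elim \<omega>)
    have "(\<lambda>n. (\<Sum>i=1..n. \<bar>g n i x (u n) \<omega>\<bar>) / real n) \<in> o(\<lambda>n. \<phi> (u n))" by (rule elim(1))
    also have "(\<lambda>n. \<phi> (u n)) \<in> O(\<lambda>n. \<phi> (h n))"
    proof -
      have "eventually (\<lambda>n. \<phi> (u n) = \<phi> (h n * s)) sequentially" using u_eq by eventually_elim simp
      from landau_o.big.in_cong[OF this] show ?thesis using \<phi>_bigo[of s] s by auto
    qed
    finally have "(\<lambda>n. (\<Sum>i=1..n. \<bar>g n i x (u n) \<omega>\<bar>) / real n / \<phi> (h n)) \<longlonglongrightarrow> 0"
      by (rule smalloD_tendsto)
    then have g0: "(\<lambda>n. (\<Sum>i=1..n. g n i x (u n) \<omega>) / real n / \<phi> (h n)) \<longlonglongrightarrow> 0"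
    proof (rule Lim_null_comparison[rotated])
      show "eventually (\<lambda>n. norm ((\<Sum>i=1..n. g n i x (u n) \<omega>) / real n / \<phi> (h n))
        \<le> (\<Sum>i=1..n. \<bar>g n i x (u n) \<omega>\<bar>) / real n / \<phi> (h n)) sequentially"
        using \<phi>_pos by eventually_elim (auto simp: abs_divide intro!: divide_right_mono sum_abs)
    qed
    have "(\<lambda>n. \<phi> (h n * s) / \<phi> (h n) * ((\<Sum>i=1..n. fr n i x \<omega>) / real n)) \<longlonglongrightarrow> \<tau>0 s * f1 x"
      using s by (intro tendsto_intros phi_ratio_limit elim(3)) auto
    from tendsto_add[OF this g0]
    have "(\<lambda>n. \<phi> (h n * s) / \<phi> (h n) * ((\<Sum>i=1..n. fr n i x \<omega>) / real n)
       + (\<Sum>i=1..n. g n i x (u n) \<omega>) / real n / \<phi> (h n)) \<longlonglongrightarrow> f1 x * \<tau>0 s" by (simp add: mult.commute)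
    then show ?case
    proof (rule Lim_transform_eventually)
      show "eventually (\<lambda>n. \<phi> (h n * s) / \<phi> (h n) * ((\<Sum>i=1..n. fr n i x \<omega>) / real n)
       + (\<Sum>i=1..n. g n i x (u n) \<omega>) / real n / \<phi> (h n) = (\<Sum>i=1..n. FF n i x (h n * s) \<omega>) / v n) sequentially"
        using eventually_gt_at_top[of 0]
      proof eventually_elim
        case n: (elim n)
        have u: "u n = h n * s" using n by (simp add: u_def)
        have "(\<Sum>i=1..n. FF n i x (h n * s) \<omega>) = (\<Sum>i=1..n. \<phi> (h n * s) * fr n i x \<omega> + g n i x (u n) \<omega>)"
          using elim(2) unfolding u[symmetric] by (intro sum.cong) auto
        also have "\<dots> = \<phi> (h n * s) * (\<Sum>i=1..n. fr n i x \<omega>) + (\<Sum>i=1..n. g n i x (u n) \<omega>)"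
          by (simp add: sum.distrib sum_distrib_left)
        finally show ?case by (simp add: v_def add_divide_distrib mult.commute)
      qed
    qed
  qed
qed

section \<open>The two kernels and their means\<close>

text \<open>\<open>M1\<close> belongs to the kernel \<open>K(t)\<close> of the denominator, and \<open>M0\<close> to \<open>t K(t)\<close>, which weights the linear
  part of the increments of the regression function.\<close>

definition K2 where "K2 t = K t * t"

lemma K_supp: "K t = 0" if "t \<notin> {0..1}" for t
  using that K_support closure_subset[of "{t. K t \<noteq> 0}"] by auto

lemma K_cont: "continuous_on {0..1} K" by (rule differentiable_imp_continuous_on[OF K_diff])

lemma K2_cont: "continuous_on {0..1} K2" unfolding K2_def by (intro continuous_intros K_cont)

lemma K_meas [measurable]: "K \<in> borel_measurable borel"
proof -
  have "K = (\<lambda>t. indicator {0..1} t *\<^sub>R K t)"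
  proof
    show "K t = indicator {0..1} t *\<^sub>R K t" for t using K_supp[of t] by (cases "t \<in> {0..1}") simp_all
  qed
  then show ?thesis using borel_measurable_continuous_on_indicator[OF _ K_cont] by simp
qed

lemma K2_meas [measurable]: "K2 \<in> borel_measurable borel" unfolding K2_def by measurable

definition Ksup where "Ksup = (SUP t. K t)"

lemma K_le_sup: "K t \<le> Ksup"
  unfolding Ksup_def by (intro cSUP_upper bounded_imp_bdd_above K_bounded) simp

lemma K2_bd: "\<bar>K2 t\<bar> \<le> Ksup" for t
proof (cases "t \<in> {0..1}")
  case True
  then have "K t * t \<le> K t * 1" using K_nonneg by (intro mult_left_mono) auto
  then show ?thesis using True K_le_sup[of t] K_nonneg by (simp add: K2_def)
next
  case False
  then show ?thesis using K_supp[of t] K_le_sup[of t] by (simp add: K2_def)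
qed

lemma K_deriv: "(K has_vector_derivative deriv01 K s) (at s within {0..1})" if "s \<in> {0..1}" for s
  using K_diff that by (simp add: differentiable_on_def deriv01_def flip: vector_derivative_works)

lemma K2_deriv': "(K2 has_vector_derivative (K s + deriv01 K s * s)) (at s within {0..1})" if "s \<in> {0..1}" for s
  unfolding K2_def using K_deriv[OF that]
  by (auto intro!: derivative_eq_intros)

lemma K2_deriv01: "deriv01 K2 s = K s + deriv01 K s * s" if "s \<in> {0..1}" for s
  unfolding deriv01_def[of K2] using that K2_deriv'[OF that]
  by (intro vector_derivative_within_closed_interval) auto

lemma K2_C1: "continuous_on {0..1} (deriv01 K2)"
  using K_cont K_C1 by (subst continuous_on_cong[OF refl K2_deriv01]) (auto intro!: continuous_intros)

lemma K2_deriv: "(K2 has_vector_derivative deriv01 K2 s) (at s within {0..1})" if "s \<in> {0..1}" for s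
  using K2_deriv'[OF that] K2_deriv01[OF that] by simp

definition A1 where "A1 = f1 x * M1 K \<tau>0"

definition A0 where "A0 = f1 x * M0 K \<tau>0"

lemma integral_scaled_tau0: "integral {0..1} (\<lambda>s. k s * (f1 x * \<tau>0 s)) = f1 x * integral {0..1} (\<lambda>s. k s * \<tau>0 s)" for k :: "real \<Rightarrow> real"
proof -
  have "(\<lambda>s. k s * (f1 x * \<tau>0 s)) = (\<lambda>s. f1 x * (k s * \<tau>0 s))" by (simp add: ac_simps)
  then show ?thesis by simp
qed

lemma h_ev: "eventually (\<lambda>n. h n > 0) sequentially"
  using eventually_ge_at_top[of 1] by eventually_elim (use h_pos in simp)

lemma K_mean_limit: "(\<lambda>n. (LINT \<omega>|M. K (D 1 1 \<omega> / h n)) / \<phi> (h n)) \<longlonglongrightarrow> A1"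
proof -
  have "K 1 * (f1 x * \<tau>0 1) - integral {0..1} (\<lambda>s. deriv01 K s * (f1 x * \<tau>0 s)) = A1"
    unfolding integral_scaled_tau0 by (simp add: A1_def M1_def tau0_1 algebra_simps)
  moreover have "K t = 0" if "t > 1" for t using that by (intro K_supp) auto
  ultimately show ?thesis
    using kernel_mean_limit[OF prob D11 D_pos K_deriv K_C1 _ h_ev \<phi>_pos small_ball_ratio_limit] by simp
qed

lemma K2_mean_limit: "(\<lambda>n. (LINT \<omega>|M. K2 (D 1 1 \<omega> / h n)) / \<phi> (h n)) \<longlonglongrightarrow> A0"
proof -
  have "K2 1 * (f1 x * \<tau>0 1) - integral {0..1} (\<lambda>s. deriv01 K2 s * (f1 x * \<tau>0 s)) = A0"
    unfolding integral_scaled_tau0 by (simp add: A0_def M0_def tau0_1 K2_def[abs_def] algebra_simps)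
  moreover have "K2 t = 0" if "t > 1" for t using that K_supp[of t] by (simp add: K2_def)
  ultimately show ?thesis
    using kernel_mean_limit[OF prob D11 D_pos K2_deriv K2_C1 _ h_ev \<phi>_pos small_ball_ratio_limit] by simp
qed

text \<open>Because \<open>K\<close> decreases and \<open>\<tau>0\<close> is nonnegative, \<open>M1\<close> is at least \<open>K(1)\<close>.\<close>

lemma M1_pos: "M1 K \<tau>0 > 0"
proof -
  have "integral {0..1} (\<lambda>s. deriv01 K s * \<tau>0 s) \<le> 0"
  proof (cases "(\<lambda>s. deriv01 K s * \<tau>0 s) integrable_on {0..1}")
    case True
    have "integral {0..1} (\<lambda>s. deriv01 K s * \<tau>0 s) \<le> integral {0..1} (\<lambda>s::real. 0::real)"
      using True K_decr \<tau>0_range by (intro integral_le) (auto simp: mult_nonpos_nonneg image_subset_iff)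
    then show ?thesis by simp
  next
    case False
    then show ?thesis by (simp add: not_integrable_integral)
  qed
  then show ?thesis using K_1 by (simp add: M1_def)
qed

lemma A1_pos: "A1 > 0" using f1_pos M1_pos by (simp add: A1_def)

definition F where "F n i = Fsig M S X Y n (i - 1)"

definition p where "p n i = real_cond_exp M (F n i) (\<lambda>\<omega>. K (D n i \<omega> / h n))"

definition q where "q n i = real_cond_exp M (F n i) (\<lambda>\<omega>. K2 (D n i \<omega> / h n))"

definition Z where "Z n i = cond_exp M (F n i) (\<lambda>\<omega>. K (D n i \<omega> / h n) *\<^sub>R Y n i \<omega>)"

lemma FF_version: "is_cond_exp M (F n i) (\<lambda>\<omega>. indicat_real {..u} (D n i \<omega>)) (FF n i x u)" if "i \<in> {1..n}" for n i u
  using FF that by (simp add: F_def D_def)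

lemma p_average_limit: "AE \<omega> in M. (\<lambda>n. (\<Sum>i=1..n. p n i \<omega>) / v n) \<longlonglongrightarrow> A1"
  unfolding p_def
  by (rule conditional_kernel_average_limit[where ?D0.0 = "D 1 1", OF prob FF_version D_meas D_pos D11 D_pos _ v_pos \<phi>_pos K_cont _ K_meas conditional_small_ball_average_limit small_ball_ratio_limit K_mean_limit])
    (use h_pos K_supp in auto)

lemma q_average_limit: "AE \<omega> in M. (\<lambda>n. (\<Sum>i=1..n. q n i \<omega>) / v n) \<longlonglongrightarrow> A0"
  unfolding q_def
  by (rule conditional_kernel_average_limit[where ?D0.0 = "D 1 1", OF prob FF_version D_meas D_pos D11 D_pos _ v_pos \<phi>_pos K2_cont _ K2_meas conditional_small_ball_average_limit small_ball_ratio_limit K2_mean_limit])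
    (use h_pos K_supp in \<open>auto simp: K2_def\<close>)

section \<open>Linearisation of the regression function\<close>

definition c where "c k = deriv_nonneg (\<psi> k x) 0"

lemma basis_inner: "e j \<bullet> e k = (if j = k then 1 else 0)" for j k
  using basis by (simp add: orthonormal_basis_def)

lemma c_sum: "summable (\<lambda>k. (c k)\<^sup>2)" and L_sum: "summable (\<lambda>k. (L k)\<^sup>2)"
  by (rule summable_comparison_test'[OF A4_sum, of 0]; simp add: c_def)+

definition w where "w = (\<Sum>k. c k *\<^sub>R e k)"

lemma w_inner: "w \<bullet> e k = c k" for k
  unfolding w_def by (rule inner_suminf_orthonormal[OF basis_inner square_summable_imp_summable_orthonormal[OF basis_inner c_sum]])

definition \<Lambda> where "\<Lambda> = sqrt (\<Sum>k. (L k)\<^sup>2)"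

text \<open>(A4) says nothing about the radius \<open>0\<close>, but by identical distribution the probability of
  distance \<open>0\<close> is at most every small ball probability, and these tend to \<open>0\<close>.\<close>

lemma distance_AE_nonzero: "AE \<omega> in M. D n i \<omega> \<noteq> 0" if i: "i \<in> {1..n}" for n i
proof -
  have [measurable]: "d x \<in> borel_measurable S" using S_dist by simp
  have eq: "measure M {\<omega>\<in>space M. D m j \<omega> \<le> u}
      = measure (distr M (S \<Otimes>\<^sub>M borel) (\<lambda>\<omega>. (X m j \<omega>, Y m j \<omega>))) {z \<in> space (S \<Otimes>\<^sub>M borel). d x (fst z) \<le> u}"
    if j: "j \<in> {1..m}" for m j u
  proof -
    have [measurable]: "X m j \<in> M \<rightarrow>\<^sub>M S" "Y m j \<in> borel_measurable M" using X_meas Y_meas j by auto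
    have "measure (distr M (S \<Otimes>\<^sub>M borel) (\<lambda>\<omega>. (X m j \<omega>, Y m j \<omega>))) {z \<in> space (S \<Otimes>\<^sub>M borel). d x (fst z) \<le> u}
      = measure M ((\<lambda>\<omega>. (X m j \<omega>, Y m j \<omega>)) -` {z \<in> space (S \<Otimes>\<^sub>M borel). d x (fst z) \<le> u} \<inter> space M)"
      by (rule measure_distr) measurable
    also have "(\<lambda>\<omega>. (X m j \<omega>, Y m j \<omega>)) -` {z \<in> space (S \<Otimes>\<^sub>M borel). d x (fst z) \<le> u} \<inter> space M
      = {\<omega>\<in>space M. D m j \<omega> \<le> u}"
      by (auto simp: space_pair_measure S_space D_def)
    finally show ?thesis by simp
  qed
  have same: "distr M (S \<Otimes>\<^sub>M borel) (\<lambda>\<omega>. (X n i \<omega>, Y n i \<omega>)) = distr M (S \<Otimes>\<^sub>M borel) (\<lambda>\<omega>. (X 1 1 \<omega>, Y 1 1 \<omega>))"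
    using same_distr i by blast
  have "measure M {\<omega>\<in>space M. D n i \<omega> \<le> 0} = measure M {\<omega>\<in>space M. D 1 1 \<omega> \<le> 0}"
    unfolding eq[OF i] same by (rule eq[symmetric]) simp
  also have "\<dots> \<le> 0"
  proof (rule tendsto_lowerbound)
    have "(\<lambda>n. measure M {\<omega>\<in>space M. D 1 1 \<omega> \<le> h n * 1} / \<phi> (h n) * \<phi> (h n)) \<longlonglongrightarrow> f1 x * \<tau>0 1 * 0"
      by (intro tendsto_mult small_ball_ratio_limit filterlim_compose[OF \<phi>_0 h_right]) simp
    then show "(\<lambda>n. measure M {\<omega>\<in>space M. D 1 1 \<omega> \<le> h n * 1} / \<phi> (h n) * \<phi> (h n)) \<longlonglongrightarrow> 0" by simp
    show "eventually (\<lambda>n. measure M {\<omega>\<in>space M. D 1 1 \<omega> \<le> 0}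
        \<le> measure M {\<omega>\<in>space M. D 1 1 \<omega> \<le> h n * 1} / \<phi> (h n) * \<phi> (h n)) sequentially"
      using \<phi>_pos h_ev
    proof eventually_elim
      case (elim n)
      have "measure M {\<omega>\<in>space M. D 1 1 \<omega> \<le> 0} \<le> measure M {\<omega>\<in>space M. D 1 1 \<omega> \<le> h n * 1}"
        using elim(2) by (intro finite_measure_mono) auto
      then show ?case using elim(1) by simp
    qed
  qed simp
  finally have "measure M {\<omega>\<in>space M. D n i \<omega> \<le> 0} = 0" by (simp add: measure_nonneg antisym)
  moreover have [measurable]: "D n i \<in> borel_measurable M" using D_meas[OF i] .
  ultimately have "AE \<omega> in M. \<not> D n i \<omega> \<le> 0"
    by (subst AE_iff_measurable[OF _ refl]) (auto simp: emeasure_eq_measure)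
  then show ?thesis by eventually_elim auto
qed

text \<open>Halving the radius keeps it strictly inside the neighbourhood of (A2)(i).  The estimate of
  \<open>\<psi>\<close> at a fixed radius does not involve \<open>n\<close> and \<open>i\<close>; it is read off at \<open>n = i = 1\<close>.\<close>

lemma linearisation_radius:
  obtains \<rho>' where "\<rho>' > 0"
    and "\<And>k s. s \<in> {0<..\<rho>'} \<Longrightarrow> \<bar>\<psi> k x s - c k * s\<bar> \<le> L k * s powr (1 + \<alpha>)"
    and "\<And>k n i. i \<in> {1..n} \<Longrightarrow> AE \<omega> in M. D n i \<omega> \<in> {0<..\<rho>'} \<longrightarrow>
      \<bar>gb k n i x (D n i \<omega>) \<omega>\<bar> \<le> L k * D n i \<omega> powr (1 + \<alpha>)"
proof -
  obtain \<delta> where "\<delta> > 0" and incr: "\<And>n i. i \<in> {1..n} \<Longrightarrow> AE \<omega> in M. \<forall>u\<in>{0<..<\<delta>}. \<forall>\<epsilon>\<in>{0..<u}.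
      (FF n i x (u + \<epsilon>) \<omega> - FF n i x (u - \<epsilon>) \<omega>) / FF n i x u \<omega> \<le> Lt n i * \<epsilon> * inverse u"
    using A2i_incr by blast
  obtain \<rho> where "\<rho> > 0"
    and \<psi>_diff: "\<And>k s. s \<in> {0..\<rho>} \<Longrightarrow> \<psi> k x differentiable (at s within {0..})"
    and \<psi>_bd: "\<And>k s u n i. s \<in> {0<..\<rho>} \<Longrightarrow> u \<in> {0..s} \<Longrightarrow> i \<in> {1..n} \<Longrightarrow>
        ereal (\<bar>deriv_nonneg (\<psi> k x) u - c k\<bar> * s) + Linf_norm M (gb k n i x s) \<le> ereal (L k * s powr (1 + \<alpha>))"
  proof -
    obtain \<rho> where "\<rho> > 0" and 1: "\<forall>k. \<forall>y\<in>pm_cball d x \<rho>.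
        (\<forall>s\<in>{0..\<rho>}. \<psi> k y differentiable (at s within {0..})) \<and> deriv_nonneg (\<psi> k y) 0 \<noteq> 0"
      and 2: "\<forall>k. \<forall>s\<in>{0<..\<rho>}. \<forall>u\<in>{0..s}. \<forall>y\<in>pm_cball d x s. \<forall>n. \<forall>i\<in>{1..n}.
        ereal (\<bar>deriv_nonneg (\<psi> k y) u - deriv_nonneg (\<psi> k x) 0\<bar> * s) + Linf_norm M (gb k n i y s)
          \<le> ereal (L k * s powr (1 + \<alpha>))"
      using A4_nhd by blast
    have x_mem: "x \<in> pm_cball d x s" if "s \<ge> 0" for s using that d_self by (simp add: pm_cball_def)
    show thesis
    proof (rule that[OF \<open>\<rho> > 0\<close>])
      show "\<psi> k x differentiable (at s within {0..})" if "s \<in> {0..\<rho>}" for k s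
        using 1 x_mem[of \<rho>] that \<open>\<rho> > 0\<close> by auto
      show "ereal (\<bar>deriv_nonneg (\<psi> k x) u - c k\<bar> * s) + Linf_norm M (gb k n i x s) \<le> ereal (L k * s powr (1 + \<alpha>))"
        if "s \<in> {0<..\<rho>}" "u \<in> {0..s}" "i \<in> {1..n}" for k s u n i
        using 2 x_mem[of s] that unfolding c_def by auto
    qed
  qed
  define \<rho>' where "\<rho>' = min \<rho> (\<delta> / 2)"
  have \<rho>': "\<rho>' > 0" "\<rho>' \<le> \<rho>" "\<rho>' < \<delta>" using \<open>\<rho> > 0\<close> \<open>\<delta> > 0\<close> by (auto simp: \<rho>'_def)
  have \<psi>_lin: "\<bar>\<psi> k x s - c k * s\<bar> \<le> L k * s powr (1 + \<alpha>)" if s: "s \<in> {0<..\<rho>'}" for k s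
  proof (rule linear_approximation_error_le)
    fix u assume u: "u \<in> {0..s}"
    then show "\<psi> k x differentiable (at u within {0..})" using s \<rho>' by (intro \<psi>_diff) auto
    have "ereal (\<bar>deriv_nonneg (\<psi> k x) u - c k\<bar> * s) + 0
        \<le> ereal (\<bar>deriv_nonneg (\<psi> k x) u - c k\<bar> * s) + Linf_norm M (gb k 1 1 x s)"
      by (intro add_left_mono Linf_norm_nonneg[OF prob])
    also have "\<dots> \<le> ereal (L k * s powr (1 + \<alpha>))" using s u \<rho>' by (intro \<psi>_bd) auto
    finally show "\<bar>deriv_nonneg (\<psi> k x) u - c k\<bar> * s \<le> L k * s powr (1 + \<alpha>)" by simp
  qed (use s \<psi>_0 in auto)
  have gb_bd: "AE \<omega> in M. D n i \<omega> \<in> {0<..\<rho>'} \<longrightarrow> \<bar>gb k n i x (D n i \<omega>) \<omega>\<bar> \<le> L k * D n i \<omega> powr (1 + \<alpha>)"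
    if i: "i \<in> {1..n}" for k n i
  proof (rule AE_bound_at_random_radius[OF prob D_meas[OF i] FF_version[OF i] _ incr[OF i]])
    show "0 \<le> Lt n i" using Lt_nonneg i by simp
    show "(\<lambda>(\<omega>, s). gb k n i x s \<omega>) \<in> borel_measurable (F n i \<Otimes>\<^sub>M borel)" using gb_meas i by (simp add: F_def)
    show "AE \<omega> in M. \<bar>gb k n i x s \<omega>\<bar> \<le> L k * s powr (1 + \<alpha>)" if s: "s \<in> {0<..\<rho>'}" for s
    proof -
      have "0 + Linf_norm M (gb k n i x s) \<le> ereal (\<bar>deriv_nonneg (\<psi> k x) 0 - c k\<bar> * s) + Linf_norm M (gb k n i x s)"
        using s by (intro add_right_mono) simp
      also have "\<dots> \<le> ereal (L k * s powr (1 + \<alpha>))" using s i \<rho>' by (intro \<psi>_bd) auto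
      finally have le: "Linf_norm M (gb k n i x s) \<le> ereal (L k * s powr (1 + \<alpha>))" by simp
      have "AE \<omega> in M. ereal \<bar>gb k n i x s \<omega>\<bar> \<le> Linf_norm M (gb k n i x s)"
        unfolding Linf_norm_def by (rule esssup_AE)
      then show ?thesis by eventually_elim (use le order_trans in fastforce)
    qed
  qed (use \<rho>' in auto)
  show thesis by (rule that[OF \<rho>'(1) \<psi>_lin gb_bd])
qed

text \<open>For each coordinate the error counts \<open>L k\<close> twice, for the linearisation of \<open>\<psi>\<close> and for \<open>gb\<close>;
  a kernel that vanishes beyond \<open>h\<close> turns the power of the distance into a power of \<open>h\<close>.\<close>

lemma linearisation_in_norm:
  obtains \<rho>' where "\<rho>' > 0" and "AE \<omega> in M. \<forall>n. h n \<le> \<rho>' \<longrightarrow> (\<forall>i\<in>{1..n}.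
      norm (Z n i \<omega> - p n i \<omega> *\<^sub>R r x - (h n * q n i \<omega>) *\<^sub>R w) \<le> (2 * h n powr (1 + \<alpha>) * \<Lambda>) * p n i \<omega>)"
proof -
  obtain \<rho>' where \<rho>'_pos: "\<rho>' > 0"
    and \<psi>_lin: "\<And>k s. s \<in> {0<..\<rho>'} \<Longrightarrow> \<bar>\<psi> k x s - c k * s\<bar> \<le> L k * s powr (1 + \<alpha>)"
    and gb_bd: "\<And>k n i. i \<in> {1..n} \<Longrightarrow> AE \<omega> in M. D n i \<omega> \<in> {0<..\<rho>'} \<longrightarrow>
      \<bar>gb k n i x (D n i \<omega>) \<omega>\<bar> \<le> L k * D n i \<omega> powr (1 + \<alpha>)"
    by (rule linearisation_radius) blast
  have coord: "AE \<omega> in M. \<bar>Z n i \<omega> \<bullet> e k - (r x \<bullet> e k) * p n i \<omega> - (c k * h n) * q n i \<omega>\<bar>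
      \<le> (2 * \<bar>L k\<bar> * h n powr (1 + \<alpha>)) * p n i \<omega>"
    if i: "i \<in> {1..n}" and hn: "h n \<le> \<rho>'" for n i k
    unfolding Z_def p_def q_def
  proof (rule conditional_coordinate_bound[OF prob])
    have n: "n \<ge> 1" and i1: "i - 1 + 1 = i" using i by auto
    have hp: "h n > 0" using h_pos n by simp
    have [measurable]: "D n i \<in> borel_measurable M" using D_meas[OF i] .
    show "subalgebra (Gsig M S X Y n (i - 1)) (F n i)" unfolding F_def by (rule subalgebra_Gsig_Fsig)
    show "subalgebra (FDsig M S d X Y x n i) (F n i)" unfolding F_def by (rule subalgebra_FDsig_Fsig)
    show "is_cond_exp M (Gsig M S X Y n (i - 1)) (Y n i) (\<lambda>\<omega>. r (X n i \<omega>))" using A3i i by blast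
    show "is_cond_exp M (FDsig M S d X Y x n i) (\<lambda>\<omega>. r (X n i \<omega>) \<bullet> e k - r x \<bullet> e k)
        (\<lambda>\<omega>. \<psi> k x (D n i \<omega>) + gb k n i x (D n i \<omega>) \<omega>)"
    proof -
      have "is_cond_exp M (FDsig M S d X Y x n i) (\<lambda>\<omega>. rv (e k) (X n i \<omega>) - rv (e k) x)
          (\<lambda>\<omega>. \<psi> k x (d x (X n i \<omega>)) + gb k n i x (d x (X n i \<omega>)) \<omega>)"
        using A4_cond i by blast
      then show ?thesis using rv_r by (simp add: D_def)
    qed
    have XG: "X n i \<in> Gsig M S X Y n (i - 1) \<rightarrow>\<^sub>M S" using measurable_Gsig[OF S_space, of X n "i - 1" M Y] i1 by simp
    have [measurable]: "D n i \<in> borel_measurable (Gsig M S X Y n (i - 1))"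
      unfolding D_def[abs_def] by (rule measurable_compose[OF XG S_dist[rule_format]])
    show "(\<lambda>\<omega>. K (D n i \<omega> / h n)) \<in> borel_measurable (Gsig M S X Y n (i - 1))" by measurable
    have [measurable]: "D n i \<in> borel_measurable (FDsig M S d X Y x n i)"
      unfolding D_def[abs_def] by (rule measurable_FDsig)
    show "(\<lambda>\<omega>. K (D n i \<omega> / h n)) \<in> borel_measurable (FDsig M S d X Y x n i)" by measurable
    show "integrable M (\<lambda>\<omega>. K2 (D n i \<omega> / h n))"
      using K2_bd by (intro integrable_const_bound[where B = Ksup]) auto
    show "AE \<omega> in M. \<bar>K (D n i \<omega> / h n) * (\<psi> k x (D n i \<omega>) + gb k n i x (D n i \<omega>) \<omega>) - c k * h n * K2 (D n i \<omega> / h n)\<bar>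
        \<le> 2 * \<bar>L k\<bar> * h n powr (1 + \<alpha>) * K (D n i \<omega> / h n)"
      using gb_bd[OF i, of k] distance_AE_nonzero[OF i]
    proof eventually_elim
      case (elim \<omega>)
      let ?D = "D n i \<omega>" and ?\<Delta> = "K (D n i \<omega> / h n)"
      show ?case
      proof (cases "?D \<le> h n")
        case False
        then have "?\<Delta> = 0" using hp by (intro K_supp) (simp add: field_simps)
        then show ?thesis by (simp add: K2_def)
      next
        case True
        then have D: "?D \<in> {0<..\<rho>'}" using elim(2) D_pos[of n i \<omega>] hn by auto
        have "L k * ?D powr (1 + \<alpha>) \<le> \<bar>L k\<bar> * h n powr (1 + \<alpha>)"
          using D True \<alpha> by (intro mult_mono powr_mono2) auto
        then have "\<bar>\<psi> k x ?D + gb k n i x ?D \<omega> - c k * ?D\<bar> \<le> 2 * \<bar>L k\<bar> * h n powr (1 + \<alpha>)"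
          using \<psi>_lin[OF D, of k] elim(1) D by linarith
        then have "?\<Delta> * \<bar>\<psi> k x ?D + gb k n i x ?D \<omega> - c k * ?D\<bar> \<le> ?\<Delta> * (2 * \<bar>L k\<bar> * h n powr (1 + \<alpha>))"
          using K_nonneg by (intro mult_left_mono) auto
        moreover have "?\<Delta> * (\<psi> k x ?D + gb k n i x ?D \<omega>) - c k * h n * K2 (?D / h n)
            = ?\<Delta> * (\<psi> k x ?D + gb k n i x ?D \<omega> - c k * ?D)"
          using hp by (simp add: K2_def algebra_simps)
        ultimately show ?thesis using K_nonneg by (simp add: abs_mult ac_simps)
      qed
    qed
  qed (use K_nonneg K_le_sup in auto)
  have vec: "AE \<omega> in M. norm (Z n i \<omega> - p n i \<omega> *\<^sub>R r x - (h n * q n i \<omega>) *\<^sub>R w)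
      \<le> (2 * h n powr (1 + \<alpha>) * \<Lambda>) * p n i \<omega>"
    if i: "i \<in> {1..n}" and hn: "h n \<le> \<rho>'" for n i
  proof -
    have [measurable]: "D n i \<in> borel_measurable M" using D_meas[OF i] .
    have "subalgebra M (F n i)" using FF_version[OF i] by (auto simp: is_cond_exp_def)
    then interpret F: finite_measure_subalgebra M "F n i" by unfold_locales
    have "AE \<omega> in M. p n i \<omega> \<ge> 0" unfolding p_def
      using K_nonneg by (intro F.real_cond_exp_pos) auto
    moreover have "AE \<omega> in M. \<forall>k. \<bar>Z n i \<omega> \<bullet> e k - (r x \<bullet> e k) * p n i \<omega> - (c k * h n) * q n i \<omega>\<bar>
      \<le> (2 * \<bar>L k\<bar> * h n powr (1 + \<alpha>)) * p n i \<omega>"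
      using coord[OF i hn] by (subst AE_all_countable) simp
    ultimately show ?thesis
    proof eventually_elim
      case (elim \<omega>)
      let ?a = "2 * h n powr (1 + \<alpha>) * p n i \<omega>"
      have a: "?a \<ge> 0" using elim(1) by simp
      have sq: "(\<lambda>k. (?a * \<bar>L k\<bar>)\<^sup>2) = (\<lambda>k. ?a\<^sup>2 * (L k)\<^sup>2)" by (simp add: power_mult_distrib)
      have "norm (Z n i \<omega> - p n i \<omega> *\<^sub>R r x - (h n * q n i \<omega>) *\<^sub>R w) \<le> sqrt (\<Sum>k. (?a * \<bar>L k\<bar>)\<^sup>2)"
      proof (rule norm_le_of_coefficients_le[OF basis])
        fix k
        have "(Z n i \<omega> - p n i \<omega> *\<^sub>R r x - (h n * q n i \<omega>) *\<^sub>R w) \<bullet> e k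
            = Z n i \<omega> \<bullet> e k - (r x \<bullet> e k) * p n i \<omega> - (c k * h n) * q n i \<omega>"
          by (simp add: inner_diff_left w_inner)
        then show "\<bar>(Z n i \<omega> - p n i \<omega> *\<^sub>R r x - (h n * q n i \<omega>) *\<^sub>R w) \<bullet> e k\<bar> \<le> ?a * \<bar>L k\<bar>"
          using elim(2)[rule_format, of k] by (simp add: ac_simps)
        show "summable (\<lambda>k. (?a * \<bar>L k\<bar>)\<^sup>2)" unfolding sq by (intro summable_mult L_sum)
      qed
      also have "(\<Sum>k. (?a * \<bar>L k\<bar>)\<^sup>2) = ?a\<^sup>2 * (\<Sum>k. (L k)\<^sup>2)"
        unfolding sq by (rule suminf_mult[OF L_sum])
      also have "sqrt \<dots> = ?a * \<Lambda>" using a by (simp add: real_sqrt_mult \<Lambda>_def)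
      finally show ?case by (simp add: ac_simps)
    qed
  qed
  have vec_all: "AE \<omega> in M. \<forall>n. h n \<le> \<rho>' \<longrightarrow> (\<forall>i\<in>{1..n}.
      norm (Z n i \<omega> - p n i \<omega> *\<^sub>R r x - (h n * q n i \<omega>) *\<^sub>R w) \<le> (2 * h n powr (1 + \<alpha>) * \<Lambda>) * p n i \<omega>)"
  proof (subst AE_all_countable, rule allI)
    fix n
    show "AE \<omega> in M. h n \<le> \<rho>' \<longrightarrow> (\<forall>i\<in>{1..n}.
      norm (Z n i \<omega> - p n i \<omega> *\<^sub>R r x - (h n * q n i \<omega>) *\<^sub>R w) \<le> (2 * h n powr (1 + \<alpha>) * \<Lambda>) * p n i \<omega>)"
    proof (cases "h n \<le> \<rho>'")
      case True
      then have "AE \<omega> in M. \<forall>i\<in>{1..n}.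
        norm (Z n i \<omega> - p n i \<omega> *\<^sub>R r x - (h n * q n i \<omega>) *\<^sub>R w) \<le> (2 * h n powr (1 + \<alpha>) * \<Lambda>) * p n i \<omega>"
        using vec by (subst AE_ball_countable) auto
      then show ?thesis by eventually_elim simp
    qed simp
  qed
  show thesis by (rule that[OF \<rho>'_pos vec_all])
qed

section \<open>Bias and remainder of the regression estimator\<close>

text \<open>The common denominator of the three estimators, which cancels in \<open>Bn\<close>.\<close>

definition E0 where "E0 n = real n * (LINT \<omega>|M. K (D 1 1 \<omega> / h n))"

lemma E0_lim: "(\<lambda>n. E0 n / v n) \<longlonglongrightarrow> A1"
proof (rule Lim_transform_eventually[OF K_mean_limit])
  show "eventually (\<lambda>n. (LINT \<omega>|M. K (D 1 1 \<omega> / h n)) / \<phi> (h n) = E0 n / v n) sequentially"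
    using eventually_gt_at_top[of 0] by eventually_elim (simp add: E0_def v_def)
qed

lemma E0_pos: "eventually (\<lambda>n. E0 n > 0) sequentially"
  using order_tendstoD(1)[OF E0_lim A1_pos] v_pos by eventually_elim (simp add: zero_less_divide_iff)

lemma rbar1_eq: "rbar1 M S d K X Y x h n \<omega> = (\<Sum>i=1..n. p n i \<omega>) / E0 n" for n \<omega>
  by (simp add: rbar1_def p_def F_def E0_def Delta_def[abs_def] D_def)

lemma rbar2_eq: "rbar2 M S d K X Y x h n \<omega> = (\<Sum>i=1..n. Z n i \<omega>) /\<^sub>R E0 n" for n \<omega>
  by (simp add: rbar2_def Z_def F_def E0_def Delta_def[abs_def] D_def)

lemma rhat1_eq: "rhat1 M d K X x h n \<omega> = (\<Sum>i=1..n. K (D n i \<omega> / h n)) / E0 n" for n \<omega>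
  by (simp add: rhat1_def E0_def Delta_def[abs_def] D_def)

text \<open>The bias is the \<open>p\<close>-weighted mean of the linearised increments, and \<open>\<Sum>q / \<Sum>p\<close> tends to \<open>M0 / M1\<close>.\<close>

lemma bias_expansion: "AE \<omega> in M. (\<lambda>n. norm (Bn M S d K X Y r x h n \<omega> - (M0 K \<tau>0 / M1 K \<tau>0 * h n) *\<^sub>R w)) \<in> o(h)"
proof -
  obtain \<rho>' where \<rho>': "\<rho>' > 0" and linear: "AE \<omega> in M. \<forall>n. h n \<le> \<rho>' \<longrightarrow> (\<forall>i\<in>{1..n}.
      norm (Z n i \<omega> - p n i \<omega> *\<^sub>R r x - (h n * q n i \<omega>) *\<^sub>R w) \<le> (2 * h n powr (1 + \<alpha>) * \<Lambda>) * p n i \<omega>)"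
    by (rule linearisation_in_norm)
  show ?thesis
    using p_average_limit q_average_limit linear
  proof eventually_elim
    case (elim \<omega>)
    define P where "P n = (\<Sum>i=1..n. p n i \<omega>)" for n
    define Q where "Q n = (\<Sum>i=1..n. q n i \<omega>)" for n
    have P_pos: "eventually (\<lambda>n. P n > 0) sequentially"
      using order_tendstoD(1)[OF elim(1) A1_pos] v_pos
      by eventually_elim (simp add: P_def zero_less_divide_iff)
    have "(\<lambda>n. (Q n / v n) / (P n / v n)) \<longlonglongrightarrow> A0 / A1"
      unfolding P_def Q_def using A1_pos by (intro tendsto_divide elim) auto
    moreover have "eventually (\<lambda>n. (Q n / v n) / (P n / v n) = Q n / P n) sequentially"
      using v_pos by eventually_elim simp
    ultimately have "(\<lambda>n. Q n / P n) \<longlonglongrightarrow> A0 / A1" by (rule Lim_transform_eventually)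
    then have QP: "(\<lambda>n. Q n / P n) \<longlonglongrightarrow> M0 K \<tau>0 / M1 K \<tau>0" using f1_pos by (simp add: A0_def A1_def)
    have "eventually (\<lambda>n. h n < \<rho>') sequentially" using A5_h \<rho>' by (rule order_tendstoD)
    with P_pos E0_pos h_ev
    have ub: "eventually (\<lambda>n. norm (Bn M S d K X Y r x h n \<omega> - (M0 K \<tau>0 / M1 K \<tau>0 * h n) *\<^sub>R w) / h n
        \<le> 2 * h n powr \<alpha> * \<Lambda> + \<bar>Q n / P n - M0 K \<tau>0 / M1 K \<tau>0\<bar> * norm w) sequentially"
    proof eventually_elim
      case n: (elim n)
      have "Bn M S d K X Y r x h n \<omega> = (\<Sum>i=1..n. Z n i \<omega>) /\<^sub>R P n - r x"
        using n(2) by (simp add: Bn_def rbar1_eq rbar2_eq P_def divide_inverse)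
      moreover have "norm ((\<Sum>i=1..n. Z n i \<omega>) /\<^sub>R P n - r x - (h n * (Q n / P n)) *\<^sub>R w) \<le> 2 * h n powr (1 + \<alpha>) * \<Lambda>"
        unfolding P_def Q_def using elim(3) n by (intro weighted_mean_deviation_le) (auto simp: P_def)
      ultimately have 1: "norm (Bn M S d K X Y r x h n \<omega> - (h n * (Q n / P n)) *\<^sub>R w) \<le> 2 * h n powr (1 + \<alpha>) * \<Lambda>"
        by simp
      define \<mu> where "\<mu> = M0 K \<tau>0 / M1 K \<tau>0"
      define y where "y = Q n / P n"
      have split: "Bn M S d K X Y r x h n \<omega> - (\<mu> * h n) *\<^sub>R w
          = (Bn M S d K X Y r x h n \<omega> - (h n * y) *\<^sub>R w) + (h n * (y - \<mu>)) *\<^sub>R w"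
        by (simp add: algebra_simps)
      have "norm (Bn M S d K X Y r x h n \<omega> - (\<mu> * h n) *\<^sub>R w)
          \<le> 2 * h n powr (1 + \<alpha>) * \<Lambda> + norm ((h n * (y - \<mu>)) *\<^sub>R w)"
        unfolding split by (rule order.trans[OF norm_triangle_ineq add_right_mono[OF 1[folded y_def]]])
      moreover have "norm ((h n * (y - \<mu>)) *\<^sub>R w) = h n * (\<bar>y - \<mu>\<bar> * norm w)"
        using n(3) by (simp add: abs_mult)
      moreover have "h n powr (1 + \<alpha>) = h n * h n powr \<alpha>" using n(3) by (simp add: powr_add)
      ultimately have "norm (Bn M S d K X Y r x h n \<omega> - (\<mu> * h n) *\<^sub>R w)
          \<le> (2 * h n powr \<alpha> * \<Lambda> + \<bar>y - \<mu>\<bar> * norm w) * h n"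
        by (simp add: algebra_simps)
      then show ?case using n(3) by (simp add: divide_le_eq \<mu>_def y_def)
    qed
    have "(\<lambda>n. 2 * h n powr \<alpha> * \<Lambda> + \<bar>Q n / P n - M0 K \<tau>0 / M1 K \<tau>0\<bar> * norm w) \<longlonglongrightarrow>
        2 * 0 * \<Lambda> + \<bar>M0 K \<tau>0 / M1 K \<tau>0 - M0 K \<tau>0 / M1 K \<tau>0\<bar> * norm w"
    proof (rule tendsto_add[OF tendsto_mult[OF tendsto_mult[OF tendsto_const] tendsto_const]
          tendsto_mult[OF tendsto_rabs[OF tendsto_diff[OF QP tendsto_const]] tendsto_const]])
      show "(\<lambda>n. h n powr \<alpha>) \<longlonglongrightarrow> 0"
      proof -
        have "eventually (\<lambda>n. 0 \<le> h n) sequentially" using h_ev by eventually_elim simp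
        from tendsto_powr2[OF A5_h tendsto_const this \<alpha>(1)] show ?thesis using \<alpha> by simp
      qed
    qed
    then have zero: "(\<lambda>n. 2 * h n powr \<alpha> * \<Lambda> + \<bar>Q n / P n - M0 K \<tau>0 / M1 K \<tau>0\<bar> * norm w) \<longlonglongrightarrow> 0"
      by simp
    have "eventually (\<lambda>n. 0 \<le> norm (Bn M S d K X Y r x h n \<omega> - (M0 K \<tau>0 / M1 K \<tau>0 * h n) *\<^sub>R w) / h n) sequentially"
      using h_ev by eventually_elim simp
    from tendsto_sandwich[OF this ub tendsto_const zero]
    have "(\<lambda>n. norm (Bn M S d K X Y r x h n \<omega> - (M0 K \<tau>0 / M1 K \<tau>0 * h n) *\<^sub>R w) / h n) \<longlonglongrightarrow> 0" .
    moreover have "eventually (\<lambda>n. h n \<noteq> 0) sequentially" using h_ev by eventually_elim simp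
    ultimately show ?case by (rule smalloI_tendsto)
  qed
qed

lemma kernel_sum_deviation_bigo: "AE \<omega> in M. (\<lambda>n. (\<Sum>i=1..n. K (D n i \<omega> / h n)) - (\<Sum>i=1..n. p n i \<omega>))
    \<in> O(\<lambda>n. sqrt (ln (real n) * v n))"
  unfolding p_def F_def
proof (rule centred_triangular_sum_bigo[OF prob])
  show "subalgebra M (Fsig M S X Y n (i - 1))" if "i \<in> {1..n}" for n i
    using FF_version[OF that] by (auto simp: is_cond_exp_def F_def)
  show "sets (Fsig M S X Y n i) \<subseteq> sets (Fsig M S X Y n j)" if "i \<le> j" for n i j
    using that by (rule sets_Fsig_mono)
  show "(\<lambda>\<omega>. K (D n i \<omega> / h n)) \<in> borel_measurable (Fsig M S X Y n j)" if "1 \<le> i" "i \<le> j" for n i j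
  proof -
    have [measurable]: "D n i \<in> borel_measurable (Fsig M S X Y n j)"
      unfolding D_def[abs_def] using that
      by (intro measurable_compose[OF measurable_Fsig[OF S_space] S_dist[rule_format]]) auto
    show ?thesis by measurable
  qed
  show "(\<lambda>\<omega>. K (D n i \<omega> / h n)) \<in> borel_measurable M" if "i \<in> {1..n}" for n i
    using D_meas[OF that] by measurable
  show "K (D n i \<omega> / h n) \<in> {0..Ksup}" for n i \<omega> using K_nonneg K_le_sup by simp
  show "AE \<omega> in M. \<exists>C. eventually (\<lambda>n. (\<Sum>i=1..n. real_cond_exp M (Fsig M S X Y n (i - 1))
      (\<lambda>\<omega>. K (D n i \<omega> / h n)) \<omega>) \<le> C * v n) sequentially"
    using p_average_limit
  proof eventually_elim
    case (elim \<omega>)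
    have "eventually (\<lambda>n. (\<Sum>i=1..n. p n i \<omega>) / v n < A1 + 1) sequentially"
      using elim by (rule order_tendstoD) simp
    with v_pos have "eventually (\<lambda>n. (\<Sum>i=1..n. p n i \<omega>) \<le> (A1 + 1) * v n) sequentially"
      by eventually_elim (simp add: divide_less_eq)
    then show ?case unfolding p_def F_def by blast
  qed
qed (use v_pos log_over_v_limit in auto)

lemma remainder_bigo: "AE \<omega> in M. (\<lambda>n. norm (Rn M S d K X Y r x h n \<omega>))
      \<in> O(\<lambda>n. h n * ln (real n) powr (1/2) * (real n * \<phi> (h n)) powr (- 1/2))"
  using bias_expansion kernel_sum_deviation_bigo
proof eventually_elim
  case (elim \<omega>)
  define S1 where "S1 n = (\<Sum>i=1..n. K (D n i \<omega> / h n)) - (\<Sum>i=1..n. p n i \<omega>)" for n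
  define m where "m n = (M0 K \<tau>0 / M1 K \<tau>0 * h n) *\<^sub>R w" for n
  define bn where "bn n = Bn M S d K X Y r x h n \<omega>" for n
  have "(\<lambda>n. norm (m n)) \<in> O(h)"
    by (rule bigoI[where c = "\<bar>M0 K \<tau>0 / M1 K \<tau>0\<bar> * norm w"]) (simp add: m_def abs_mult ac_simps)
  moreover have "(\<lambda>n. norm (bn n - m n)) \<in> O(h)"
    using elim(1) unfolding bn_def m_def by (rule landau_o.small_imp_big)
  ultimately have "(\<lambda>n. norm (bn n - m n) + norm (m n)) \<in> O(h)" by (rule sum_in_bigo(1)[rotated])
  moreover have "(\<lambda>n. norm (bn n)) \<in> O(\<lambda>n. norm (bn n - m n) + norm (m n))"
  proof (intro bigoI[where c = 1] always_eventually allI)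
    fix n
    show "norm (norm (bn n)) \<le> 1 * norm (norm (bn n - m n) + norm (m n))"
      using norm_triangle_sub[of "bn n" "m n"] by simp
  qed
  ultimately have B_O: "(\<lambda>n. norm (Bn M S d K X Y r x h n \<omega>)) \<in> O(h)"
    unfolding bn_def by (rule landau_o.big_trans[rotated])
  have E_O: "(\<lambda>n. 1 / E0 n) \<in> O(\<lambda>n. 1 / v n)"
  proof (rule bigoI_tendsto)
    have "(\<lambda>n. inverse (E0 n / v n)) \<longlonglongrightarrow> inverse A1" using A1_pos by (intro tendsto_inverse E0_lim) simp
    then show "(\<lambda>n. 1 / E0 n / (1 / v n)) \<longlonglongrightarrow> inverse A1" by (simp add: field_simps)
    show "eventually (\<lambda>n. 1 / v n \<noteq> 0) sequentially" using v_pos by eventually_elim simp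
  qed
  have "(\<lambda>n. S1 n * (1 / E0 n) * norm (Bn M S d K X Y r x h n \<omega>))
      \<in> O(\<lambda>n. sqrt (ln (real n) * v n) * (1 / v n) * h n)"
    using elim(2) unfolding S1_def by (intro landau_o.big_mult B_O E_O)
  then have "(\<lambda>n. norm (S1 n * (1 / E0 n) * norm (Bn M S d K X Y r x h n \<omega>)))
      \<in> O(\<lambda>n. sqrt (ln (real n) * v n) * (1 / v n) * h n)"
    by (simp only: real_norm_def landau_o.big.abs_in_iff)
  moreover have "norm (Rn M S d K X Y r x h n \<omega>) = norm (S1 n * (1 / E0 n) * norm (Bn M S d K X Y r x h n \<omega>))" for n
    by (simp add: Rn_def rhat1_eq rbar1_eq S1_def abs_mult flip: diff_divide_distrib)
  moreover have "eventually (\<lambda>n. sqrt (ln (real n) * v n) * (1 / v n) * h n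
      = h n * ln (real n) powr (1/2) * (real n * \<phi> (h n)) powr (- 1/2)) sequentially"
    using v_pos eventually_ge_at_top[of 1]
  proof eventually_elim
    case (elim n)
    have 1: "sqrt (v n) * (1 / v n) = 1 / sqrt (v n)"
      using elim(1) by (simp add: sqrt_divide_self_eq inverse_eq_divide)
    have 2: "v n powr (- 1/2) = 1 / sqrt (v n)"
      using elim(1) by (simp add: powr_minus_divide powr_half_sqrt)
    have 3: "ln (real n) powr (1/2) = sqrt (ln (real n))"
      using elim(2) by (intro powr_half_sqrt) simp
    have "sqrt (ln (real n) * v n) * (1 / v n) * h n = h n * sqrt (ln (real n)) * (sqrt (v n) * (1 / v n))"
      by (simp add: real_sqrt_mult)
    then show ?case unfolding v_def[symmetric] 1 2 3 .
  qed
  ultimately show ?case by (simp add: landau_o.big.cong)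
qed

end

theorem lemma3p6:
  fixes M :: "'w measure"
    and S :: "'e measure"
    and d :: "'e \<Rightarrow> 'e \<Rightarrow> real"
    and e :: "nat \<Rightarrow> 'h::{real_inner, banach, second_countable_topology}"
    and X :: "nat \<Rightarrow> nat \<Rightarrow> 'w \<Rightarrow> 'e"
    and Y :: "nat \<Rightarrow> nat \<Rightarrow> 'w \<Rightarrow> 'h"
    and r :: "'e \<Rightarrow> 'h"
    and rv :: "'h \<Rightarrow> 'e \<Rightarrow> real"
    and x :: 'e
    and K \<phi> \<tau>0 :: "real \<Rightarrow> real"
    and h b :: "nat \<Rightarrow> real"
    and \<alpha> Lbar :: real
    and Lt :: "nat \<Rightarrow> nat \<Rightarrow> real"
    and FF :: "nat \<Rightarrow> nat \<Rightarrow> 'e \<Rightarrow> real \<Rightarrow> 'w \<Rightarrow> real"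
    and fr :: "nat \<Rightarrow> nat \<Rightarrow> 'e \<Rightarrow> 'w \<Rightarrow> real"
    and g :: "nat \<Rightarrow> nat \<Rightarrow> 'e \<Rightarrow> real \<Rightarrow> 'w \<Rightarrow> real"
    and f1 :: "'e \<Rightarrow> real"
    and \<psi> :: "nat \<Rightarrow> 'e \<Rightarrow> real \<Rightarrow> real"
    and gb :: "nat \<Rightarrow> nat \<Rightarrow> nat \<Rightarrow> 'e \<Rightarrow> real \<Rightarrow> 'w \<Rightarrow> real"
    and L :: "nat \<Rightarrow> real"
  assumes prob: "prob_space M"
    and pm: "pseudometric d"
    and S_space: "space S = UNIV"
    and S_dist: "\<forall>y. d y \<in> borel_measurable S"
    and basis: "orthonormal_basis e"
    and X_meas: "\<forall>n. \<forall>i\<in>{1..n}. X n i \<in> M \<rightarrow>\<^sub>M S"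
    and Y_meas: "\<forall>n. \<forall>i\<in>{1..n}. Y n i \<in> borel_measurable M"
    and same_distr: "\<forall>n. \<forall>i\<in>{1..n}.
      distr M (S \<Otimes>\<^sub>M borel) (\<lambda>\<omega>. (X n i \<omega>, Y n i \<omega>)) =
      distr M (S \<Otimes>\<^sub>M borel) (\<lambda>\<omega>. (X 1 1 \<omega>, Y 1 1 \<omega>))"
    and r: "is_regression M S (X 1 1) (Y 1 1) r"
    and rv: "\<forall>v. is_regression M S (X 1 1) (\<lambda>\<omega>. Y 1 1 \<omega> \<bullet> v) (rv v)"
    and rv_r: "\<forall>v y. rv v y = r y \<bullet> v"
    and FF: "\<forall>n. \<forall>i\<in>{1..n}. \<forall>y u.
      is_cond_exp M (Fsig M S X Y n (i - 1)) (\<lambda>\<omega>. indicat_real {..u} (d y (X n i \<omega>))) (FF n i y u)"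
    and h_pos: "\<forall>n\<ge>1. h n > 0"
    and b_pos: "\<forall>n\<ge>1. b n > 0"
    \<comment> \<open>(A1)\<close>
    and K_nonneg: "\<forall>t. 0 \<le> K t"
    and K_bounded: "bounded (range K)"
    and K_support: "closure {t. K t \<noteq> 0} = {0..1}"
    and K_diff: "K differentiable_on {0..1}"
    and K_C1: "continuous_on {0..1} (deriv01 K)"
    and K_decr: "\<forall>t\<in>{0..1}. deriv01 K t \<le> 0"
    and K_1: "K 1 > 0"
    \<comment> \<open>(A2)(i)\<close>
    and \<alpha>: "0 < \<alpha>" "\<alpha> \<le> 1"
    and Lt_nonneg: "\<forall>n. \<forall>i\<in>{1..n}. 0 \<le> Lt n i"
    and A2i_Hoelder: "\<exists>\<delta>>0. \<forall>n. \<forall>i\<in>{1..n}. AE \<omega> in M. \<forall>u\<in>{0<..<\<delta>}. \<forall>y1 y2.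
      \<bar>FF n i y1 u \<omega> - FF n i y2 u \<omega>\<bar> / FF n i x u \<omega> \<le> Lt n i * d y1 y2 powr \<alpha>"
    and A2i_incr: "\<exists>\<delta>>0. \<forall>n. \<forall>i\<in>{1..n}. AE \<omega> in M. \<forall>u\<in>{0<..<\<delta>}. \<forall>\<epsilon>\<in>{0..<u}.
      (FF n i x (u + \<epsilon>) \<omega> - FF n i x (u - \<epsilon>) \<omega>) / FF n i x u \<omega> \<le> Lt n i * \<epsilon> * inverse u"
    and A2i_limsup: "limsup (\<lambda>n. ereal ((\<Sum>i=1..n. (Lt n i)\<^sup>2) / real n)) = ereal Lbar"
    \<comment> \<open>the functionals of (A2)\<close>
    and fr_meas: "\<forall>n. \<forall>i\<in>{1..n}. \<forall>y. fr n i y \<in> borel_measurable M"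
    and fr_bounded: "\<forall>n. \<forall>i\<in>{1..n}. \<exists>C. \<forall>y. AE \<omega> in M. 0 \<le> fr n i y \<omega> \<and> fr n i y \<omega> \<le> C"
    and g_meas: "\<forall>n. \<forall>i\<in>{1..n}. \<forall>y u. g n i y u \<in> borel_measurable M"
    and f1_nonneg: "\<forall>y. 0 \<le> f1 y"
    and f1_bounded: "bounded (range f1)"
    and \<phi>_nonneg: "\<forall>u\<ge>0. 0 \<le> \<phi> u"
    and \<phi>_0: "(\<phi> \<longlongrightarrow> 0) (at_right 0)"
    \<comment> \<open>(A2)(ii)\<close>
    and A2ii: "\<forall>y. (\<lambda>u. small_ball M d X y u - \<phi> u * f1 y) \<in> o[at_right 0](\<phi>)"
    \<comment> \<open>(A2)(iii)\<close>
    and A2iii_decomp: "\<forall>n. \<forall>i\<in>{1..n}. \<forall>y. \<forall>u>0. AE \<omega> in M.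
      FF n i y u \<omega> = \<phi> u * fr n i y \<omega> + g n i y u \<omega>"
    and A2iii_g: "\<forall>n. \<forall>i\<in>{1..n}. \<forall>y. AE \<omega> in M. (\<lambda>u. \<bar>g n i y u \<omega>\<bar>) \<in> o[at_right 0](\<phi>)"
    and A2iii_g_mean: "\<forall>y u. (\<forall>n. u n > 0) \<longrightarrow> u \<longlonglongrightarrow> 0 \<longrightarrow>
      (AE \<omega> in M. (\<lambda>n. (\<Sum>i=1..n. \<bar>g n i y (u n) \<omega>\<bar>) / real n) \<in> o(\<lambda>n. \<phi> (u n)))"
    and A2iii_bounds: "\<exists>\<delta>>0. \<forall>n. \<forall>i\<in>{1..n}. \<forall>y\<in>pm_cball d x \<delta>.
      Linf_norm M (fr n i y) \<le> ereal (Lt n i) \<and>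
      (\<forall>u\<in>{0<..\<delta>}. ereal (inverse (\<phi> u)) * Linf_norm M (g n i y u) \<le> ereal (Lt n i))"
    \<comment> \<open>(A2)(iv)\<close>
    and A2iv: "AE \<omega> in M. (\<lambda>n. (\<Sum>i=1..n. fr n i x \<omega>) / real n) \<longlonglongrightarrow> f1 x"
    and f1_pos: "f1 x > 0"
    \<comment> \<open>(A2)(v)\<close>
    and \<tau>0_range: "\<tau>0 ` {0..1} \<subseteq> {0..1}"
    and A2v: "uniform_limit {0..1} (\<lambda>\<eta> u. \<phi> (\<eta> * u) / \<phi> \<eta>) \<tau>0 (at_right 0)"
    \<comment> \<open>(A3)(i)\<close>
    and A3i: "\<forall>n. \<forall>i\<in>{1..n}. is_cond_exp M (Gsig M S X Y n (i - 1)) (Y n i) (\<lambda>\<omega>. r (X n i \<omega>))"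
    \<comment> \<open>(A4)(i)\<close>
    and A4_cont: "\<forall>k. pm_continuous d (rv (e k))"
    and \<psi>_meas: "\<forall>k y. \<psi> k y \<in> borel_measurable borel"
    and gb_meas: "\<forall>k n. \<forall>i\<in>{1..n}. \<forall>y.
      (\<lambda>(\<omega>, s). gb k n i y s \<omega>) \<in> borel_measurable (Fsig M S X Y n (i - 1) \<Otimes>\<^sub>M borel)"
    and A4_cond: "\<forall>k n. \<forall>i\<in>{1..n}. \<forall>y.
      is_cond_exp M (FDsig M S d X Y y n i)
        (\<lambda>\<omega>. rv (e k) (X n i \<omega>) - rv (e k) y)
        (\<lambda>\<omega>. \<psi> k y (d y (X n i \<omega>)) + gb k n i y (d y (X n i \<omega>)) \<omega>)"
    and \<psi>_0: "\<forall>k y. \<psi> k y 0 = 0"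
    and A4_nhd: "\<exists>\<rho>>0.
      (\<forall>k. \<forall>y\<in>pm_cball d x \<rho>.
        (\<forall>s\<in>{0..\<rho>}. \<psi> k y differentiable (at s within {0..})) \<and> deriv_nonneg (\<psi> k y) 0 \<noteq> 0) \<and>
      (\<forall>k. \<forall>s\<in>{0<..\<rho>}. \<forall>u\<in>{0..s}. \<forall>y\<in>pm_cball d x s. \<forall>n. \<forall>i\<in>{1..n}.
        ereal (\<bar>deriv_nonneg (\<psi> k y) u - deriv_nonneg (\<psi> k x) 0\<bar> * s) + Linf_norm M (gb k n i y s)
          \<le> ereal (L k * s powr (1 + \<alpha>)))"
    and A4_sum: "summable (\<lambda>k. (deriv_nonneg (\<psi> k x) 0)\<^sup>2 + (L k)\<^sup>2)"
    \<comment> \<open>(A5)\<close>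
    and A5_h: "h \<longlonglongrightarrow> 0"
    and A5_b: "b \<longlonglongrightarrow> 0"
    and A5_hb: "(\<lambda>n. h n / b n) \<longlonglongrightarrow> 0"
    and A5_log: "filterlim
      (\<lambda>n. (real n * \<phi> (h n)) powr (1/2) * ln (real n) powr (- max (2 + \<alpha>) (1/2))) at_top sequentially"
    and A5_ratio: "(\<lambda>n. \<phi> (h n) / \<phi> (b n) * (ln (real n))\<^sup>2) \<in> o(\<lambda>_. 1)"
    and A5_h_rate: "(\<lambda>n. h n * (real n * \<phi> (h n)) powr (1/2)) \<in> O(\<lambda>_. 1)"
    and A5_b_rate: "(\<lambda>n. b n powr (1 + \<alpha>) * (real n * \<phi> (h n)) powr (1/2)) \<in> o(\<lambda>_. 1)"
    and A5_b_h: "b \<in> o(\<lambda>n. h n * sqrt (real n * \<phi> (h n)))"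
    and A5_h_log: "(\<lambda>n. h n * ln (real n) powr (1/2)) \<in> o(\<lambda>_. 1)"
  shows "(AE \<omega> in M.
      (\<lambda>n. norm (Bn M S d K X Y r x h n \<omega>
          - (M0 K \<tau>0 / M1 K \<tau>0 * h n) *\<^sub>R (\<Sum>k. deriv_nonneg (\<psi> k x) 0 *\<^sub>R e k))) \<in> o(h)) \<and>
    (AE \<omega> in M.
      (\<lambda>n. norm (Rn M S d K X Y r x h n \<omega>))
        \<in> O(\<lambda>n. h n * ln (real n) powr (1/2) * (real n * \<phi> (h n)) powr (- 1/2)))"
proof -
  interpret functional_regression_array M S d e X Y r rv x K \<phi> \<tau>0 h b \<alpha> Lbar Lt FF fr g f1 \<psi> gb L
    by (rule functional_regression_array.intro) (fact assms)+
  show ?thesis using bias_expansion remainder_bigo unfolding w_def c_def by blast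
qed

end
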